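(* Let $H$ be a real separable Hilbert space and $Y$ a real or complex separable Hilbert space. Suppose that $-A$ generates a $C_0$-contraction semigroup $(S(t))_{t\ge0}$ on $Y$, let $F:Y\to Y$ and $G:Y\to\mathcal{L}_2(H,Y)$ be Borel measurable, and suppose that for some $q\in[2,\infty)$ there is $C_q\ge0$ such that for all $x\in Y$ $$\mathrm{Re}\,\langle x,F(x)\rangle_Y+\frac{q-1}{2}\|G(x)\|_{\mathcal{L}_2(H,Y)}^2\le C_q(1+\|x\|_Y^2).$$ Let $\theta\in(0,\frac14]$ and $u_0\in L^q_{\mathcal{F}_0}(\Omega;Y)$. Then the nonlinearities-stopped exponential Euler scheme with parameter $\theta$ is pointwise stable in $Y$. That is, for all $T>0$ there exists a constant $C_{T,q}\ge0$ independent of $k$, $N$, and $\theta$ such that $$\sup_{t\in[0,T]}\|\hat U(t)\|_{L^q(\Omega;Y)}\le C_{T,q}\big(1+\|u_0\|_{L^q(\Omega;Y)}\big)<\infty.$$ In particular, the same bound holds for $\max_{j=0,\ldots,N}\|U^j\|_{L^q(\Omega;Y)}$ and $\sup_{t\in[0,T]}\|U^k(t)\|_{L^q(\Omega;Y)}$.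
   Context: $(\Omega,\mathcal{F},(\mathcal{F}_t)_{t\in[0,T]},\mathbb{P})$ is a filtered probability space satisfying the usual conditions. $W_H$ is an $H$-cylindrical Brownian motion adapted to $(\mathcal{F}_t)$: a mapping $W_H:L^2(0,T;H)\to L^2(\Omega)$ such that $W_Hb$ is Gaussian, $\mathbb{E}(W_Hb_1\,W_Hb_2)=\langle b_1,b_2\rangle_{L^2(0,T;H)}$, $W_Hb$ is $\mathcal{F}_t$-measurable if $b$ is supported in $[0,t]$ and independent of $\mathcal{F}_s$ if $b$ is supported in $[s,T]$; $W_H(t)h:=W_H(\mathbf{1}_{(0,t)}\otimes h)$. $\mathcal{L}_2(H,Y)$ denotes the Hilbert--Schmidt operators from $H$ to $Y$. $L^q_{\mathcal{F}_0}(\Omega;Y)$ denotes the $\mathcal{F}_0$-measurable elements of $L^q(\Omega;Y)$. Scheme: for $N\in\mathbb{N}$ let $k=T/N$ and $t_j=jk$, $0\le j\le N$. Set $U^0=u_0$ and, for $0\le j\le N-1$, $$U^{j+1}=S(k)U^j+kS(k)\mathbf{1}_{\theta,j}F(U^j)+S(k)\mathbf{1}_{\theta,j}G(U^j)\Delta W_{j+1},$$ where $\mathbf{1}_{\theta,j}=\mathbf{1}_{\{\|F(U^j)\|_Y+\|G(U^j)\|_{\mathcal{L}_2(H,Y)}\le k^{-\theta}\}}$ and, for an orthonormal basis $(h_n)_n$ of $H$, $R\,\Delta W_{j+1}:=\sum_n(W_H(t_{j+1})h_n-W_H(t_j)h_n)Rh_n$. Piecewise constant extension: $U^k(s)=U^j$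 for $s\in[t_j,t_{j+1})$, $0\le j\le N-1$, $U^k(T)=U^N$. Continuous extension: $\hat U(T)=U^N$ and, for $t\in[t_j,t_{j+1})$, $0\le j\le N-1$, $$\hat U(t)=S(t-t_j)\Big[U^j+(t-t_j)\mathbf{1}_{\theta,j}F(U^j)+\int_{t_j}^t\mathbf{1}_{\theta,j}G(U^j)\,\mathrm{d}W_H(s)\Big].$$ *)

theory Defs
  imports "HOL-Probability.Probability"
begin

section \<open>Real or complex Hilbert spaces\<close>

text \<open>
  A complex Hilbert space is treated through its underlying real Hilbert space, which is carried by
  the type, together with the scalar multiplication \<open>sc\<close> by elements of the scalar field \<open>K\<close>
  (\<open>K = \<real>\<close> or \<open>K = UNIV\<close>, inside the complex numbers) and the \<open>K\<close>-valued inner product \<open>ip\<close>, which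
  is linear in the first argument. Polarization gives \<open>Re (ip x y) = x \<bullet> y\<close>. For \<open>K = \<real>\<close> one has
  \<open>sc (complex_of_real r) x = r *\<^sub>R x\<close> and \<open>ip x y = complex_of_real (x \<bullet> y)\<close>.
\<close>

definition hilbert_scalars ::
  "complex set \<Rightarrow> (complex \<Rightarrow> 'y::real_inner \<Rightarrow> 'y) \<Rightarrow> ('y \<Rightarrow> 'y \<Rightarrow> complex) \<Rightarrow> bool" where
  "hilbert_scalars K sc ip \<longleftrightarrow>
     (K = \<real> \<or> K = UNIV) \<and>
     (\<forall>r x. sc (complex_of_real r) x = r *\<^sub>R x) \<and>
     (\<forall>c\<in>K. \<forall>x y. sc c (x + y) = sc c x + sc c y) \<and>
     (\<forall>c\<in>K. \<forall>d\<in>K. \<forall>x. sc (c + d) x = sc c x + sc d x \<and> sc (c * d) x = sc c (sc d x)) \<and>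
     (\<forall>x y. ip x y \<in> K) \<and>
     (\<forall>x y z. ip (x + y) z = ip x z + ip y z) \<and>
     (\<forall>c\<in>K. \<forall>x y. ip (sc c x) y = c * ip x y) \<and>
     (\<forall>x y. ip y x = cnj (ip x y)) \<and>
     (\<forall>x. ip x x = complex_of_real ((norm x)\<^sup>2))"

section \<open>Contraction semigroups\<close>

definition C0_contraction_semigroup ::
  "complex set \<Rightarrow> (complex \<Rightarrow> 'y \<Rightarrow> 'y) \<Rightarrow> (real \<Rightarrow> 'y::real_normed_vector \<Rightarrow>\<^sub>L 'y) \<Rightarrow> bool" where
  "C0_contraction_semigroup K sc S \<longleftrightarrow>
     (\<forall>t\<ge>0. \<forall>c\<in>K. \<forall>x. S t (sc c x) = sc c (S t x)) \<and>
     S 0 = id_blinfun \<and>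
     (\<forall>s\<ge>0. \<forall>t\<ge>0. S (s + t) = S s o\<^sub>L S t) \<and>
     (\<forall>x. ((\<lambda>t. S t x) \<longlongrightarrow> x) (at_right 0)) \<and>
     (\<forall>t\<ge>0. norm (S t) \<le> 1)"

text \<open>The graph of the infinitesimal generator.\<close>

definition generator_graph :: "(real \<Rightarrow> 'y::real_normed_vector \<Rightarrow>\<^sub>L 'y) \<Rightarrow> ('y \<times> 'y) set" where
  "generator_graph S = {(x, y). ((\<lambda>t. (1 / t) *\<^sub>R (S t x - x)) \<longlongrightarrow> y) (at_right 0)}"

section \<open>Hilbert--Schmidt operators\<close>

definition orthonormal_basis :: "'h::real_inner set \<Rightarrow> bool" where
  "orthonormal_basis B \<longleftrightarrow>
     pairwise orthogonal B \<and> (\<forall>h\<in>B. norm h = 1) \<and> closure (span B) = UNIV"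

text \<open>
  The basis \<open>B\<close> occurs as a parameter below; the notions do not depend on its choice.
  On operators that are not Hilbert--Schmidt the value of \<open>hs_norm\<close> is meaningless.
\<close>

definition hs_ops :: "'h::real_inner set \<Rightarrow> ('h \<Rightarrow>\<^sub>L 'y::real_normed_vector) set" where
  "hs_ops B = {R. (\<lambda>h. (norm (blinfun_apply R h))\<^sup>2) summable_on B}"

definition hs_norm :: "'h::real_inner set \<Rightarrow> ('h \<Rightarrow>\<^sub>L 'y::real_normed_vector) \<Rightarrow> real" where
  "hs_norm B R = sqrt (\<Sum>\<^sub>\<infinity>h\<in>B. (norm (blinfun_apply R h))\<^sup>2)"

definition hs_open :: "'h::real_inner set \<Rightarrow> ('h \<Rightarrow>\<^sub>L 'y::real_normed_vector) set \<Rightarrow> bool" where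
  "hs_open B V \<longleftrightarrow> V \<subseteq> hs_ops B \<and>
     (\<forall>R\<in>V. \<exists>e>0. \<forall>Q\<in>hs_ops B. hs_norm B (Q - R) < e \<longrightarrow> Q \<in> V)"

text \<open>The Borel sigma-algebra of the Hilbert--Schmidt norm, on the space of Hilbert--Schmidt operators.\<close>

definition hs_borel :: "'h::real_inner set \<Rightarrow> ('h \<Rightarrow>\<^sub>L 'y::real_normed_vector) measure" where
  "hs_borel B = sigma (hs_ops B) {V. hs_open B V}"

section \<open>Filtered probability space and cylindrical Brownian motion\<close>

definition usual_filtered_prob_space :: "'w measure \<Rightarrow> (real \<Rightarrow> 'w measure) \<Rightarrow> real \<Rightarrow> bool" where
  "usual_filtered_prob_space M Fil T \<longleftrightarrow>
     prob_space M \<and> complete_measure M \<and>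
     (\<forall>t\<in>{0..T}. subalgebra M (Fil t)) \<and>
     (\<forall>s\<in>{0..T}. \<forall>t\<in>{s..T}. sets (Fil s) \<subseteq> sets (Fil t)) \<and>
     null_sets M \<subseteq> sets (Fil 0) \<and>
     (\<forall>t\<in>{0..<T}. sets (Fil t) = (\<Inter>s\<in>{t<..T}. sets (Fil s)))"

text \<open>
  Gaussian with arbitrary mean and possibly degenerate. For a cylindrical Brownian motion the mean
  is forced to be zero by the covariance and independence conditions together.
\<close>

definition gaussian_rv :: "'w measure \<Rightarrow> ('w \<Rightarrow> real) \<Rightarrow> bool" where
  "gaussian_rv M X \<longleftrightarrow> X \<in> borel_measurable M \<and>
     ((\<exists>m. AE w in M. X w = m) \<or>
      (\<exists>m s. s > 0 \<and> distributed M lborel X (normal_density m s)))"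

abbreviation time_measure :: "real \<Rightarrow> real measure" where
  "time_measure T \<equiv> restrict_space lborel {0..T}"

definition L2_time :: "real \<Rightarrow> (real \<Rightarrow> 'h::{real_inner, second_countable_topology}) set" where
  "L2_time T = {b. b \<in> borel_measurable (time_measure T) \<and>
                   integrable (time_measure T) (\<lambda>t. (norm (b t))\<^sup>2)}"

definition supported_in :: "real \<Rightarrow> (real \<Rightarrow> 'h::zero) \<Rightarrow> real set \<Rightarrow> bool" where
  "supported_in T b J \<longleftrightarrow> (AE t in time_measure T. t \<notin> J \<longrightarrow> b t = 0)"

text \<open>
  Elements of the \<open>L\<^sup>2\<close> spaces are represented by functions; \<open>W b\<close> is some representative of the
  random variable. The covariance identity makes \<open>W b\<close> depend, up to null sets, only on the
  equivalence class of \<open>b\<close>, and makes \<open>W\<close> linear up to null sets.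
\<close>

definition cylindrical_BM ::
  "'w measure \<Rightarrow> (real \<Rightarrow> 'w measure) \<Rightarrow> real \<Rightarrow>
   ((real \<Rightarrow> 'h::{real_inner, second_countable_topology}) \<Rightarrow> 'w \<Rightarrow> real) \<Rightarrow> bool" where
  "cylindrical_BM M Fil T W \<longleftrightarrow>
     (\<forall>b\<in>L2_time T. gaussian_rv M (W b) \<and> integrable M (\<lambda>w. (W b w)\<^sup>2)) \<and>
     (\<forall>b\<in>L2_time T. \<forall>c\<in>L2_time T.
        (\<integral>w. W b w * W c w \<partial>M) = (\<integral>t. b t \<bullet> c t \<partial>time_measure T)) \<and>
     (\<forall>t\<in>{0..T}. \<forall>b\<in>L2_time T. supported_in T b {0..t} \<longrightarrow> W b \<in> borel_measurable (Fil t)) \<and>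
     (\<forall>s\<in>{0..T}. \<forall>b\<in>L2_time T. supported_in T b {s..T} \<longrightarrow>
        prob_space.indep_set M (sets (Fil s)) (sets (vimage_algebra (space M) (W b) borel)))"

definition W_at :: "((real \<Rightarrow> 'h::real_vector) \<Rightarrow> 'w \<Rightarrow> real) \<Rightarrow> real \<Rightarrow> 'h \<Rightarrow> 'w \<Rightarrow> real" where
  "W_at W t h = W (\<lambda>s. indicator {0<..<t} s *\<^sub>R h)"

section \<open>Increments and stochastic integrals\<close>

text \<open>
  \<open>X\<close> is a version of \<open>R (W b - W a) = (\<Sum>h\<in>B. (W_at W b h - W_at W a h) *\<^sub>R R h)\<close>, the series
  converging unconditionally in \<open>L\<^sup>2\<close>. Here \<open>R\<close> is a random operator.
\<close>

definition is_increment ::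
  "'w measure \<Rightarrow> 'h::real_inner set \<Rightarrow> ((real \<Rightarrow> 'h) \<Rightarrow> 'w \<Rightarrow> real) \<Rightarrow> real \<Rightarrow> real \<Rightarrow>
   ('w \<Rightarrow> 'h \<Rightarrow>\<^sub>L 'y::{real_inner, banach, second_countable_topology}) \<Rightarrow> ('w \<Rightarrow> 'y) \<Rightarrow> bool" where
  "is_increment M B W a b R X \<longleftrightarrow> X \<in> borel_measurable M \<and>
     ((\<lambda>A. \<integral>\<^sup>+w. ennreal ((norm ((\<Sum>h\<in>A. (W_at W b h w - W_at W a h w) *\<^sub>R R w h) - X w))\<^sup>2) \<partial>M)
        \<longlongrightarrow> 0) (finite_subsets_at_top B)"

text \<open>
  A finite rank adapted step process is a list of tuples \<open>(a, b, A, h, y)\<close>, each representing the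
  process \<open>1\<^bsub>(a,b] \<times> A\<^esub> h \<otimes> y\<close>, where \<open>(h \<otimes> y) x = (h \<bullet> x) y\<close>.
\<close>

type_synonym ('w, 'h, 'y) step_process = "(real \<times> real \<times> 'w set \<times> 'h \<times> 'y) list"

definition adapted_step ::
  "(real \<Rightarrow> 'w measure) \<Rightarrow> real \<Rightarrow> ('w, 'h, 'y) step_process \<Rightarrow> bool" where
  "adapted_step Fil T e \<longleftrightarrow>
     (\<forall>(a, b, A, h, y)\<in>set e. 0 \<le> a \<and> a \<le> b \<and> b \<le> T \<and> A \<in> sets (Fil a))"

definition step_val ::
  "('w, 'h::real_inner, 'y::real_normed_vector) step_process \<Rightarrow> real \<Rightarrow> 'w \<Rightarrow> 'h \<Rightarrow>\<^sub>L 'y" where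
  "step_val e s w = (\<Sum>(a, b, A, h, y)\<leftarrow>e.
     (indicator {a<..b} s * indicator A w) *\<^sub>R (blinfun_scaleR_left y o\<^sub>L blinfun_inner_right h))"

definition step_integral ::
  "((real \<Rightarrow> 'h) \<Rightarrow> 'w \<Rightarrow> real) \<Rightarrow> ('w, 'h::real_inner, 'y::real_normed_vector) step_process \<Rightarrow>
   'w \<Rightarrow> 'y" where
  "step_integral W e w = (\<Sum>(a, b, A, h, y)\<leftarrow>e.
     (indicator A w * (W_at W b h w - W_at W a h w)) *\<^sub>R y)"

text \<open>\<open>I\<close> is a version of the Ito integral of \<open>\<Phi>\<close> over \<open>(a, b]\<close>.\<close>

definition has_ito_integral ::
  "'w measure \<Rightarrow> (real \<Rightarrow> 'w measure) \<Rightarrow> real \<Rightarrow> 'h::real_inner set \<Rightarrow>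
   ((real \<Rightarrow> 'h) \<Rightarrow> 'w \<Rightarrow> real) \<Rightarrow>
   (real \<Rightarrow> 'w \<Rightarrow> 'h \<Rightarrow>\<^sub>L 'y::{real_inner, banach, second_countable_topology}) \<Rightarrow>
   real \<Rightarrow> real \<Rightarrow> ('w \<Rightarrow> 'y) \<Rightarrow> bool" where
  "has_ito_integral M Fil T B W \<Phi> a b I \<longleftrightarrow>
     (\<lambda>(s, w). indicator {a<..b} s *\<^sub>R \<Phi> s w) \<in> (time_measure T \<Otimes>\<^sub>M M) \<rightarrow>\<^sub>M hs_borel B \<and>
     I \<in> borel_measurable M \<and>
     (\<exists>e :: nat \<Rightarrow> ('w, 'h, 'y) step_process.
        (\<forall>n. adapted_step Fil T (e n)) \<and>
        (\<lambda>n. \<integral>\<^sup>+(s, w). ennreal ((hs_norm B (step_val (e n) s w - indicator {a<..b} s *\<^sub>R \<Phi> s w))\<^sup>2)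
               \<partial>(time_measure T \<Otimes>\<^sub>M M)) \<longlonglongrightarrow> 0 \<and>
        (\<lambda>n. \<integral>\<^sup>+w. ennreal ((norm (step_integral W (e n) w - I w))\<^sup>2) \<partial>M) \<longlonglongrightarrow> 0)"

section \<open>The nonlinearities-stopped exponential Euler scheme\<close>

definition stopping_ind ::
  "'h::real_inner set \<Rightarrow> ('y \<Rightarrow> 'y::real_normed_vector) \<Rightarrow> ('y \<Rightarrow> 'h \<Rightarrow>\<^sub>L 'y) \<Rightarrow> real \<Rightarrow> real \<Rightarrow> 'y \<Rightarrow> real"
  where
  "stopping_ind B F G \<theta> k x = (if norm (F x) + hs_norm B (G x) \<le> k powr (-\<theta>) then 1 else 0)"

text \<open>
  Equations between random variables hold almost surely, so \<open>U j\<close> and \<open>Uhat t\<close> range over all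
  versions of the scheme and of its continuous extension.
\<close>

definition exp_euler_scheme ::
  "'w measure \<Rightarrow> 'h::real_inner set \<Rightarrow> ((real \<Rightarrow> 'h) \<Rightarrow> 'w \<Rightarrow> real) \<Rightarrow>
   (real \<Rightarrow> 'y \<Rightarrow>\<^sub>L 'y) \<Rightarrow> ('y \<Rightarrow> 'y) \<Rightarrow> ('y \<Rightarrow> 'h \<Rightarrow>\<^sub>L 'y) \<Rightarrow>
   real \<Rightarrow> real \<Rightarrow> nat \<Rightarrow> ('w \<Rightarrow> 'y::{real_inner, banach, second_countable_topology}) \<Rightarrow>
   (nat \<Rightarrow> 'w \<Rightarrow> 'y) \<Rightarrow> bool" where
  "exp_euler_scheme M B W S F G \<theta> T N u0 U \<longleftrightarrow>
     (let k = T / real N; t = (\<lambda>j. real j * k); ind = stopping_ind B F G \<theta> k in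
       (\<forall>j\<le>N. U j \<in> borel_measurable M) \<and>
       (AE w in M. U 0 w = u0 w) \<and>
       (\<forall>j<N. \<exists>X.
          is_increment M B W (t j) (t (j + 1)) (\<lambda>w. S k o\<^sub>L (ind (U j w) *\<^sub>R G (U j w))) X \<and>
          (AE w in M. U (j + 1) w =
             S k (U j w) + k *\<^sub>R S k (ind (U j w) *\<^sub>R F (U j w)) + X w)))"

text \<open>For \<open>t \<in> {real j * (T / N)..<real (j + 1) * (T / N)}\<close> the floor below is \<open>j\<close>.\<close>

definition piecewise_constant_ext :: "real \<Rightarrow> nat \<Rightarrow> (nat \<Rightarrow> 'w \<Rightarrow> 'y) \<Rightarrow> real \<Rightarrow> 'w \<Rightarrow> 'y" where
  "piecewise_constant_ext T N U t = (if t < T then U (nat \<lfloor>t / (T / real N)\<rfloor>) else U N)"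

definition continuous_ext ::
  "'w measure \<Rightarrow> (real \<Rightarrow> 'w measure) \<Rightarrow> 'h::real_inner set \<Rightarrow> ((real \<Rightarrow> 'h) \<Rightarrow> 'w \<Rightarrow> real) \<Rightarrow>
   (real \<Rightarrow> 'y \<Rightarrow>\<^sub>L 'y) \<Rightarrow> ('y \<Rightarrow> 'y) \<Rightarrow> ('y \<Rightarrow> 'h \<Rightarrow>\<^sub>L 'y) \<Rightarrow>
   real \<Rightarrow> real \<Rightarrow> nat \<Rightarrow> (nat \<Rightarrow> 'w \<Rightarrow> 'y::{real_inner, banach, second_countable_topology}) \<Rightarrow>
   (real \<Rightarrow> 'w \<Rightarrow> 'y) \<Rightarrow> bool" where
  "continuous_ext M Fil B W S F G \<theta> T N U Uhat \<longleftrightarrow>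
     (let k = T / real N; t = (\<lambda>j. real j * k); ind = stopping_ind B F G \<theta> k in
       (\<forall>s\<in>{0..T}. Uhat s \<in> borel_measurable M) \<and>
       (AE w in M. Uhat T w = U N w) \<and>
       (\<forall>j<N. \<forall>s\<in>{t j..<t (j + 1)}. \<exists>I.
          has_ito_integral M Fil T B W (\<lambda>r w. ind (U j w) *\<^sub>R G (U j w)) (t j) s I \<and>
          (AE w in M. Uhat s w =
             S (s - t j) (U j w + (s - t j) *\<^sub>R ind (U j w) *\<^sub>R F (U j w) + I w))))"

text \<open>The \<open>L\<^sup>q(\<Omega>; Y)\<close> norm, infinite outside of \<open>L\<^sup>q(\<Omega>; Y)\<close>.\<close>

definition Lq_norm ::
  "'w measure \<Rightarrow> real \<Rightarrow> ('w \<Rightarrow> 'y::{real_normed_vector, second_countable_topology}) \<Rightarrow> ennreal" where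
  "Lq_norm M q X =
     (if X \<in> borel_measurable M \<and> integrable M (\<lambda>w. norm (X w) powr q)
      then ennreal ((\<integral>w. norm (X w) powr q \<partial>M) powr (1 / q)) else \<infinity>)"

end

theory Submission
  imports Defs "HOL-Real_Asymp.Real_Asymp"
begin

text \<open>
  The heart of the matter is the sharp inequality
  \<open>(E \<parallel>x + Z\<parallel>\<^sup>q)\<^bsup>2/q\<^esup> \<le> \<parallel>x\<parallel>\<^sup>2 + (q - 1) E \<parallel>Z\<parallel>\<^sup>2\<close> for a centred Gaussian \<open>Z\<close> in a Hilbert space.
  Conditionally on \<open>U\<^sub>j = x\<close>, a step of the scheme is \<open>S(k)\<close> applied to \<open>x + k F(x) + Z\<close> with
  \<open>E \<parallel>Z\<parallel>\<^sup>2 = k \<parallel>G(x)\<parallel>\<^sup>2\<close>, so that the right-hand side becomes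
  \<open>\<parallel>x\<parallel>\<^sup>2 + 2k (\<langle>x, F(x)\<rangle> + (q - 1)/2 \<parallel>G(x)\<parallel>\<^sup>2) + k\<^sup>2 \<parallel>F(x)\<parallel>\<^sup>2\<close>: coercivity bounds the bracket, and the
  stopping bounds the last term by a multiple of \<open>k\<close>. Hence \<open>E (1 + \<parallel>U\<^sub>j\<parallel>\<^sup>2)\<^bsup>q/2\<^esup>\<close> grows at most
  exponentially in \<open>t\<^sub>j\<close>, without any recourse to Ito's formula. The inequality tensorizes over the
  coordinates of \<open>Z\<close>; for a single coordinate it follows from the two-point inequality by the central
  limit theorem.
\<close>

section \<open>Moments of shifted Gaussians\<close>

text \<open>The factor \<open>q - 1\<close> must be exact. For a stopped step
  \<open>k * (hs_norm B (G x))\<^sup>2\<close> is bounded only by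
  \<open>k powr (1 - 2 * \<theta>)\<close>, which is not of order \<open>k\<close>, so an excess of
  the Gaussian constant over the one in the coercivity hypothesis would not be absorbed over
  \<open>N\<close> steps. The term quadratic in \<open>F\<close> has one more factor
  \<open>k\<close>. Cylindrical Brownian motion is independent of the past only one value
  \<open>W b\<close> at a time, and neither linearity nor zero mean is part of its definition.
  Linearity follows from the covariance; a linear combination of increments over one interval is
  then again a single value of \<open>W\<close>, and characteristic functions yield joint
  independence of all coordinates and the past. The Ito integrals in the continuous extension are
  limits of unspecified step processes. An isometry identifies them with mean square limits of the
  same finite Gaussian sums that define the increments of the scheme, so one estimate serves both.
  Mean square limits do not control moments of order \<open>q\<close>; Fatou's lemma does, and all
  moments are taken in \<open>ennreal\<close>, so no integrability has to be propagated.\<close>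

text \<open>For \<open>h(r) = ((a + 2br + dr\<^sup>2)\<^sup>p + (a - 2br + dr\<^sup>2)\<^sup>p) / 2\<close> the second derivative of \<open>h\<^bsup>1/p\<^esup>\<close> is at most
  \<open>2 (2p - 1) d\<close>, and its first derivative vanishes at \<open>0\<close>.\<close>

lemma two_point_inequality_strict:
  fixes a b d p :: real
  assumes p: "1 \<le> p" and bd: "b\<^sup>2 < a * d" and d0: "0 \<le> d"
  shows "((a + 2 * b + d) powr p + (a - 2 * b + d) powr p) / 2 \<le> (a + (2 * p - 1) * d) powr p"
proof -
  have d: "d > 0" using bd d0 by (metis le_less mult_zero_right not_less zero_le_power2)
  have a: "a > 0" using bd d by (smt (verit) mult_nonpos_nonneg zero_le_power2)
  define P where "P r = a + 2 * b * r + d * r\<^sup>2" for r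
  \<comment> \<open>The difference of the two sides is \<open>a * d - b\<^sup>2\<close> for every
    \<open>r\<close>. This keeps \<open>P\<close> positive and, read as a bound for the squared
    derivative of \<open>P\<close> by \<open>4 * d * P\<close>, removes \<open>b\<close> from the
    estimate of \<open>h2\<close>.\<close>
  have Pd: "(b + d * r)\<^sup>2 < d * P r" for r
    unfolding P_def using bd by (simp add: power2_eq_square algebra_simps)
  have P: "P r > 0" for r
    using Pd[of r] d by (smt (verit) mult_nonneg_nonpos zero_le_power2)
  define h where "h r = (P r powr p + P (-r) powr p) / 2" for r
  define h1 where "h1 r = p * (P r powr (p - 1) * (b + d * r) + P (-r) powr (p - 1) * (d * r - b))" for r
  define h2 where "h2 r = p * (P r powr (p - 1) * d + (p - 1) * (P r powr (p - 2) * (2 * (b + d * r)\<^sup>2))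
     + P (-r) powr (p - 1) * d + (p - 1) * (P (-r) powr (p - 2) * (2 * (d * r - b)\<^sup>2)))" for r
  have h: "h r > 0" for r unfolding h_def using P[of r] P[of "-r"] by (simp add: add_pos_pos)
  have dP: "(P has_real_derivative 2 * (b + d * r)) (at r)" for r
    unfolding P_def by (auto intro!: derivative_eq_intros simp: algebra_simps power2_eq_square)
  have dPm: "((\<lambda>r. P (-r)) has_real_derivative 2 * (d * r - b)) (at r)" for r
    unfolding P_def by (auto intro!: derivative_eq_intros simp: algebra_simps power2_eq_square)
  have dpow: "((\<lambda>r. f r powr e) has_real_derivative e * f r powr (e - 1) * f') (at r)"
    if "(f has_real_derivative f') (at r)" "f r > 0" for f :: "real \<Rightarrow> real" and f' e r
    using DERIV_fun_powr[OF that(1), of e] that(2) by (simp add: mult_ac)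
  have dh: "(h has_real_derivative h1 r) (at r)" for r
    unfolding h_def h1_def
    by (rule derivative_eq_intros dpow dP dPm P refl | simp add: field_simps)+
  have dh1: "(h1 has_real_derivative h2 r) (at r)" for r
    unfolding h2_def h1_def
    by (rule derivative_eq_intros dpow dP dPm P refl | simp add: algebra_simps power2_eq_square)+
  define g where "g r = h r powr (1 / p)" for r
  define g1 where "g1 r = 1 / p * h r powr (1 / p - 1) * h1 r" for r
  define g2 where "g2 r = 1 / p * (h r powr (1 / p - 1) * h2 r + (1 / p - 1) * h r powr (1 / p - 2) * (h1 r)\<^sup>2)" for r
  have dg: "(g has_real_derivative g1 r) (at r)" for r
    unfolding g_def g1_def
    by (rule derivative_eq_intros dpow dh h refl | simp add: algebra_simps)+
  have dg1: "(g1 has_real_derivative g2 r) (at r)" for r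
    unfolding g2_def g1_def
    by (rule derivative_eq_intros dpow dh dh1 h refl | simp add: algebra_simps power2_eq_square)+
  have h2_le: "h2 r \<le> 2 * p * (2 * p - 1) * d * h r powr (1 - 1 / p)" for r
  proof -
    have t: "P s powr (p - 2) * (2 * w) \<le> 2 * d * P s powr (p - 1)"
      if "w \<le> d * P s" for s w
    proof -
      have "P s powr (p - 2) * w \<le> P s powr (p - 2) * (d * P s)"
        using that by (intro mult_left_mono) auto
      also have "\<dots> = d * P s powr (p - 1)"
        using P[of s] powr_mult_base[of "P s" "p - 2"] by (simp add: mult_ac)
      finally show ?thesis by simp
    qed
    have "P r powr (p - 2) * (2 * (b + d * r)\<^sup>2) \<le> 2 * d * P r powr (p - 1)"
      using Pd[of r] by (intro t) auto
    moreover have "P (-r) powr (p - 2) * (2 * (d * r - b)\<^sup>2) \<le> 2 * d * P (-r) powr (p - 1)"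
      using Pd[of "-r"] by (intro t) (auto simp: power2_commute)
    ultimately have "h2 r \<le> p * (P r powr (p - 1) * d + (p - 1) * (2 * d * P r powr (p - 1))
       + P (-r) powr (p - 1) * d + (p - 1) * (2 * d * P (-r) powr (p - 1)))"
      unfolding h2_def using p by (intro mult_left_mono add_mono order.refl) auto
    \<comment> \<open>Origin of the constant: \<open>d\<close> arises from differentiating the
      factor \<open>b + d * r\<close>, \<open>2 * (p - 1) * d\<close> from differentiating the
      power.\<close>
    also have "\<dots> = 2 * p * (2 * p - 1) * d * ((P r powr (p - 1) + P (-r) powr (p - 1)) / 2)"
      by (simp add: algebra_simps)
    \<comment> \<open>Jensen's inequality for the concave power \<open>e = 1 - 1 / p\<close>, using
      \<open>p * e = p - 1\<close>. It replaces the powers of order \<open>p - 1\<close> by a power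
      of \<open>h\<close> itself, which cancels in \<open>g2\<close>.\<close>
    also have "(P r powr (p - 1) + P (-r) powr (p - 1)) / 2 \<le> h r powr (1 - 1 / p)"
    proof -
      define e where "e = 1 - 1 / p"
      have e: "0 \<le> e" "e \<le> 1" "p * e = p - 1" using p by (auto simp: e_def field_simps)
      have conc: "concave_on {0<..} (\<lambda>x::real. x powr e)"
      proof (rule f''_le0_imp_concave)
        fix x :: real assume x: "x \<in> {0<..}"
        then show "((\<lambda>x. x powr e) has_real_derivative e * x powr (e - 1)) (at x)"
          by (auto intro!: derivative_eq_intros)
        show "((\<lambda>x. e * x powr (e - 1)) has_real_derivative e * ((e - 1) * x powr (e - 1 - 1))) (at x)"
          using x by (auto intro!: derivative_eq_intros)
        show "e * ((e - 1) * x powr (e - 1 - 1)) \<le> 0"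
          using e by (intro mult_nonneg_nonpos mult_nonpos_nonneg) auto
      qed simp
      have "(1 / 2) * (P r powr p) powr e + (1 / 2) * (P (-r) powr p) powr e
         \<le> ((1 - 1 / 2) *\<^sub>R (P r powr p) + (1 / 2) *\<^sub>R (P (-r) powr p)) powr e"
        using concave_onD[OF conc, of "1/2" "P r powr p" "P (-r) powr p"] P[of r] P[of "-r"] by auto
      then show ?thesis
        unfolding h_def e_def[symmetric] powr_powr e(3) by (simp add: field_simps)
    qed
    finally show ?thesis using p d by (simp add: mult_left_mono)
  qed
  have g2_le: "g2 r \<le> 2 * (2 * p - 1) * d" for r
  proof -
    have "(1 / p - 1) * h r powr (1 / p - 2) * (h1 r)\<^sup>2 \<le> 0"
      using p by (intro mult_nonpos_nonneg) (auto simp: field_simps)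
    then have "g2 r \<le> 1 / p * (h r powr (1 / p - 1) * h2 r)"
      unfolding g2_def using p by (intro mult_left_mono) auto
    also have "\<dots> \<le> 1 / p * (h r powr (1 / p - 1) * (2 * p * (2 * p - 1) * d * h r powr (1 - 1 / p)))"
      using p h2_le[of r] by (intro mult_left_mono) auto
    also have "\<dots> = 2 * (2 * p - 1) * d * (h r powr (1 / p - 1) * h r powr (1 - 1 / p))"
      using p by simp
    also have "h r powr (1 / p - 1) * h r powr (1 - 1 / p) = 1"
      using h[of r] by (simp flip: powr_add)
    finally show ?thesis by simp
  qed
  have k1: "g1 r \<le> 2 * (2 * p - 1) * d * r" if "0 \<le> r" for r
  proof -
    have "g1 0 = 0" unfolding g1_def h1_def by simp
    have "(\<lambda>r. 2 * (2 * p - 1) * d * r - g1 r) 0 \<le> (\<lambda>r. 2 * (2 * p - 1) * d * r - g1 r) r"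
    proof (rule DERIV_nonneg_imp_nondecreasing[OF that])
      fix x
      have "((\<lambda>r. 2 * (2 * p - 1) * d * r - g1 r) has_real_derivative 2 * (2 * p - 1) * d - g2 x) (at x)"
        by (auto intro!: derivative_eq_intros dg1)
      then show "\<exists>y. ((\<lambda>r. 2 * (2 * p - 1) * d * r - g1 r) has_real_derivative y) (at x) \<and> 0 \<le> y"
        using g2_le[of x] by fastforce
    qed
    with \<open>g1 0 = 0\<close> show ?thesis by simp
  qed
  have "(\<lambda>r. (2 * p - 1) * d * r\<^sup>2 - g r) 0 \<le> (\<lambda>r. (2 * p - 1) * d * r\<^sup>2 - g r) 1"
  proof (rule DERIV_nonneg_imp_nondecreasing[where f="\<lambda>r. (2 * p - 1) * d * r\<^sup>2 - g r"])
    fix x :: real assume "0 \<le> x"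
    have "((\<lambda>r. (2 * p - 1) * d * r\<^sup>2 - g r) has_real_derivative 2 * (2 * p - 1) * d * x - g1 x) (at x)"
      by (auto intro!: derivative_eq_intros dg)
    then show "\<exists>y. ((\<lambda>r. (2 * p - 1) * d * r\<^sup>2 - g r) has_real_derivative y) (at x) \<and> 0 \<le> y"
      using k1[OF \<open>0 \<le> x\<close>] by fastforce
  qed simp
  moreover have "g 0 = a"
    unfolding g_def h_def P_def using a p by (simp add: powr_powr)
  ultimately have "g 1 \<le> a + (2 * p - 1) * d" by simp
  then have "g 1 powr p \<le> (a + (2 * p - 1) * d) powr p"
    using p by (intro powr_mono2) (auto simp: g_def)
  moreover have "g 1 powr p = h 1" unfolding g_def using p h[of 1] by (simp add: powr_powr)
  ultimately show ?thesis unfolding h_def P_def by simp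
qed

lemma two_point_inequality:
  fixes a b d p :: real
  assumes p: "1 \<le> p" and bd: "b\<^sup>2 \<le> a * d" and a: "0 \<le> a" and d: "0 \<le> d"
  shows "((a + 2 * b + d) powr p + (a - 2 * b + d) powr p) / 2 \<le> (a + (2 * p - 1) * d) powr p"
proof -
  have ge: "2 * \<bar>b\<bar> \<le> a + d"
  proof -
    have "(2 * \<bar>b\<bar>)\<^sup>2 \<le> 4 * (a * d)" using bd by (simp add: power_mult_distrib)
    also have "\<dots> \<le> (a + d)\<^sup>2" using zero_le_power2[of "a - d"] by (simp add: power2_eq_square algebra_simps)
    finally show ?thesis using a d by (intro power2_le_imp_le[of "2 * \<bar>b\<bar>"]) auto
  qed
  have lim: "((\<lambda>e. f e powr p) \<longlongrightarrow> f 0 powr p) (at_right 0)"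
    if "continuous_on UNIV f" "\<And>e. 0 < e \<Longrightarrow> 0 \<le> f e" for f :: "real \<Rightarrow> real"
  proof (rule tendsto_powr')
    show "(f \<longlongrightarrow> f 0) (at_right 0)"
      using that(1) by (metis UNIV_I continuous_on_def filterlim_at_split tendsto_within_subset top_greatest)
    show "f 0 \<noteq> 0 \<or> 0 < p \<and> (\<forall>\<^sub>F e in at_right 0. 0 \<le> f e)"
      using p that(2) by (auto simp: eventually_at_right_less intro: eventually_at_rightI[of 0 1])
  qed auto
  have 1: "((\<lambda>e. (((a + e) + 2 * b + (d + e)) powr p + ((a + e) - 2 * b + (d + e)) powr p) / 2)
     \<longlongrightarrow> (((a + 0) + 2 * b + (d + 0)) powr p + ((a + 0) - 2 * b + (d + 0)) powr p) / 2) (at_right 0)"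
    using ge by (intro tendsto_intros lim continuous_intros) (auto simp: abs_if split: if_splits)
  have 2: "((\<lambda>e. ((a + e) + (2 * p - 1) * (d + e)) powr p)
     \<longlongrightarrow> ((a + 0) + (2 * p - 1) * (d + 0)) powr p) (at_right 0)"
    using a d p by (intro lim continuous_intros) auto
  have "\<forall>\<^sub>F e in at_right 0. (((a + e) + 2 * b + (d + e)) powr p + ((a + e) - 2 * b + (d + e)) powr p) / 2
     \<le> ((a + e) + (2 * p - 1) * (d + e)) powr p"
  proof (rule eventually_at_rightI[of 0 1])
    fix e :: real assume "e \<in> {0<..<1}"
    then have "b\<^sup>2 < (a + e) * (d + e)" using bd a d
      by (smt (verit) greaterThanLessThan_iff mult_less_cancel_left_pos mult_mono mult_strict_mono)
    then show "(((a + e) + 2 * b + (d + e)) powr p + ((a + e) - 2 * b + (d + e)) powr p) / 2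
     \<le> ((a + e) + (2 * p - 1) * (d + e)) powr p"
      using \<open>e \<in> _\<close> d p by (intro two_point_inequality_strict) auto
  qed simp
  from tendsto_le[OF _ 2 1 this] show ?thesis by simp
qed

section \<open>Random signs and the central limit theorem\<close>

primrec simple_walk :: "nat \<Rightarrow> real pmf" where
  "simple_walk 0 = return_pmf 0"
| "simple_walk (Suc n) =
     bind_pmf (simple_walk n) (\<lambda>x. map_pmf (\<lambda>b. if b then x + 1 else x - 1) (bernoulli_pmf (1 / 2)))"

lemma char_simple_walk:
  "(\<integral>x. cis (s * x) \<partial>measure_pmf (simple_walk n)) = cos s ^ n"
proof (induction n)
  case (Suc n)
  have fin: "finite (set_pmf (simple_walk n))" for n
    by (induction n) auto
  have "(\<integral>x. cis (s * x) \<partial>measure_pmf (simple_walk (Suc n)))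
    = (\<Sum>x\<in>set_pmf (simple_walk n). pmf (simple_walk n) x *\<^sub>R
        (\<integral>y. cis (s * y) \<partial>measure_pmf (map_pmf (\<lambda>b. if b then x + 1 else x - 1) (bernoulli_pmf (1 / 2)))))"
    unfolding simple_walk.simps by (rule pmf_expectation_bind) (auto simp: fin)
  also have "\<dots> = (\<Sum>x\<in>set_pmf (simple_walk n). pmf (simple_walk n) x *\<^sub>R (cos s * cis (s * x)))"
    by (intro sum.cong refl arg_cong2[where f=scaleR])
       (simp add: integral_measure_pmf[of UNIV] UNIV_bool complex_eq_iff algebra_simps cos_add cos_diff sin_add sin_diff)
  also have "\<dots> = (\<integral>x. cos s * cis (s * x) \<partial>measure_pmf (simple_walk n))"
    by (rule integral_measure_pmf[OF fin, symmetric]) (auto simp: set_pmf_iff)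
  also have "\<dots> = cos s ^ Suc n" by (simp add: Suc.IH)
  finally show ?case .
qed simp

text \<open>The last sign is averaged out with the position \<open>x\<close> held fixed. This is the
  two-point inequality for \<open>c + Q x\<close>, \<open>h * (b + d * (h * x))\<close> and
  \<open>d * h\<^sup>2\<close>; its price \<open>(2 * p - 1) * (d * h\<^sup>2)\<close> does not
  depend on \<open>x\<close> and is moved into \<open>c\<close>. Hence the free offset
  \<open>c\<close>, over which the induction generalises.\<close>

lemma simple_walk_moment_le:
  fixes a b d p h c :: real
  assumes p: "1 \<le> p" and bd: "b\<^sup>2 \<le> a * d" and a: "0 \<le> a" and d: "0 \<le> d" and c: "0 \<le> c"
  shows "(\<integral>\<^sup>+x. ennreal ((c + (a + 2 * b * (h * x) + d * (h * x)\<^sup>2)) powr p) \<partial>measure_pmf (simple_walk n))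
    \<le> ennreal ((c + a + n * ((2 * p - 1) * (d * h\<^sup>2))) powr p)"
  using c
proof (induction n arbitrary: c)
  case (Suc n)
  define Q where "Q x = a + 2 * b * (h * x) + d * (h * x)\<^sup>2" for x
  have Qd: "(b + d * (h * x))\<^sup>2 \<le> d * Q x" for x
    unfolding Q_def using bd by (simp add: power2_eq_square algebra_simps)
  have Q0: "0 \<le> Q x" for x
  proof (cases "d = 0")
    case True
    then show ?thesis using bd a unfolding Q_def by simp
  next
    case False
    then show ?thesis using Qd[of x] d by (smt (verit) mult_pos_neg zero_le_power2)
  qed
  have "(\<integral>\<^sup>+x. ennreal ((c + Q x) powr p) \<partial>measure_pmf (simple_walk (Suc n)))
    = (\<integral>\<^sup>+x. ennreal (((c + Q (x + 1)) powr p + (c + Q (x - 1)) powr p) / 2) \<partial>measure_pmf (simple_walk n))"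
  proof -
    have half: "inverse 2 * ennreal u + inverse 2 * ennreal v = ennreal ((u + v) / 2)" if "0 \<le> u" "0 \<le> v" for u v :: real
      using that ennreal_divide_numeral[of "u + v"]
      by (simp add: divide_ennreal_def distrib_left mult.commute)
    show ?thesis
      by (auto simp: divide_ennreal_def mult.commute add.commute intro!: nn_integral_cong half)
  qed
  also have "\<dots> \<le> (\<integral>\<^sup>+x. ennreal ((c + (2 * p - 1) * (d * h\<^sup>2) + Q x) powr p) \<partial>measure_pmf (simple_walk n))"
  proof (intro nn_integral_mono ennreal_leI)
    fix x
    have *: "c + Q (x + 1) = c + Q x + 2 * (h * (b + d * (h * x))) + d * h\<^sup>2"
      "c + Q (x - 1) = c + Q x - 2 * (h * (b + d * (h * x))) + d * h\<^sup>2"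
      unfolding Q_def by (auto simp: power2_eq_square algebra_simps)
    have "(h * (b + d * (h * x)))\<^sup>2 \<le> h\<^sup>2 * (d * Q x)"
      using Qd[of x] by (simp add: power_mult_distrib mult_left_mono)
    also have "\<dots> \<le> (c + Q x) * (d * h\<^sup>2)"
      using Suc.prems d by (simp add: algebra_simps)
    finally have "((c + Q (x + 1)) powr p + (c + Q (x - 1)) powr p) / 2 \<le> (c + Q x + (2 * p - 1) * (d * h\<^sup>2)) powr p"
      unfolding * using p d Q0[of x] Suc.prems by (intro two_point_inequality) auto
    then show "((c + Q (x + 1)) powr p + (c + Q (x - 1)) powr p) / 2 \<le> (c + (2 * p - 1) * (d * h\<^sup>2) + Q x) powr p"
      by (simp add: add_ac)
  qed
  also have "\<dots> \<le> ennreal ((c + (2 * p - 1) * (d * h\<^sup>2) + a + n * ((2 * p - 1) * (d * h\<^sup>2))) powr p)"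
    unfolding Q_def using p d Suc.prems by (intro Suc.IH) auto
  also have "\<dots> = ennreal ((c + a + Suc n * ((2 * p - 1) * (d * h\<^sup>2))) powr p)"
    by (simp add: algebra_simps)
  finally show ?case unfolding Q_def .
qed simp

text \<open>The walk with step \<open>1 / sqrt n\<close> costs \<open>(2 * p - 1) * d / n\<close>
  per step, so the bound after \<open>n\<close> steps is the same for every \<open>n > 0\<close> and
  survives the weak limit.\<close>

lemma gaussian_moment_le:
  fixes a b d p :: real
  assumes p: "1 \<le> p" and bd: "b\<^sup>2 \<le> a * d" and a: "0 \<le> a" and d: "0 \<le> d"
  shows "(\<integral>\<^sup>+x. ennreal ((a + 2 * b * x + d * x\<^sup>2) powr p) \<partial>std_normal_distribution)
    \<le> ennreal ((a + (2 * p - 1) * d) powr p)"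
proof -
  define Q where "Q x = a + 2 * b * x + d * x\<^sup>2" for x
  have Qd: "(b + d * x)\<^sup>2 \<le> d * Q x" for x
    unfolding Q_def using bd by (simp add: power2_eq_square algebra_simps)
  have Q0: "0 \<le> Q x" for x
  proof (cases "d = 0")
    case True
    then show ?thesis using bd a unfolding Q_def by simp
  next
    case False
    then show ?thesis using Qd[of x] d by (smt (verit) mult_pos_neg zero_le_power2)
  qed
  define \<mu> where "\<mu> n = distr (measure_pmf (simple_walk n)) borel (\<lambda>x. x / sqrt n)" for n
  have \<mu>: "real_distribution (\<mu> n)" for n
    unfolding \<mu>_def by (rule prob_space.real_distribution_distr[OF measure_pmf.prob_space_axioms]) simp
  interpret N: real_distribution std_normal_distribution by (rule real_dist_normal_dist)
  have char: "char (\<mu> n) t = of_real (cos (t / sqrt n) ^ n)" for n t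
  proof -
    have "char (\<mu> n) t = (\<integral>x. cis (t / sqrt n * x) \<partial>measure_pmf (simple_walk n))"
      unfolding char_def \<mu>_def by (subst integral_distr) (auto simp: cis_conv_exp)
    also have "\<dots> = of_real (cos (t / sqrt n) ^ n)"
      by (subst char_simple_walk) (simp add: cos_of_real)
    finally show ?thesis .
  qed
  have "weak_conv_m \<mu> std_normal_distribution"
  proof (rule levy_continuity[OF \<mu>])
    fix t :: real
    have "(\<lambda>n. cos (t / sqrt (real n)) ^ n) \<longlonglongrightarrow> exp (- (t\<^sup>2) / 2)"
      by (simp add: power2_eq_square) real_asymp
    then show "(\<lambda>n. char (\<mu> n) t) \<longlonglongrightarrow> char std_normal_distribution t"
      unfolding char char_std_normal_distribution by (intro tendsto_of_real)
  qed (rule real_dist_normal_dist)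
  define R where "R = ((a + (2 * p - 1) * d) powr p)"
  \<comment> \<open>Weak convergence transports only bounded continuous integrands. The truncation
    at \<open>L\<close> leaves the bound \<open>R\<close> unchanged and is removed by monotone
    convergence at the end.\<close>
  have bnd: "(\<integral>\<^sup>+x. ennreal (min (Q x powr p) L) \<partial>std_normal_distribution) \<le> ennreal R" if L: "0 \<le> L" for L
  proof -
    define f where "f x = min (Q x powr p) L" for x
    have cont: "isCont f x" for x
    proof -
      have "continuous_on UNIV f" unfolding f_def Q_def
        by (intro continuous_intros continuous_on_powr') (use Q0 p in \<open>auto simp: Q_def\<close>)
      then show ?thesis by (simp add: continuous_on_eq_continuous_at)
    qed
    have fb: "\<bar>f x\<bar> \<le> L" "0 \<le> f x" for x using L by (auto simp: f_def)
    have meas[measurable]: "f \<in> borel_measurable borel"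
      using cont by (intro borel_measurable_continuous_onI) (simp add: continuous_on_eq_continuous_at)
    have lim: "(\<lambda>n. integral\<^sup>L (\<mu> n) f) \<longlonglongrightarrow> integral\<^sup>L std_normal_distribution f"
      using \<open>weak_conv_m _ _\<close> \<mu> real_dist_normal_dist
      by (intro weak_conv_imp_bdd_ae_continuous_conv[of \<mu> _ f L]) (use cont fb in auto)
    have ile: "integral\<^sup>L (\<mu> n) f \<le> R" if "n > 0" for n
    proof -
      interpret \<mu>: real_distribution "\<mu> n" by (rule \<mu>)
      have int: "integrable (\<mu> n) f" using fb by (intro \<mu>.integrable_const_bound[where B=L]) (auto simp: \<mu>_def)
      have "ennreal (integral\<^sup>L (\<mu> n) f) = (\<integral>\<^sup>+x. ennreal (f x) \<partial>\<mu> n)"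
        using int fb by (intro nn_integral_eq_integral[symmetric]) auto
      also have "\<dots> = (\<integral>\<^sup>+x. ennreal (f (1 / sqrt n * x)) \<partial>measure_pmf (simple_walk n))"
        unfolding \<mu>_def by (subst nn_integral_distr) auto
      also have "\<dots> \<le> (\<integral>\<^sup>+x. ennreal ((0 + (a + 2 * b * (1 / sqrt n * x) + d * (1 / sqrt n * x)\<^sup>2)) powr p) \<partial>measure_pmf (simple_walk n))"
        by (intro nn_integral_mono ennreal_leI) (auto simp: f_def Q_def)
      also have "\<dots> \<le> ennreal ((0 + a + n * ((2 * p - 1) * (d * (1 / sqrt n)\<^sup>2))) powr p)"
        by (rule simple_walk_moment_le) (use assms in auto)
      also have "\<dots> = ennreal R" using that by (simp add: R_def power_divide)
      finally show ?thesis by (simp add: R_def)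
    qed
    have "integral\<^sup>L std_normal_distribution f \<le> R"
      by (rule LIMSEQ_le_const2[OF lim]) (use ile in \<open>auto intro!: exI[of _ 1]\<close>)
    moreover have "(\<integral>\<^sup>+x. ennreal (f x) \<partial>std_normal_distribution) = ennreal (integral\<^sup>L std_normal_distribution f)"
      using fb by (intro nn_integral_eq_integral N.integrable_const_bound[where B=L]) auto
    ultimately show ?thesis unfolding f_def by (simp add: ennreal_leI)
  qed
  have [measurable]: "Q \<in> borel_measurable borel" unfolding Q_def by measurable
  have "(\<integral>\<^sup>+x. ennreal (Q x powr p) \<partial>std_normal_distribution)
    = (\<integral>\<^sup>+x. (SUP n. ennreal (min (Q x powr p) (real n))) \<partial>std_normal_distribution)"
  proof (rule nn_integral_cong)
    fix x
    obtain n where n: "Q x powr p \<le> real n" using real_arch_simple by blast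
    show "ennreal (Q x powr p) = (SUP n. ennreal (min (Q x powr p) (real n)))"
    proof (rule antisym)
      show "ennreal (Q x powr p) \<le> (SUP n. ennreal (min (Q x powr p) (real n)))"
        using n by (intro SUP_upper2[of n]) auto
    qed (auto intro!: SUP_least ennreal_leI)
  qed
  also have "\<dots> = (SUP n. \<integral>\<^sup>+x. ennreal (min (Q x powr p) (real n)) \<partial>std_normal_distribution)"
    by (intro nn_integral_monotone_convergence_SUP)
       (auto simp: incseq_def le_fun_def intro!: ennreal_leI)
  also have "\<dots> \<le> ennreal R" using bnd by (intro SUP_least) auto
  finally show ?thesis by (simp add: Q_def R_def)
qed


section \<open>Gaussian families independent of a sigma-algebra\<close>

text \<open>In contrast to \<^const>\<open>normal_density\<close>, variance \<open>\<tau> = 0\<close> is meaningful and gives the point mass at \<open>0\<close>.\<close>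

definition centered_normal :: "real \<Rightarrow> real measure" where
  "centered_normal \<tau> = distr std_normal_distribution borel (\<lambda>x. sqrt \<tau> * x)"

lemma real_distribution_centered_normal: "real_distribution (centered_normal \<tau>)"
proof -
  interpret real_distribution std_normal_distribution by (rule real_dist_normal_dist)
  show ?thesis unfolding centered_normal_def by (rule real_distribution_distr) simp
qed

lemma char_centered_normal:
  assumes "0 \<le> \<tau>"
  shows "char (centered_normal \<tau>) t = of_real (exp (- (\<tau> * t\<^sup>2) / 2))"
proof -
  have "char (centered_normal \<tau>) t = char std_normal_distribution (t * sqrt \<tau>)"
    unfolding char_def centered_normal_def by (subst integral_distr) (auto simp: mult_ac)
  then show ?thesis
    using assms by (simp add: char_std_normal_distribution power_mult_distrib mult_ac)
qed

lemma centered_normal_moment_le: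
  fixes a b d p \<tau> :: real
  assumes p: "1 \<le> p" and bd: "b\<^sup>2 \<le> a * d" and a: "0 \<le> a" and d: "0 \<le> d" and \<tau>: "0 \<le> \<tau>"
  shows "(\<integral>\<^sup>+x. ennreal ((a + 2 * b * x + d * x\<^sup>2) powr p) \<partial>centered_normal \<tau>)
    \<le> ennreal ((a + (2 * p - 1) * (\<tau> * d)) powr p)"
proof -
  have "(\<integral>\<^sup>+x. ennreal ((a + 2 * b * x + d * x\<^sup>2) powr p) \<partial>centered_normal \<tau>)
    = (\<integral>\<^sup>+x. ennreal ((a + 2 * (b * sqrt \<tau>) * x + (\<tau> * d) * x\<^sup>2) powr p) \<partial>std_normal_distribution)"
    unfolding centered_normal_def using \<tau>
    by (subst nn_integral_distr) (auto simp: power_mult_distrib mult_ac)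
  also have "\<dots> \<le> ennreal ((a + (2 * p - 1) * (\<tau> * d)) powr p)"
    using \<tau> d a p bd mult_right_mono[OF bd \<tau>]
    by (intro gaussian_moment_le) (auto simp: power_mult_distrib mult_ac)
  finally show ?thesis .
qed

section \<open>Joint laws from characteristic functions, and integrating out one Gaussian
  coordinate\<close>

context prob_space
begin

text \<open>Reweighting by \<open>X / expectation X\<close> gives a probability measure under which
  \<open>\<beta>\<close> has the characteristic function of \<open>\<gamma>\<close>, hence the law
  \<open>\<gamma>\<close> by Levy's uniqueness theorem. Undoing the normalisation decouples
  \<open>X\<close> from \<open>\<beta>\<close>.\<close>

lemma expectation_indicator_of_char_nonneg:
  fixes X \<beta> :: "'a \<Rightarrow> real"
  assumes [measurable]: "X \<in> borel_measurable M" "\<beta> \<in> borel_measurable M"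
    and X0: "\<And>w. 0 \<le> X w" and XK: "\<And>w. X w \<le> K" and pos: "0 < expectation X"
    and \<gamma>: "real_distribution \<gamma>"
    and ch: "\<And>t. (\<integral>w. of_real (X w) * iexp (t * \<beta> w) \<partial>M) = of_real (expectation X) * char \<gamma> t"
    and E[measurable]: "E \<in> sets borel"
  shows "(\<integral>w. X w * indicator E (\<beta> w) \<partial>M) = expectation X * measure \<gamma> E"
proof -
  define m where "m = expectation X"
  have m: "m > 0" using pos by (simp add: m_def)
  have intX: "integrable M X"
    using X0 XK by (intro integrable_const_bound[where B=K]) auto
  define D where "D = density M (\<lambda>w. ennreal (X w / m))"
  have "emeasure D (space D) = ennreal (\<integral>w. X w / m \<partial>M)"
    unfolding D_def using intX X0 m
    by (subst emeasure_density) (auto simp: nn_integral_eq_integral)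
  also have "\<dots> = 1" using m by (simp add: m_def)
  finally interpret D: prob_space D by (rule prob_spaceI)
  define \<nu> where "\<nu> = distr D borel \<beta>"
  have mD[measurable]: "\<beta> \<in> borel_measurable D" unfolding D_def by measurable
  have \<nu>: "real_distribution \<nu>"
    unfolding \<nu>_def by (rule D.real_distribution_distr) (rule mD)
  have "char \<nu> t = char \<gamma> t" for t
  proof -
    have "char \<nu> t = (\<integral>w. (X w / m) *\<^sub>R iexp (t * \<beta> w) \<partial>M)"
      unfolding char_def \<nu>_def using m X0
      by (subst integral_distr) (auto simp: D_def integral_density)
    also have "\<dots> = (\<integral>w. of_real (X w) * iexp (t * \<beta> w) \<partial>M) / of_real m"
      by (simp add: scaleR_conv_of_real flip: integral_divide_zero)
    also have "\<dots> = char \<gamma> t" unfolding ch using m by (simp add: m_def)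
    finally show ?thesis .
  qed
  then have "\<nu> = \<gamma>" using Levy_uniqueness[OF \<nu> \<gamma>] by blast
  have "measure \<gamma> E = (\<integral>x. indicator E x \<partial>\<nu>)" unfolding \<open>\<nu> = \<gamma>\<close>
    using real_distribution.space_eq_univ[OF \<gamma>] by simp
  also have "\<dots> = (\<integral>w. (X w / m) *\<^sub>R indicator E (\<beta> w) \<partial>M)"
    unfolding \<nu>_def using m X0
    by (subst integral_distr) (auto simp: D_def integral_density)
  also have "\<dots> = (\<integral>w. X w * indicator E (\<beta> w) \<partial>M) / m"
    by simp
  finally show ?thesis using m by (simp add: m_def)
qed

text \<open>Adding a constant to the real and imaginary parts of the bounded weight \<open>X\<close> turns them into densities,
  to which the uniqueness theorem for characteristic functions applies.\<close>

lemma expectation_indicator_of_char: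
  fixes X :: "'a \<Rightarrow> complex" and \<beta> :: "'a \<Rightarrow> real"
  assumes [measurable]: "X \<in> borel_measurable M" "\<beta> \<in> borel_measurable M"
    and XK: "\<And>w. norm (X w) \<le> K"
    and \<gamma>: "real_distribution \<gamma>"
    and ch1: "\<And>t. (\<integral>w. iexp (t * \<beta> w) \<partial>M) = char \<gamma> t"
    and ch: "\<And>t. (\<integral>w. X w * iexp (t * \<beta> w) \<partial>M) = (\<integral>w. X w \<partial>M) * char \<gamma> t"
    and E[measurable]: "E \<in> sets borel"
  shows "(\<integral>w. X w * of_real (indicator E (\<beta> w)) \<partial>M) = (\<integral>w. X w \<partial>M) * of_real (measure \<gamma> E)"
proof -
  interpret \<gamma>: real_distribution \<gamma> by (rule \<gamma>)
  have K: "0 \<le> K" using XK norm_ge_zero order_trans by blast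
  have int: "integrable M (\<lambda>w. X w * f w)"
    if [measurable]: "f \<in> borel_measurable M" and "\<And>w. norm (f w) \<le> 1" for f
    using mult_mono[OF XK that(2) K norm_ge_zero]
    by (intro integrable_const_bound[where B="K * 1"]) (auto simp: norm_mult)
  have intX: "integrable M X" using int[of "\<lambda>_. 1"] by simp
  have char_minus: "char \<gamma> (-t) = cnj (char \<gamma> t)" for t
    unfolding char_def by (simp flip: Bochner_Integration.integral_cnj add: exp_cnj)
  \<comment> \<open>The identity passes to \<open>cnj (X w)\<close> by conjugating it at
    \<open>- t\<close>, where \<open>char \<gamma>\<close> takes the conjugate value. Sum and
    difference of \<open>X\<close> and its conjugate then give it for the real and the imaginary
    part.\<close>
  have chc: "(\<integral>w. cnj (X w) * iexp (t * \<beta> w) \<partial>M) = (\<integral>w. cnj (X w) \<partial>M) * char \<gamma> t" for t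
  proof -
    have "(\<integral>w. cnj (X w) * iexp (t * \<beta> w) \<partial>M) = (\<integral>w. cnj (X w * iexp (- t * \<beta> w)) \<partial>M)"
      by (simp add: exp_cnj)
    also have "\<dots> = cnj ((\<integral>w. X w \<partial>M) * char \<gamma> (-t))"
      unfolding Bochner_Integration.integral_cnj ch ..
    finally show ?thesis by (simp add: char_minus)
  qed
  have real_case: "(\<integral>w. Y w * indicator E (\<beta> w) \<partial>M) = expectation Y * measure \<gamma> E"
    if [measurable]: "Y \<in> borel_measurable M" and YK: "\<And>w. \<bar>Y w\<bar> \<le> K"
      and chY: "\<And>t. (\<integral>w. of_real (Y w) * iexp (t * \<beta> w) \<partial>M) = of_real (expectation Y) * char \<gamma> t" for Y
  proof -
    define L where "L = K + 1"
    have intY: "integrable M Y" using YK by (intro integrable_const_bound[where B=K]) auto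
    have intYf: "integrable M (\<lambda>w. of_real (Y w) * f w)"
      if [measurable]: "f \<in> borel_measurable M" and "\<And>w. norm (f w) \<le> 1" for f :: "'a \<Rightarrow> complex"
      using mult_mono[OF YK that(2) K norm_ge_zero]
      by (intro integrable_const_bound[where B="K * 1"]) (auto simp: norm_mult)
    have intYi: "integrable M (\<lambda>w. Y w * indicator E (\<beta> w))"
      using YK K by (intro integrable_const_bound[where B="K"]) (auto simp: indicator_def abs_mult)
    have inti: "integrable M (\<lambda>w. indicator E (\<beta> w) :: real)"
      by (intro integrable_const_bound[where B="1"]) (auto simp: indicator_def)
    have inte: "integrable M (\<lambda>w. iexp (t * \<beta> w))" for t
      by (intro integrable_const_bound[where B="1"]) (auto)
    have Epos: "expectation Y \<ge> - K"
      using integral_mono[of M "\<lambda>_. - K" Y] intY YK by (auto simp: prob_space abs_le_iff minus_le_iff)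
    have 1: "(\<integral>w. (Y w + L) * indicator E (\<beta> w) \<partial>M) = expectation (\<lambda>w. Y w + L) * measure \<gamma> E"
    proof (rule expectation_indicator_of_char_nonneg[where K="2 * K + 1"])
      show "0 \<le> Y w + L" "Y w + L \<le> 2 * K + 1" for w using YK[of w] by (auto simp: L_def)
      show "0 < expectation (\<lambda>w. Y w + L)" using Epos intY by (simp add: prob_space L_def)
      fix t
      have "(\<integral>w. of_real (Y w + L) * iexp (t * \<beta> w) \<partial>M)
        = (\<integral>w. of_real (Y w) * iexp (t * \<beta> w) \<partial>M) + of_real L * (\<integral>w. iexp (t * \<beta> w) \<partial>M)"
        unfolding of_real_add distrib_right
        by (subst Bochner_Integration.integral_add) (auto simp del: of_real_mult intro!: intYf inte integrable_mult_right)
      also have "\<dots> = of_real (expectation (\<lambda>w. Y w + L)) * char \<gamma> t"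
        unfolding chY ch1 using intY by (simp add: prob_space algebra_simps)
      finally show "(\<integral>w. of_real (Y w + L) * iexp (t * \<beta> w) \<partial>M)
         = of_real (expectation (\<lambda>w. Y w + L)) * char \<gamma> t" .
    qed (use \<gamma> in auto)
    have 2: "(\<integral>w. 1 * indicator E (\<beta> w) \<partial>M) = expectation (\<lambda>w. 1) * measure \<gamma> E"
      by (rule expectation_indicator_of_char_nonneg[where K=1]) (use \<gamma> ch1 in \<open>auto simp: prob_space\<close>)
    have "(\<integral>w. (Y w + L) * indicator E (\<beta> w) \<partial>M)
      = (\<integral>w. Y w * indicator E (\<beta> w) \<partial>M) + L * (\<integral>w. 1 * indicator E (\<beta> w) \<partial>M)"
      unfolding distrib_right using intYi inti by (subst Bochner_Integration.integral_add) auto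
    then show ?thesis using 1 2 intY by (simp add: prob_space algebra_simps)
  qed
  have sum: "(\<integral>w. (X w + u * cnj (X w)) * iexp (t * \<beta> w) \<partial>M) = (\<integral>w. X w + u * cnj (X w) \<partial>M) * char \<gamma> t" for u t
  proof -
    have i1: "integrable M (\<lambda>w. X w * iexp (t * \<beta> w))" by (intro int) auto
    have "integrable M (\<lambda>w. cnj (X w * iexp (- t * \<beta> w)))"
      by (intro Bochner_Integration.integrable_cnj int) auto
    then have i2: "integrable M (\<lambda>w. cnj (X w) * iexp (t * \<beta> w))" by (simp add: exp_cnj)
    have i3: "integrable M (\<lambda>w. cnj (X w))" using intX by simp
    show ?thesis
      using i1 i2 i3 intX ch[of t] chc[of t] by (simp add: distrib_right mult.assoc)
  qed
  have Re: "(\<integral>w. Re (X w) * indicator E (\<beta> w) \<partial>M) = expectation (\<lambda>w. Re (X w)) * measure \<gamma> E"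
  proof (rule real_case)
    show "\<bar>Re (X w)\<bar> \<le> K" for w using XK[of w] abs_Re_le_cmod order_trans by blast
    have "X w + 1 * cnj (X w) = 2 * of_real (Re (X w))" for w by (simp add: complex_eq_iff)
    with sum[of 1] show "(\<integral>w. of_real (Re (X w)) * iexp (t * \<beta> w) \<partial>M) = of_real (expectation (\<lambda>w. Re (X w))) * char \<gamma> t" for t
      by (simp add: mult.assoc)
  qed simp
  have Im: "(\<integral>w. Im (X w) * indicator E (\<beta> w) \<partial>M) = expectation (\<lambda>w. Im (X w)) * measure \<gamma> E"
  proof (rule real_case)
    show "\<bar>Im (X w)\<bar> \<le> K" for w using XK[of w] abs_Im_le_cmod order_trans by blast
    have "X w + (-1) * cnj (X w) = (2 * \<i>) * of_real (Im (X w))" for w by (simp add: complex_eq_iff)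
    with sum[of "-1"] show "(\<integral>w. of_real (Im (X w)) * iexp (t * \<beta> w) \<partial>M) = of_real (expectation (\<lambda>w. Im (X w))) * char \<gamma> t" for t
      by (simp add: mult.assoc)
  qed simp
  have iE: "integrable M (\<lambda>w. X w * of_real (indicator E (\<beta> w)))"
    by (intro int) (auto simp: indicator_def)
  show ?thesis
    using Re Im intX iE
    by (simp add: complex_eq_iff flip: integral_Re integral_Im)
qed

text \<open>The induction exchanges the exponential factors for indicators one coordinate at a time; this needs
  only the uniqueness theorem on the real line.\<close>

lemma joint_distribution_of_char:
  fixes \<beta> :: "'i \<Rightarrow> 'a \<Rightarrow> real"
  assumes \<gamma>: "real_distribution \<gamma>" and D: "D \<in> events"
    and meas: "\<And>i. i \<in> I \<Longrightarrow> \<beta> i \<in> borel_measurable M"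
    and ch: "\<And>D A c. D \<in> \<D> \<Longrightarrow> finite A \<Longrightarrow> A \<subseteq> I \<Longrightarrow>
       (\<integral>w. indicator D w * iexp (\<Sum>i\<in>A. c i * \<beta> i w) \<partial>M) = of_real (prob D) * (\<Prod>i\<in>A. char \<gamma> (c i))"
    and \<D>: "D \<in> \<D>" "space M \<in> \<D>"
    and A: "finite A1" "finite A2" "A1 \<subseteq> I" "A2 \<subseteq> I" "A1 \<inter> A2 = {}"
    and E: "\<And>i. i \<in> A1 \<Longrightarrow> E i \<in> sets borel"
  shows "(\<integral>w. indicator D w * of_real (\<Prod>i\<in>A1. indicator (E i) (\<beta> i w)) * iexp (\<Sum>i\<in>A2. c i * \<beta> i w) \<partial>M)
    = of_real (prob D) * of_real (\<Prod>i\<in>A1. measure \<gamma> (E i)) * (\<Prod>i\<in>A2. char \<gamma> (c i))"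
  using A E
proof (induction A1 arbitrary: A2 c rule: finite_induct)
  case empty
  then show ?case using ch[OF \<D>(1)] by simp
next
  case (insert j A1)
  have j: "j \<in> I" "j \<notin> A2" "j \<notin> A1" using insert by auto
  have [measurable]: "\<beta> j \<in> borel_measurable M" "D \<in> events" using j meas D by auto
  have [measurable]: "(\<lambda>w. \<Prod>i\<in>A1. indicator (E i) (\<beta> i w) :: real) \<in> borel_measurable M"
    using insert.prems meas
    by (intro borel_measurable_prod measurable_compose[OF _ borel_measurable_indicator]) auto
  have [measurable]: "(\<lambda>w. \<Sum>i\<in>A2. c i * \<beta> i w) \<in> borel_measurable M"
    using insert.prems meas by (intro borel_measurable_sum borel_measurable_times) auto
  define X where "X w = indicator D w * of_real (\<Prod>i\<in>A1. indicator (E i) (\<beta> i w)) * iexp (\<Sum>i\<in>A2. c i * \<beta> i w)" for w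
  have [measurable]: "X \<in> borel_measurable M" unfolding X_def by measurable
  have XE: "(\<integral>w. X w \<partial>M) = of_real (prob D) * of_real (\<Prod>i\<in>A1. measure \<gamma> (E i)) * (\<Prod>i\<in>A2. char \<gamma> (c i))"
    unfolding X_def using insert.prems by (intro insert.IH) auto
  have "(\<integral>w. X w * of_real (indicator (E j) (\<beta> j w)) \<partial>M) = (\<integral>w. X w \<partial>M) * of_real (measure \<gamma> (E j))"
  proof (rule expectation_indicator_of_char[where K=1])
    have "norm (\<Prod>i\<in>A1. indicator (E i) (\<beta> i w) :: real) \<le> 1" for w
      unfolding real_norm_def abs_prod by (intro prod_le_1) (auto simp: indicator_def)
    moreover have "norm (X w) = indicator D w * norm (\<Prod>i\<in>A1. indicator (E i) (\<beta> i w) :: real)" for w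
      by (simp add: X_def norm_mult indicator_def del: of_real_prod)
    ultimately show "norm (X w) \<le> 1" for w
      by (auto simp: indicator_def)
    show "(\<integral>w. iexp (t * \<beta> j w) \<partial>M) = char \<gamma> t" for t
    proof -
      have "(\<integral>w. iexp (t * \<beta> j w) \<partial>M) = (\<integral>w. indicator (space M) w * iexp (\<Sum>i\<in>{j}. t * \<beta> i w) \<partial>M)"
        by (intro Bochner_Integration.integral_cong) auto
      also have "\<dots> = char \<gamma> t" using ch[OF \<D>(2), of "{j}" "\<lambda>_. t"] j by (simp add: prob_space)
      finally show ?thesis .
    qed
    show "(\<integral>w. X w * iexp (t * \<beta> j w) \<partial>M) = (\<integral>w. X w \<partial>M) * char \<gamma> t" for t
    proof -
      \<comment> \<open>The new exponential in \<open>\<beta> j\<close> is regarded as one more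
        coordinate of \<open>A2\<close>, so that the induction hypothesis evaluates it; this is why
        \<open>A2\<close> and \<open>c\<close> are arbitrary in the induction.\<close>
      let ?c = "c(j := t)"
      have s: "(\<Sum>i\<in>A2. ?c i * \<beta> i w) = (\<Sum>i\<in>A2. c i * \<beta> i w)" for w
        using j by (intro sum.cong) auto
      have p: "(\<Prod>i\<in>A2. char \<gamma> (?c i)) = (\<Prod>i\<in>A2. char \<gamma> (c i))"
        using j by (intro prod.cong) auto
      have "(\<integral>w. X w * iexp (t * \<beta> j w) \<partial>M)
        = (\<integral>w. indicator D w * of_real (\<Prod>i\<in>A1. indicator (E i) (\<beta> i w)) * iexp (\<Sum>i\<in>insert j A2. ?c i * \<beta> i w) \<partial>M)"
        using insert.prems(1) j s by (simp add: X_def algebra_simps exp_add)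
      also have "\<dots> = of_real (prob D) * of_real (\<Prod>i\<in>A1. measure \<gamma> (E i)) * (\<Prod>i\<in>insert j A2. char \<gamma> (?c i))"
        using insert.prems insert.hyps by (intro insert.IH) auto
      also have "\<dots> = (\<integral>w. X w \<partial>M) * char \<gamma> t"
        unfolding XE using insert.prems(1) j p by (simp add: mult_ac)
      finally show ?thesis .
    qed
  qed (use insert.prems \<gamma> in auto)
  then show ?case
    unfolding XE using insert.hyps by (simp add: X_def mult_ac)
qed

text \<open>As a function of \<open>\<beta> w\<close> the squared norm is a quadratic polynomial
  whose coefficients, collected in \<open>f\<close>, are measurable for \<open>N\<close>.
  Independence makes the joint law of \<open>f\<close> and \<open>\<beta>\<close> a product, so
  Fubini's theorem freezes \<open>f\<close> and leaves the one-dimensional bound, whose discriminant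
  condition is the Cauchy-Schwarz inequality. Passing to the real triple \<open>f\<close> replaces
  conditional expectations given \<open>N\<close>.\<close>

lemma gaussian_step_moment_le:
  fixes v y :: "'a \<Rightarrow> 'y::{real_inner, second_countable_topology}" and c \<beta> :: "'a \<Rightarrow> real"
  assumes N: "subalgebra M N"
    and ind: "indep_set (sets N) (sets (vimage_algebra (space M) \<beta> borel))"
    and \<beta>: "distr M borel \<beta> = centered_normal \<tau>" "\<beta> \<in> borel_measurable M" and \<tau>: "0 \<le> \<tau>"
    and v: "v \<in> borel_measurable N" and y: "y \<in> borel_measurable N"
    and c: "c \<in> borel_measurable N" "\<And>w. 0 \<le> c w"
    and p: "1 \<le> p"
  shows "(\<integral>\<^sup>+w. ennreal ((c w + (norm (v w + \<beta> w *\<^sub>R y w))\<^sup>2) powr p) \<partial>M)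
    \<le> (\<integral>\<^sup>+w. ennreal ((c w + (2 * p - 1) * (\<tau> * (norm (y w))\<^sup>2) + (norm (v w))\<^sup>2) powr p) \<partial>M)"
proof -
  interpret \<gamma>: real_distribution "centered_normal \<tau>" by (rule real_distribution_centered_normal)
  note [measurable] = \<beta>(2)
  let ?S = "borel \<Otimes>\<^sub>M borel \<Otimes>\<^sub>M borel :: (real \<times> real \<times> real) measure"
  define f where "f w = (c w + (norm (v w))\<^sup>2, v w \<bullet> y w, (norm (y w))\<^sup>2)" for w
  define \<psi> where "\<psi> = (\<lambda>((a, b, d), z). ennreal ((a + 2 * b * z + d * z\<^sup>2) powr p))"
  have \<psi>[measurable]: "\<psi> \<in> borel_measurable (?S \<Otimes>\<^sub>M borel)"
    unfolding \<psi>_def case_prod_beta by measurable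
  have fN: "f \<in> N \<rightarrow>\<^sub>M ?S"
    unfolding f_def using v y c by measurable
  have f[measurable]: "f \<in> M \<rightarrow>\<^sub>M ?S"
    using measurable_from_subalg[OF N fN] .
  interpret f: prob_space "distr M ?S f" by (rule prob_space_distr) (rule f)
  have dist: "distr M ?S f \<Otimes>\<^sub>M centered_normal \<tau> = distr M (?S \<Otimes>\<^sub>M borel) (\<lambda>w. (f w, \<beta> w))"
  proof (rule pair_measure_eqI)
    show "sets (distr M ?S f \<Otimes>\<^sub>M centered_normal \<tau>) = sets (distr M (?S \<Otimes>\<^sub>M borel) (\<lambda>w. (f w, \<beta> w)))"
      unfolding sets_distr by (intro sets_pair_measure_cong) auto
    fix U V assume "U \<in> sets (distr M ?S f)" "V \<in> sets (centered_normal \<tau>)"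
    then have U[measurable]: "U \<in> sets ?S" and V[measurable]: "V \<in> sets borel" by auto
    have fU: "f -` U \<inter> space M \<in> sets N"
      using measurable_sets[OF fN U] N unfolding subalgebra_def by auto
    have "\<beta> -` V \<inter> space M \<in> sets (vimage_algebra (space M) \<beta> borel)"
      using V by (rule in_vimage_algebra)
    then have "prob ((f -` U \<inter> space M) \<inter> (\<beta> -` V \<inter> space M)) = prob (f -` U \<inter> space M) * prob (\<beta> -` V \<inter> space M)"
      by (rule indep_setD[OF ind fU])
    moreover have "(\<lambda>w. (f w, \<beta> w)) -` (U \<times> V) \<inter> space M = (f -` U \<inter> space M) \<inter> (\<beta> -` V \<inter> space M)"
      by auto
    ultimately show "emeasure (distr M ?S f) U * emeasure (centered_normal \<tau>) V
      = emeasure (distr M (?S \<Otimes>\<^sub>M borel) (\<lambda>w. (f w, \<beta> w))) (U \<times> V)"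
      by (simp add: \<beta>(1)[symmetric] emeasure_distr emeasure_eq_measure ennreal_mult)
  qed (unfold_locales)
  have sets_eq: "sets (?S \<Otimes>\<^sub>M borel) = sets (distr M ?S f \<Otimes>\<^sub>M centered_normal \<tau>)"
    by (intro sets_pair_measure_cong) auto
  have \<psi>': "\<psi> \<in> borel_measurable (distr M ?S f \<Otimes>\<^sub>M centered_normal \<tau>)"
    using \<psi> measurable_cong_sets[OF sets_eq refl] by blast
  have sq: "(norm (v w + \<beta> w *\<^sub>R y w))\<^sup>2 = (norm (v w))\<^sup>2 + 2 * (v w \<bullet> y w) * \<beta> w + (norm (y w))\<^sup>2 * (\<beta> w)\<^sup>2" for w
    unfolding power2_norm_eq_inner
    by (simp add: inner_add_left inner_add_right inner_commute algebra_simps power2_eq_square[of "\<beta> w"])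
  have "(\<integral>\<^sup>+w. ennreal ((c w + (norm (v w + \<beta> w *\<^sub>R y w))\<^sup>2) powr p) \<partial>M)
    = (\<integral>\<^sup>+w. \<psi> (f w, \<beta> w) \<partial>M)"
    unfolding \<psi>_def f_def sq by (simp add: add_ac)
  also have "\<dots> = (\<integral>\<^sup>+x. \<psi> x \<partial>distr M (?S \<Otimes>\<^sub>M borel) (\<lambda>w. (f w, \<beta> w)))"
    by (subst nn_integral_distr) auto
  also have "\<dots> = (\<integral>\<^sup>+x. \<integral>\<^sup>+z. \<psi> (x, z) \<partial>centered_normal \<tau> \<partial>distr M ?S f)"
    unfolding dist[symmetric] by (rule \<gamma>.nn_integral_fst[OF \<psi>', symmetric])
  also have "\<dots> = (\<integral>\<^sup>+w. \<integral>\<^sup>+z. \<psi> (f w, z) \<partial>centered_normal \<tau> \<partial>M)"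
  proof (rule nn_integral_distr[where f="\<lambda>x. \<integral>\<^sup>+z. \<psi> (x, z) \<partial>centered_normal \<tau>"])
    show "(\<lambda>x. \<integral>\<^sup>+z. \<psi> (x, z) \<partial>centered_normal \<tau>) \<in> borel_measurable (distr M ?S f)"
      by (rule \<gamma>.borel_measurable_nn_integral_fst[OF \<psi>'])
  qed simp
  also have "\<dots> \<le> (\<integral>\<^sup>+w. ennreal ((c w + (2 * p - 1) * (\<tau> * (norm (y w))\<^sup>2) + (norm (v w))\<^sup>2) powr p) \<partial>M)"
  proof (intro nn_integral_mono)
    fix w
    have "(v w \<bullet> y w)\<^sup>2 \<le> (norm (v w))\<^sup>2 * (norm (y w))\<^sup>2"
      using Cauchy_Schwarz_ineq[of "v w" "y w"] by (simp add: power2_norm_eq_inner)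
    also have "\<dots> \<le> (c w + (norm (v w))\<^sup>2) * (norm (y w))\<^sup>2"
      using c by (intro mult_right_mono) auto
    finally have "(\<integral>\<^sup>+z. \<psi> (f w, z) \<partial>centered_normal \<tau>)
      \<le> ennreal ((c w + (norm (v w))\<^sup>2 + (2 * p - 1) * (\<tau> * (norm (y w))\<^sup>2)) powr p)"
      unfolding \<psi>_def f_def using c p \<tau> by (auto intro!: centered_normal_moment_le)
    then show "(\<integral>\<^sup>+z. \<psi> (f w, z) \<partial>centered_normal \<tau>)
      \<le> ennreal ((c w + (2 * p - 1) * (\<tau> * (norm (y w))\<^sup>2) + (norm (v w))\<^sup>2) powr p)"
      by (simp add: add_ac)
  qed
  finally show ?thesis .
qed

end

text \<open>The assumption on characteristic functions expresses two things at once: the coordinates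
  are independent centred normals of variance \<open>\<tau>\<close>, and jointly they are
  independent of \<open>F\<close>. In this form it can be verified for increments, whose linear
  combinations are again single values of the cylindrical Brownian motion.\<close>

locale gaussian_family = prob_space M for M :: "'a measure" +
  fixes F :: "'a measure" and \<tau> :: real and I :: "'i set" and \<beta> :: "'i \<Rightarrow> 'a \<Rightarrow> real"
  assumes F: "subalgebra M F" and \<tau>: "0 \<le> \<tau>"
    and meas_\<beta>: "\<And>i. i \<in> I \<Longrightarrow> \<beta> i \<in> borel_measurable M"
    and char_\<beta>: "\<And>D A c. D \<in> sets F \<Longrightarrow> finite A \<Longrightarrow> A \<subseteq> I \<Longrightarrow>
       (\<integral>w. indicator D w * iexp (\<Sum>i\<in>A. c i * \<beta> i w) \<partial>M)
         = of_real (prob D) * (\<Prod>i\<in>A. char (centered_normal \<tau>) (c i))"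
begin

definition cyl :: "'i set \<Rightarrow> 'a set \<Rightarrow> ('i \<Rightarrow> real set) \<Rightarrow> 'a set" where
  "cyl A D E = D \<inter> {w \<in> space M. \<forall>i\<in>A. \<beta> i w \<in> E i}"

text \<open>The sigma-algebra generated by \<open>F\<close> together with the coordinates in
  \<open>A\<close>, presented through a generator that is closed under intersection and on which
  probabilities factor.\<close>

definition joined :: "'i set \<Rightarrow> 'a measure" where
  "joined A = sigma (space M) {cyl A D E |D E. D \<in> sets F \<and> (\<forall>i\<in>A. E i \<in> sets borel)}"

lemma F_events: "D \<in> sets F \<Longrightarrow> D \<in> events"
  using F unfolding subalgebra_def by auto

lemma space_F: "space F = space M"
  using F unfolding subalgebra_def by auto

lemma cyl_events:
  assumes "finite A" "A \<subseteq> I" "D \<in> sets F" "\<And>i. i \<in> A \<Longrightarrow> E i \<in> sets borel"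
  shows "cyl A D E \<in> events"
proof -
  have "{w \<in> space M. \<beta> i w \<in> E i} \<in> events" if "i \<in> A" for i
  proof -
    have "\<beta> i -` E i \<inter> space M \<in> events"
      using assms that meas_\<beta>[of i] by (intro measurable_sets[of _ _ borel]) auto
    then show ?thesis by (simp add: vimage_def Int_def conj_commute)
  qed
  then have "{w \<in> space M. \<forall>i\<in>A. \<beta> i w \<in> E i} \<in> events"
    using assms by (intro sets.sets_Collect_finite_All) auto
  then show ?thesis unfolding cyl_def using F_events[OF assms(3)] by auto
qed

lemma prob_cyl:
  assumes "finite A" "A \<subseteq> I" "D \<in> sets F" "\<And>i. i \<in> A \<Longrightarrow> E i \<in> sets borel"
  shows "prob (cyl A D E) = prob D * (\<Prod>i\<in>A. measure (centered_normal \<tau>) (E i))"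
proof -
  have "of_real (prob (cyl A D E)) = (\<integral>w. complex_of_real (indicator (cyl A D E) w) \<partial>M)"
    using cyl_events[OF assms] by (simp add: sets.Int_space_eq2)
  also have "\<dots> = (\<integral>w. indicator D w * of_real (\<Prod>i\<in>A. indicator (E i) (\<beta> i w)) * iexp (\<Sum>i\<in>({}::'i set). 0 * \<beta> i w) \<partial>M)"
  proof (intro Bochner_Integration.integral_cong refl)
    fix w assume "w \<in> space M"
    moreover have "(\<Prod>i\<in>A. indicator (E i) (\<beta> i w)) = (of_bool (\<forall>i\<in>A. \<beta> i w \<in> E i) :: real)"
      using assms(1) by (auto simp: indicator_def prod_zero_iff)
    ultimately show "complex_of_real (indicator (cyl A D E) w)
      = indicator D w * of_real (\<Prod>i\<in>A. indicator (E i) (\<beta> i w)) * iexp (\<Sum>i\<in>({}::'i set). 0 * \<beta> i w)"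
      unfolding cyl_def by (auto simp del: of_real_prod simp: indicator_def)
  qed
  also have "\<dots> = of_real (prob D) * of_real (\<Prod>i\<in>A. measure (centered_normal \<tau>) (E i)) * (\<Prod>i\<in>({}::'i set). char (centered_normal \<tau>) 0)"
    using assms F_events sets.top[of F] unfolding space_F
    by (intro joint_distribution_of_char[where I=I and \<D>="sets F"] real_distribution_centered_normal char_\<beta>)
       (auto intro: meas_\<beta>)
  finally have "complex_of_real (prob (cyl A D E)) = of_real (prob D * (\<Prod>i\<in>A. measure (centered_normal \<tau>) (E i)))"
    by simp
  then show ?thesis by (simp only: of_real_eq_iff)
qed

lemma Int_stable_cyl: "Int_stable {cyl A D E |D E. D \<in> sets F \<and> (\<forall>i\<in>A. E i \<in> sets borel)}"
proof (rule Int_stableI, clarify)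
  fix D D' and E E' :: "'i \<Rightarrow> real set"
  assume "D \<in> sets F" "\<forall>i\<in>A. E i \<in> sets borel" "D' \<in> sets F" "\<forall>i\<in>A. E' i \<in> sets borel"
  moreover have "cyl A D E \<inter> cyl A D' E' = cyl A (D \<inter> D') (\<lambda>i. E i \<inter> E' i)"
    unfolding cyl_def by auto
  ultimately show "\<exists>D'' E''. cyl A D E \<inter> cyl A D' E' = cyl A D'' E'' \<and> D'' \<in> sets F \<and> (\<forall>i\<in>A. E'' i \<in> sets borel)"
    by blast
qed

lemma sets_joined: "sets (joined A) = sigma_sets (space M) {cyl A D E |D E. D \<in> sets F \<and> (\<forall>i\<in>A. E i \<in> sets borel)}"
  unfolding joined_def by (intro sets_measure_of) (auto simp: cyl_def)

lemma space_joined: "space (joined A) = space M"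
  unfolding joined_def by (intro space_measure_of) (auto simp: cyl_def)

lemma subalgebra_joined:
  assumes "finite A" "A \<subseteq> I"
  shows "subalgebra M (joined A)"
  unfolding subalgebra_def space_joined sets_joined
  using cyl_events[OF assms] by (auto intro!: sets.sigma_sets_subset)

lemma subalgebra_joined_F: "subalgebra (joined A) F"
  unfolding subalgebra_def space_joined space_F sets_joined
proof (intro conjI refl subsetI)
  fix D assume D: "D \<in> sets F"
  then have "D = cyl A D (\<lambda>_. UNIV)"
    using sets.sets_into_space[OF D] unfolding cyl_def space_F by auto
  with D show "D \<in> sigma_sets (space M) {cyl A D E |D E. D \<in> sets F \<and> (\<forall>i\<in>A. E i \<in> sets borel)}"
    by (intro sigma_sets.Basic) (auto intro!: exI[of _ D] exI[of _ "\<lambda>_. UNIV"])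
qed

lemma measurable_joined:
  assumes "i \<in> A"
  shows "\<beta> i \<in> borel_measurable (joined A)"
proof (rule measurableI)
  fix B :: "real set" assume "B \<in> sets borel"
  moreover have "\<beta> i -` B \<inter> space (joined A) = cyl A (space M) (\<lambda>j. if j = i then B else UNIV)"
    using assms unfolding cyl_def space_joined by auto
  ultimately show "\<beta> i -` B \<inter> space (joined A) \<in> sets (joined A)"
    using sets.top[of F] unfolding sets_joined space_F
    by (intro sigma_sets.Basic) (auto intro!: exI[of _ "space M"] exI[of _ "\<lambda>j. if j = i then B else UNIV"])
qed simp

lemma prob_vimage:
  assumes "i \<in> I" "B \<in> sets borel"
  shows "prob (\<beta> i -` B \<inter> space M) = measure (centered_normal \<tau>) B"
proof -
  have "\<beta> i -` B \<inter> space M = cyl {i} (space M) (\<lambda>_. B)" unfolding cyl_def by auto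
  then show ?thesis using prob_cyl[of "{i}" "space M" "\<lambda>_. B"] assms sets.top[of F]
    by (simp add: space_F prob_space)
qed

lemma distr_\<beta>:
  assumes "i \<in> I"
  shows "distr M borel (\<beta> i) = centered_normal \<tau>"
proof (rule measure_eqI)
  interpret \<gamma>: real_distribution "centered_normal \<tau>" by (rule real_distribution_centered_normal)
  fix B assume "B \<in> sets (distr M borel (\<beta> i))"
  then show "emeasure (distr M borel (\<beta> i)) B = emeasure (centered_normal \<tau>) B"
    using prob_vimage[OF assms, of B] meas_\<beta>[OF assms]
    by (simp add: emeasure_distr emeasure_eq_measure \<gamma>.emeasure_eq_measure)
qed (simp add: real_distribution.events_eq_borel[OF real_distribution_centered_normal])

text \<open>Intersecting a cylinder over \<open>A\<close> with an event of coordinate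
  \<open>j\<close> yields a cylinder over \<open>insert j A\<close>, whose probability factors by
  \<open>prob_cyl\<close>. Both generators are stable under intersection, so the factorisation
  extends. Coordinates can thus be integrated out one at a time, the remaining ones counting as part
  of the past.\<close>

lemma indep_joined:
  assumes A: "finite A" "A \<subseteq> I" and j: "j \<in> I" "j \<notin> A"
  shows "indep_set (sets (joined A)) (sets (vimage_algebra (space M) (\<beta> j) borel))"
proof -
  have "indep_set {cyl A D E |D E. D \<in> sets F \<and> (\<forall>i\<in>A. E i \<in> sets borel)}
     {\<beta> j -` B \<inter> space M |B. B \<in> sets borel}"
  proof (rule indep_setI)
    show "{cyl A D E |D E. D \<in> sets F \<and> (\<forall>i\<in>A. E i \<in> sets borel)} \<subseteq> events"
      using cyl_events[OF A] by auto
    show "{\<beta> j -` B \<inter> space M |B. B \<in> sets borel} \<subseteq> events"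
      using measurable_sets[OF meas_\<beta>[OF j(1)]] by auto
  next
    fix a b
    assume "a \<in> {cyl A D E |D E. D \<in> sets F \<and> (\<forall>i\<in>A. E i \<in> sets borel)}"
      "b \<in> {\<beta> j -` B \<inter> space M |B. B \<in> sets borel}"
    then obtain D E B where a: "a = cyl A D E" "D \<in> sets F" "\<forall>i\<in>A. E i \<in> sets borel"
      and b: "b = \<beta> j -` B \<inter> space M" "B \<in> sets borel"
      by blast
    have "a \<inter> b = cyl (insert j A) D (E(j := B))"
      using j unfolding a b cyl_def by auto
    then have "prob (a \<inter> b) = prob (cyl (insert j A) D (E(j := B)))"
      by simp
    also have "\<dots> = prob D * (\<Prod>i\<in>insert j A. measure (centered_normal \<tau>) ((E(j := B)) i))"
      by (rule prob_cyl) (use a b A j in auto)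
    also have "\<dots> = prob D * (\<Prod>i\<in>A. measure (centered_normal \<tau>) (E i)) * measure (centered_normal \<tau>) B"
    proof -
      have "(\<Prod>i\<in>A. measure (centered_normal \<tau>) ((E(j := B)) i)) = (\<Prod>i\<in>A. measure (centered_normal \<tau>) (E i))"
        using j by (intro prod.cong) auto
      then show ?thesis using A j by (simp add: mult_ac del: fun_upd_apply add: fun_upd_same)
    qed
    also have "\<dots> = prob a * prob b"
      unfolding a(1) b(1) using prob_cyl[OF A a(2)] a(3) prob_vimage[OF j(1) b(2)] by simp
    finally show "prob (a \<inter> b) = prob a * prob b" .
  qed
  then have "indep_set (sets (joined A)) (sigma_sets (space M) {\<beta> j -` B \<inter> space M |B. B \<in> sets borel})"
    unfolding sets_joined
  proof (rule indep_set_sigma_sets[OF _ Int_stable_cyl])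
    show "Int_stable {\<beta> j -` B \<inter> space M |B. B \<in> sets borel}"
    proof (rule Int_stableI, clarify)
      fix B B' :: "real set" assume "B \<in> sets borel" "B' \<in> sets borel"
      then show "\<exists>C. (\<beta> j -` B \<inter> space M) \<inter> (\<beta> j -` B' \<inter> space M) = \<beta> j -` C \<inter> space M \<and> C \<in> sets borel"
        by (intro exI[of _ "B \<inter> B'"]) auto
    qed
  qed
  then show ?thesis by (simp add: sets_vimage_algebra)
qed

text \<open>Coordinate \<open>j\<close> is integrated out with \<open>F\<close> and the coordinates
  in \<open>A\<close> frozen. Its contribution
  \<open>(2 * p - 1) * (\<tau> * (norm (y j w))\<^sup>2)\<close> is measurable for \<open>F\<close>
  alone and is absorbed into \<open>c\<close>, so the induction hypothesis applies to the enlarged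
  \<open>c\<close>; the random offset exists for this purpose.\<close>

lemma gaussian_sum_moment_le:
  fixes v :: "'a \<Rightarrow> 'y::{real_inner, second_countable_topology}"
  assumes A: "finite A" "A \<subseteq> I"
    and v: "v \<in> borel_measurable F" and y: "\<And>i. i \<in> A \<Longrightarrow> y i \<in> borel_measurable F"
    and c: "c \<in> borel_measurable F" "\<And>w. 0 \<le> c w"
    and p: "1 \<le> p"
  shows "(\<integral>\<^sup>+w. ennreal ((c w + (norm (v w + (\<Sum>i\<in>A. \<beta> i w *\<^sub>R y i w)))\<^sup>2) powr p) \<partial>M)
    \<le> (\<integral>\<^sup>+w. ennreal ((c w + (2 * p - 1) * (\<tau> * (\<Sum>i\<in>A. (norm (y i w))\<^sup>2)) + (norm (v w))\<^sup>2) powr p) \<partial>M)"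
  using A y c
proof (induction A arbitrary: c rule: finite_induct)
  case (insert j A)
  have fromF: "f \<in> borel_measurable (joined A)" if "f \<in> borel_measurable F" for f :: "'a \<Rightarrow> 'z::topological_space"
    using measurable_from_subalg[OF subalgebra_joined_F that] .
  have m: "(\<lambda>w. v w + (\<Sum>i\<in>A. \<beta> i w *\<^sub>R y i w)) \<in> borel_measurable (joined A)"
    using insert.prems v fromF measurable_joined
    by (intro borel_measurable_add borel_measurable_sum borel_measurable_scaleR) auto
  have "(\<integral>\<^sup>+w. ennreal ((c w + (norm (v w + (\<Sum>i\<in>insert j A. \<beta> i w *\<^sub>R y i w)))\<^sup>2) powr p) \<partial>M)
    = (\<integral>\<^sup>+w. ennreal ((c w + (norm ((v w + (\<Sum>i\<in>A. \<beta> i w *\<^sub>R y i w)) + \<beta> j w *\<^sub>R y j w))\<^sup>2) powr p) \<partial>M)"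
    using insert.hyps by (simp add: add_ac)
  also have "\<dots> \<le> (\<integral>\<^sup>+w. ennreal (((c w + (2 * p - 1) * (\<tau> * (norm (y j w))\<^sup>2))
      + (norm (v w + (\<Sum>i\<in>A. \<beta> i w *\<^sub>R y i w)))\<^sup>2) powr p) \<partial>M)"
    using insert.hyps insert.prems \<tau> p m
    by (intro gaussian_step_moment_le[OF subalgebra_joined[of A] indep_joined[of A]]) (auto intro: fromF distr_\<beta> meas_\<beta>)
  also have "\<dots> \<le> (\<integral>\<^sup>+w. ennreal (((c w + (2 * p - 1) * (\<tau> * (norm (y j w))\<^sup>2))
      + (2 * p - 1) * (\<tau> * (\<Sum>i\<in>A. (norm (y i w))\<^sup>2)) + (norm (v w))\<^sup>2) powr p) \<partial>M)"
    using insert.prems \<tau> p by (intro insert.IH) auto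
  also have "\<dots> = (\<integral>\<^sup>+w. ennreal ((c w + (2 * p - 1) * (\<tau> * (\<Sum>i\<in>insert j A. (norm (y i w))\<^sup>2)) + (norm (v w))\<^sup>2) powr p) \<partial>M)"
    using insert.hyps by (simp add: algebra_simps)
  finally show ?case .
qed simp

end


lemma (in prob_space) indep_var_of_indep_set:
  fixes X :: "'a \<Rightarrow> 'b::topological_space"
  assumes N: "subalgebra M N"
    and ind: "indep_set (sets N) (sets (vimage_algebra (space M) \<beta> borel))"
    and \<beta>: "\<beta> \<in> borel_measurable M"
    and X: "X \<in> borel_measurable N" and g: "g \<in> borel \<rightarrow>\<^sub>M borel"
  shows "indep_var borel X borel (\<lambda>w. g (\<beta> w))"
  unfolding indep_var_eq
proof (intro conjI)
  show "random_variable borel X" using measurable_from_subalg[OF N X] .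
  show "random_variable borel (\<lambda>w. g (\<beta> w))" using \<beta> g by measurable
  have "{X -` A \<inter> space M |A. A \<in> sets borel} \<subseteq> sets N"
    using measurable_sets[OF X] N unfolding subalgebra_def by auto
  then have 1: "sigma_sets (space M) {X -` A \<inter> space M |A. A \<in> sets borel} \<subseteq> sets N"
    using N sets.sigma_sets_subset[of _ N] unfolding subalgebra_def by simp
  have "(\<lambda>w. g (\<beta> w)) -` A \<inter> space M \<in> sets (vimage_algebra (space M) \<beta> borel)" if "A \<in> sets borel" for A
  proof -
    have "g -` A \<in> sets borel" using measurable_sets[OF g that] by simp
    from in_vimage_algebra[OF this, of \<beta> "space M"] show ?thesis by (simp add: vimage_def)
  qed
  then have "{(\<lambda>w. g (\<beta> w)) -` A \<inter> space M |A. A \<in> sets borel} \<subseteq> sets (vimage_algebra (space M) \<beta> borel)"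
    by auto
  then have 2: "sigma_sets (space M) {(\<lambda>w. g (\<beta> w)) -` A \<inter> space M |A. A \<in> sets borel}
     \<subseteq> sets (vimage_algebra (space M) \<beta> borel)"
    using sets.sigma_sets_subset[of _ "vimage_algebra (space M) \<beta> borel"] by simp
  show "indep_set (sigma_sets (space M) {X -` A \<inter> space M |A. A \<in> sets borel})
     (sigma_sets (space M) {(\<lambda>w. g (\<beta> w)) -` A \<inter> space M |A. A \<in> sets borel})"
    by (intro indep_setI subset_trans[OF 1 indep_setD_ev1[OF ind]] subset_trans[OF 2 indep_setD_ev2[OF ind]]
        indep_setD[OF ind] subsetD[OF 1] subsetD[OF 2])
qed

text \<open>Both cases of \<open>gaussian_rv\<close> obey one formula: a centred point mass sits at
  0 and has second moment 0.\<close>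

lemma (in prob_space) char_gaussian_rv:
  assumes g: "gaussian_rv M X" and sq: "integrable M (\<lambda>w. (X w)\<^sup>2)" and m: "expectation X = 0"
  shows "(\<integral>w. iexp (X w) \<partial>M) = of_real (exp (- expectation (\<lambda>w. (X w)\<^sup>2) / 2))"
proof -
  have [measurable]: "X \<in> borel_measurable M" using g by (simp add: gaussian_rv_def)
  from g consider m where "AE w in M. X w = m"
    | m s where "s > 0" "distributed M lborel X (normal_density m s)"
    unfolding gaussian_rv_def by blast
  then show ?thesis
  proof cases
    case (1 c)
    then have "expectation X = expectation (\<lambda>_. c)" by (intro integral_cong_AE) auto
    then have c: "c = 0" using m by (simp add: prob_space)
    have "AE w in M. iexp (X w) = 1" "AE w in M. (X w)\<^sup>2 = 0"
      using 1 c by (auto elim: eventually_mono)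
    then have "(\<integral>w. iexp (X w) \<partial>M) = (\<integral>w. 1 \<partial>M)" "expectation (\<lambda>w. (X w)\<^sup>2) = expectation (\<lambda>_. 0)"
      by (intro integral_cong_AE; simp)+
    then show ?thesis by (simp add: prob_space)
  next
    case (2 c s)
    have c: "c = 0" using normal_distributed_expectation[OF 2] m by simp
    have v: "expectation (\<lambda>w. (X w)\<^sup>2) = s\<^sup>2" using normal_distributed_variance[OF 2] m by simp
    have "distributed M lborel (\<lambda>w. X w / s) std_normal_density"
      using normal_standard_normal_convert[OF 2(1), of X c] 2(2) c by simp
    then have d: "distr M lborel (\<lambda>w. X w / s) = std_normal_distribution"
      by (rule distributed_distr_eq_density)
    have "(\<integral>w. iexp (X w) \<partial>M) = (\<integral>x. iexp (s * x) \<partial>distr M lborel (\<lambda>w. X w / s))"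
      using 2(1) by (subst integral_distr) auto
    also have "\<dots> = of_real (exp (- expectation (\<lambda>w. (X w)\<^sup>2) / 2))"
      using char_std_normal_distribution unfolding d v char_def by (auto dest: fun_cong)
    finally show ?thesis .
  qed
qed

section \<open>Cylindrical Brownian motion\<close>

text \<open>The integrand behind an increment over \<open>(a, b)\<close> in direction
  \<open>h\<close>. Evaluating \<open>W\<close> on it once, instead of taking a difference of two
  values of \<open>W_at\<close>, makes independence of \<open>Fil a\<close> an instance of the
  definition; the two agree only almost surely.\<close>

definition bump :: "real \<Rightarrow> real \<Rightarrow> 'h::real_vector \<Rightarrow> real \<Rightarrow> 'h" where
  "bump a b h s = indicator {a<..<b} s *\<^sub>R h"

lemma W_at_bump: "W_at W t h = W (bump 0 t h)"
  unfolding W_at_def bump_def[abs_def] ..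

locale cylindrical_brownian_motion = prob_space M for M :: "'w measure" +
  fixes Fil :: "real \<Rightarrow> 'w measure" and T :: real
    and W :: "(real \<Rightarrow> 'h::{real_inner, second_countable_topology}) \<Rightarrow> 'w \<Rightarrow> real"
  assumes usual: "usual_filtered_prob_space M Fil T"
    and T_pos: "0 < T"
    and W: "cylindrical_BM M Fil T W"
begin

lemma subalgebra_Fil: "0 \<le> t \<Longrightarrow> t \<le> T \<Longrightarrow> subalgebra M (Fil t)"
  using usual unfolding usual_filtered_prob_space_def by auto

lemma sets_Fil_mono: "0 \<le> s \<Longrightarrow> s \<le> t \<Longrightarrow> t \<le> T \<Longrightarrow> sets (Fil s) \<subseteq> sets (Fil t)"
  using usual unfolding usual_filtered_prob_space_def by auto

lemma subalgebra_Fil_mono: "0 \<le> s \<Longrightarrow> s \<le> t \<Longrightarrow> t \<le> T \<Longrightarrow> subalgebra (Fil t) (Fil s)"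
  using subalgebra_Fil[of s] subalgebra_Fil[of t] sets_Fil_mono[of s t]
  unfolding subalgebra_def by auto

lemma null_sets_Fil: "0 \<le> t \<Longrightarrow> t \<le> T \<Longrightarrow> null_sets M \<subseteq> sets (Fil t)"
  using usual sets_Fil_mono[of 0 t] unfolding usual_filtered_prob_space_def by blast

text \<open>The equations of the scheme and the limits of increments hold only almost surely; the
  null sets contained in the filtration turn them into adaptedness. Preimages under \<open>f\<close>
  and \<open>g\<close> differ only inside a null set.\<close>

lemma measurable_Fil_AE:
  fixes f g :: "'w \<Rightarrow> 'b::topological_space"
  assumes t: "0 \<le> t" "t \<le> T" and g: "g \<in> borel_measurable (Fil t)" and f: "f \<in> borel_measurable M"
    and ae: "AE w in M. f w = g w"
  shows "f \<in> borel_measurable (Fil t)"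
proof (rule measurableI)
  have sp: "space (Fil t) = space M" using subalgebra_Fil[OF t] unfolding subalgebra_def by simp
  from ae obtain N where N: "N \<in> null_sets M" "{w \<in> space M. f w \<noteq> g w} \<subseteq> N"
    by (auto elim!: AE_E2 simp: eventually_ae_filter)
  fix V :: "'b set" assume V: "V \<in> sets borel"
  have fV: "f -` V \<inter> space M \<in> sets M" using measurable_sets[OF f V] .
  have gV: "g -` V \<inter> space M \<in> sets (Fil t)" using measurable_sets[OF g V] sp by simp
  have "f -` V \<inter> space M \<inter> N \<in> null_sets M"
    using null_set_Int1[OF N(1) fV] .
  then have "((g -` V \<inter> space M) - N) \<union> (f -` V \<inter> space M \<inter> N) \<in> sets (Fil t)"
    using gV N(1) null_sets_Fil[OF t] by auto
  also have "((g -` V \<inter> space M) - N) \<union> (f -` V \<inter> space M \<inter> N) = f -` V \<inter> space (Fil t)"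
    using N(2) sp by auto
  finally show "f -` V \<inter> space (Fil t) \<in> sets (Fil t)" .
qed simp

lemma measurable_time: "f \<in> borel_measurable borel \<Longrightarrow> f \<in> borel_measurable (time_measure T)"
  by (intro measurable_restrict_space1) simp

lemma measure_time_Ioo:
  assumes "0 \<le> a" "b \<le> T"
  shows "measure (time_measure T) ({a<..<b} \<inter> {0..T}) = max 0 (b - a)"
proof -
  have "measure (time_measure T) ({a<..<b} \<inter> {0..T}) = measure lborel ({a<..<b} \<inter> {0..T})"
    by (rule measure_restrict_space) auto
  moreover have "{a<..<b} \<inter> {0..T} = {a<..<b}" using assms by auto
  ultimately have "measure (time_measure T) ({a<..<b} \<inter> {0..T}) = measure lborel {a<..<b}" by metis
  also have "\<dots> = max 0 (b - a)" by (cases "a \<le> b") auto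
  finally show ?thesis .
qed

lemma finite_time_measure: "finite_measure (time_measure T)"
  by (rule finite_measureI) (simp add: emeasure_restrict_space space_restrict_space emeasure_lborel_Icc_eq)

lemma bump_L2: "bump a b h \<in> L2_time T"
proof -
  interpret finite_measure "time_measure T" by (rule finite_time_measure)
  have [measurable]: "bump a b h \<in> borel_measurable (time_measure T)"
    unfolding bump_def by (intro measurable_time) measurable
  have "integrable (time_measure T) (\<lambda>t. (norm (bump a b h t))\<^sup>2)"
  proof (rule integrable_const_bound[where B="(norm h)\<^sup>2"])
    show "AE t in time_measure T. norm ((norm (bump a b h t))\<^sup>2) \<le> (norm h)\<^sup>2"
      by (auto simp: bump_def indicator_def)
  qed measurable
  then show ?thesis unfolding L2_time_def by auto
qed

lemma bump_inner:
  assumes "0 \<le> a" "b \<le> T" "0 \<le> a'" "b' \<le> T"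
  shows "(\<integral>t. bump a b h t \<bullet> bump a' b' h' t \<partial>time_measure T) = max 0 (min b b' - max a a') * (h \<bullet> h')"
proof -
  have "(\<integral>t. bump a b h t \<bullet> bump a' b' h' t \<partial>time_measure T)
    = (\<integral>t. indicator {max a a'<..<min b b'} t * (h \<bullet> h') \<partial>time_measure T)"
    by (intro Bochner_Integration.integral_cong) (auto simp: bump_def indicator_def)
  also have "\<dots> = max 0 (min b b' - max a a') * (h \<bullet> h')"
    using measure_time_Ioo[of "max a a'" "min b b'"] assms by (simp add: space_restrict_space)
  finally show ?thesis .
qed

lemma W_measurable[measurable]: "b \<in> L2_time T \<Longrightarrow> W b \<in> borel_measurable M"
  using W unfolding cylindrical_BM_def gaussian_rv_def by blast

lemma W_sq_integrable: "b \<in> L2_time T \<Longrightarrow> integrable M (\<lambda>w. (W b w)\<^sup>2)"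
  using W unfolding cylindrical_BM_def by blast

lemma W_integrable: "b \<in> L2_time T \<Longrightarrow> integrable M (W b)"
  by (rule square_integrable_imp_integrable[OF W_measurable W_sq_integrable])

lemma W_mult_integrable: "b \<in> L2_time T \<Longrightarrow> c \<in> L2_time T \<Longrightarrow> integrable M (\<lambda>w. W b w * W c w)"
proof (rule Bochner_Integration.integrable_bound)
  assume b: "b \<in> L2_time T" and c: "c \<in> L2_time T"
  show "integrable M (\<lambda>w. (W b w)\<^sup>2 + (W c w)\<^sup>2)" using W_sq_integrable b c by auto
  show "(\<lambda>w. W b w * W c w) \<in> borel_measurable M" using b c by measurable
  have "\<bar>x * y\<bar> \<le> x\<^sup>2 + y\<^sup>2" for x y :: real
  proof -
    have "2 * \<bar>x * y\<bar> \<le> x\<^sup>2 + y\<^sup>2"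
      using sum_squares_bound[of "\<bar>x\<bar>" "\<bar>y\<bar>"] by (simp add: abs_mult)
    then show ?thesis using zero_le_power2[of x] zero_le_power2[of y] by linarith
  qed
  then show "AE w in M. norm (W b w * W c w) \<le> norm ((W b w)\<^sup>2 + (W c w)\<^sup>2)" by simp
qed

lemma W_cov: "b \<in> L2_time T \<Longrightarrow> c \<in> L2_time T \<Longrightarrow>
    (\<integral>w. W b w * W c w \<partial>M) = (\<integral>t. b t \<bullet> c t \<partial>time_measure T)"
  using W unfolding cylindrical_BM_def by blast

lemma W_bump_cov:
  assumes "0 \<le> a" "b \<le> T" "0 \<le> a'" "b' \<le> T"
  shows "(\<integral>w. W (bump a b h) w * W (bump a' b' h') w \<partial>M) = max 0 (min b b' - max a a') * (h \<bullet> h')"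
  unfolding W_cov[OF bump_L2 bump_L2] bump_inner[OF assms] ..

lemma W_bump_sq:
  assumes "0 \<le> a" "a \<le> b" "b \<le> T"
  shows "(\<integral>w. (W (bump a b h) w)\<^sup>2 \<partial>M) = (b - a) * (norm h)\<^sup>2"
  using W_bump_cov[of a b a b h h] assms unfolding power2_norm_eq_inner by (simp add: power2_eq_square)

lemma W_bump_measurable_Fil:
  assumes "0 \<le> a" "b \<le> t" "0 \<le> t" "t \<le> T"
  shows "W (bump a b h) \<in> borel_measurable (Fil t)"
proof -
  have "supported_in T (bump a b h) {0..t}"
    unfolding supported_in_def bump_def using assms
    by (intro AE_I2) (auto simp: indicator_def space_restrict_space)
  then show ?thesis using W bump_L2[of a b h] assms unfolding cylindrical_BM_def by simp
qed

lemma W_bump_indep: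
  assumes "0 \<le> s" "s \<le> a" "s \<le> T"
  shows "indep_set (sets (Fil s)) (sets (vimage_algebra (space M) (W (bump a b h)) borel))"
proof -
  have "supported_in T (bump a b h) {s..T}"
    unfolding supported_in_def bump_def using assms
    by (intro AE_I2) (auto simp: indicator_def space_restrict_space)
  then show ?thesis using W bump_L2[of a b h] assms unfolding cylindrical_BM_def by simp
qed

text \<open>Linearity is not part of the definition of \<open>W\<close>. The mean square of the
  defect is expanded into its inner products with \<open>W e\<close>, \<open>W f\<close> and
  \<open>W g\<close>, and each of these vanishes because the covariance is bilinear in the
  integrands.\<close>

lemma W_linear:
  assumes f: "f \<in> L2_time T" and g: "g \<in> L2_time T" and e: "e \<in> L2_time T"
    and efg: "AE s in time_measure T. e s = f s + r *\<^sub>R g s"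
  shows "AE w in M. W e w = W f w + r * W g w"
proof -
  have L2i: "integrable (time_measure T) (\<lambda>t. u t \<bullet> v t)" if "u \<in> L2_time T" "v \<in> L2_time T"
    for u v :: "real \<Rightarrow> 'h"
  proof (rule Bochner_Integration.integrable_bound)
    have [measurable]: "u \<in> borel_measurable (time_measure T)" "v \<in> borel_measurable (time_measure T)"
      using that by (auto simp: L2_time_def)
    show "integrable (time_measure T) (\<lambda>t. (norm (u t))\<^sup>2 + (norm (v t))\<^sup>2)"
      using that by (auto simp: L2_time_def)
    show "(\<lambda>t. u t \<bullet> v t) \<in> borel_measurable (time_measure T)" by measurable
    have "\<bar>x \<bullet> y\<bar> \<le> (norm x)\<^sup>2 + (norm y)\<^sup>2" for x y :: 'h
      using Cauchy_Schwarz_ineq2[of x y] sum_squares_bound[of "norm x" "norm y"] mult_nonneg_nonneg[of "norm x" "norm y"]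
      by (simp add: mult.assoc)
    then show "AE t in time_measure T. norm (u t \<bullet> v t) \<le> norm ((norm (u t))\<^sup>2 + (norm (v t))\<^sup>2)" by simp
  qed
  have ip: "(\<integral>w. W e w * W u w \<partial>M) = (\<integral>w. W f w * W u w \<partial>M) + r * (\<integral>w. W g w * W u w \<partial>M)"
    if u: "u \<in> L2_time T" for u
  proof -
    have [measurable]: "v \<in> borel_measurable (time_measure T)" if "v \<in> L2_time T" for v :: "real \<Rightarrow> 'h"
      using that by (auto simp: L2_time_def)
    have "(\<integral>t. e t \<bullet> u t \<partial>time_measure T) = (\<integral>t. f t \<bullet> u t + r * (g t \<bullet> u t) \<partial>time_measure T)"
      using efg u f g e by (intro integral_cong_AE) (auto simp: inner_add_left)
    then show ?thesis
      using u f g e L2i[OF f u] L2i[OF g u] by (simp add: W_cov)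
  qed
  have "(\<integral>w. (W e w - (W f w + r * W g w))\<^sup>2 \<partial>M)
    = (\<integral>w. W e w * W e w - W f w * W e w - r * (W g w * W e w)
        - (W e w * W f w - W f w * W f w - r * (W g w * W f w))
        - r * (W e w * W g w - W f w * W g w - r * (W g w * W g w)) \<partial>M)"
    by (intro Bochner_Integration.integral_cong refl) (simp add: power2_eq_square algebra_simps)
  also have "\<dots> = 0"
  proof -
    note I = W_mult_integrable[OF e e] W_mult_integrable[OF f e] W_mult_integrable[OF g e]
      W_mult_integrable[OF e f] W_mult_integrable[OF f f] W_mult_integrable[OF g f]
      W_mult_integrable[OF e g] W_mult_integrable[OF f g] W_mult_integrable[OF g g]
    have c: "(\<integral>w. W f w * W e w \<partial>M) = (\<integral>w. W e w * W f w \<partial>M)" "(\<integral>w. W g w * W e w \<partial>M) = (\<integral>w. W e w * W g w \<partial>M)"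
      by (simp_all add: mult.commute)
    show ?thesis by (simp add: I c ip[OF e] ip[OF f] ip[OF g])
  qed
  finally have "(\<integral>w. (W e w - (W f w + r * W g w))\<^sup>2 \<partial>M) = 0" .
  moreover have "integrable M (\<lambda>w. (W e w - (W f w + r * W g w))\<^sup>2)"
  proof -
    have "integrable M (\<lambda>w. W e w * W e w - W f w * W e w - r * (W g w * W e w)
        - (W e w * W f w - W f w * W f w - r * (W g w * W f w))
        - r * (W e w * W g w - W f w * W g w - r * (W g w * W g w)))"
      using W_mult_integrable e f g by (intro Bochner_Integration.integrable_diff integrable_mult_right) auto
    then show ?thesis 
      by (rule back_subst[where P="integrable M"]) (auto simp: power2_eq_square algebra_simps)
  qed
  ultimately have "AE w in M. (W e w - (W f w + r * W g w))\<^sup>2 = 0"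
    by (subst (asm) integral_nonneg_eq_0_iff_AE) auto
  then show ?thesis by eventually_elim simp
qed

lemma W_bump_split:
  assumes "0 \<le> a" "a \<le> b" "b \<le> c"
  shows "AE w in M. W (bump a c h) w = W (bump a b h) w + W (bump b c h) w"
proof -
  have "AE s in time_measure T. s \<noteq> b"
    using AE_lborel_singleton[of b] by (subst AE_restrict_space_iff) auto
  then have "AE s in time_measure T. (bump a c h s :: 'h) = bump a b h s + 1 *\<^sub>R bump b c h s"
    by eventually_elim (use assms in \<open>auto simp: bump_def indicator_def\<close>)
  from W_linear[OF bump_L2 bump_L2 bump_L2 this] show ?thesis by simp
qed

lemma W_at_diff:
  assumes "0 \<le> a" "a \<le> b"
  shows "AE w in M. W_at W b h w - W_at W a h w = W (bump a b h) w"
  using W_bump_split[OF order.refl assms, of h] unfolding W_at_bump by eventually_elim simp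

lemma W_bump_sum:
  assumes "finite A"
  shows "AE w in M. W (bump a b (\<Sum>i\<in>A. c i *\<^sub>R x i)) w = (\<Sum>i\<in>A. c i * W (bump a b (x i)) w)"
  using assms
proof (induction A rule: finite_induct)
  case empty
  have "AE s in time_measure T. bump a b 0 s = (bump a b 0 s :: 'h) + 1 *\<^sub>R bump a b 0 s"
    by (simp add: bump_def)
  from W_linear[OF bump_L2 bump_L2 bump_L2 this] show ?case by simp
next
  case (insert j A)
  have "AE s in time_measure T. (bump a b (\<Sum>i\<in>insert j A. c i *\<^sub>R x i) s :: 'h)
     = bump a b (\<Sum>i\<in>A. c i *\<^sub>R x i) s + c j *\<^sub>R bump a b (x j) s"
    using insert.hyps by (simp add: bump_def algebra_simps)
  from W_linear[OF bump_L2 bump_L2 bump_L2 this] insert.IH show ?case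
    by eventually_elim (use insert.hyps in simp)
qed

lemma W_bump_indep_integral:
  fixes X :: "'w \<Rightarrow> 'b::{real_normed_field, banach, second_countable_topology}"
  assumes s: "0 \<le> s" "s \<le> a" "s \<le> T" and X: "X \<in> borel_measurable (Fil s)" "integrable M X"
    and g: "g \<in> borel \<rightarrow>\<^sub>M borel" "integrable M (\<lambda>w. g (W (bump a b h) w))"
  shows "(\<integral>w. X w * g (W (bump a b h) w) \<partial>M) = (\<integral>w. X w \<partial>M) * (\<integral>w. g (W (bump a b h) w) \<partial>M)"
  by (rule indep_var_lebesgue_integral[OF indep_var_of_indep_set[OF subalgebra_Fil[OF s(1,3)]
        W_bump_indep[OF s] W_measurable[OF bump_L2] X(1) g(1)] X(2) g(2)])

text \<open>Of two adjacent intervals one carries an increment of mean zero, because the two increments are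
  both uncorrelated and independent. Bisecting, the whole mean is carried by arbitrarily short
  intervals, so it vanishes by the covariance identity.\<close>

lemma W_bump_mean_bisect:
  assumes "0 \<le> a" "a \<le> b" "b \<le> T"
  shows "\<bar>expectation (W (bump a b h))\<bar> \<le> norm h * sqrt ((b - a) / 2 ^ n)"
  using assms
proof (induction n arbitrary: a b)
  case 0
  have "(expectation (W (bump a b h)))\<^sup>2 \<le> expectation (\<lambda>w. (W (bump a b h) w)\<^sup>2)"
  proof -
    have "0 \<le> variance (W (bump a b h))" by simp
    then show ?thesis using W_integrable[OF bump_L2] W_sq_integrable[OF bump_L2] by (simp add: variance_eq)
  qed
  also have "\<dots> = (norm h * sqrt (b - a))\<^sup>2"
    using 0 by (simp add: W_bump_sq power_mult_distrib)
  finally show ?case using 0 by (simp add: abs_le_square_iff[symmetric])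
next
  case (Suc n)
  define m where "m = (a + b) / 2"
  have m: "a \<le> m" "m \<le> b" "m - a = (b - a) / 2" "b - m = (b - a) / 2"
    using Suc.prems by (auto simp: m_def field_simps)
  have "expectation (\<lambda>w. W (bump a m h) w * W (bump m b h) w) = expectation (W (bump a m h)) * expectation (W (bump m b h))"
    using Suc.prems m W_integrable[OF bump_L2]
    by (intro W_bump_indep_integral[where s=m and g="\<lambda>x. x"] W_bump_measurable_Fil) auto
  moreover have "expectation (\<lambda>w. W (bump a m h) w * W (bump m b h) w) = 0"
    using Suc.prems m by (subst W_bump_cov) auto
  ultimately have "expectation (W (bump a m h)) = 0 \<or> expectation (W (bump m b h)) = 0" by simp
  moreover have "expectation (W (bump a b h)) = expectation (\<lambda>w. W (bump a m h) w + W (bump m b h) w)"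
    using W_bump_split[of a m b h] Suc.prems m W_measurable[OF bump_L2] by (intro integral_cong_AE) auto
  then have "expectation (W (bump a b h)) = expectation (W (bump a m h)) + expectation (W (bump m b h))"
    using W_integrable[OF bump_L2] by simp
  moreover have "\<bar>expectation (W (bump a m h))\<bar> \<le> norm h * sqrt ((b - a) / 2 ^ Suc n)"
    "\<bar>expectation (W (bump m b h))\<bar> \<le> norm h * sqrt ((b - a) / 2 ^ Suc n)"
    using Suc.IH[of a m] Suc.IH[of m b] Suc.prems m(1,2) unfolding m(3,4) divide_divide_eq_left power_Suc[symmetric]
    by auto
  ultimately show ?case by auto
qed

lemma W_bump_mean:
  assumes "0 \<le> a" "a \<le> b" "b \<le> T"
  shows "expectation (W (bump a b h)) = 0"
proof -
  have "(\<lambda>n. (b - a) / 2 ^ n) \<longlonglongrightarrow> 0"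
    by (rule LIMSEQ_divide_realpow_zero) simp
  from tendsto_mult_left[OF tendsto_real_sqrt[OF this], of "norm h"]
  have "(\<lambda>n. norm h * sqrt ((b - a) / 2 ^ n)) \<longlonglongrightarrow> 0" by simp
  then have "\<bar>expectation (W (bump a b h))\<bar> \<le> 0"
    using W_bump_mean_bisect[OF assms] by (intro LIMSEQ_le_const) auto
  then show ?thesis by simp
qed

lemma W_bump_char:
  assumes "0 \<le> a" "a \<le> b" "b \<le> T"
  shows "(\<integral>w. iexp (W (bump a b h) w) \<partial>M) = of_real (exp (- ((b - a) * (norm h)\<^sup>2) / 2))"
proof -
  have "gaussian_rv M (W (bump a b h))"
    using W bump_L2[of a b h] unfolding cylindrical_BM_def by blast
  from char_gaussian_rv[OF this W_sq_integrable[OF bump_L2] W_bump_mean[OF assms]] show ?thesis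
    unfolding W_bump_sq[OF assms] .
qed

text \<open>By linearity the exponent is a single increment in direction
  \<open>\<Sum>h\<in>A. c h *\<^sub>R h\<close>, hence Gaussian and independent of
  \<open>Fil a\<close>. Orthonormality makes its squared length the sum of the
  \<open>(c h)\<^sup>2\<close>, and the exponential of that sum is the product of the
  one-dimensional characteristic functions.\<close>

lemma gaussian_family_bump:
  assumes "0 \<le> a" "a \<le> b" "b \<le> T" and B: "pairwise orthogonal B" "\<And>h. h \<in> B \<Longrightarrow> norm h = 1"
  shows "gaussian_family M (Fil a) (b - a) B (\<lambda>h. W (bump a b h))"
proof
  show "subalgebra M (Fil a)" using subalgebra_Fil assms by auto
  show "W (bump a b h) \<in> borel_measurable M" for h using W_measurable[OF bump_L2] .
  fix D A and c :: "'h \<Rightarrow> real" assume D: "D \<in> sets (Fil a)" and A: "finite A" "A \<subseteq> B"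
  have [measurable]: "D \<in> sets M" using D subalgebra_Fil[of a] assms unfolding subalgebra_def by auto
  note [measurable] = W_measurable[OF bump_L2]
  let ?h = "\<Sum>h\<in>A. c h *\<^sub>R h"
  have n: "(norm ?h)\<^sup>2 = (\<Sum>h\<in>A. (c h)\<^sup>2)"
  proof -
    have "(norm ?h)\<^sup>2 = (\<Sum>h\<in>A. (norm (c h *\<^sub>R h))\<^sup>2)"
      using A B by (intro norm_sum_Pythagorean) (auto simp: pairwise_def orthogonal_def subset_iff)
    also have "\<dots> = (\<Sum>h\<in>A. (c h)\<^sup>2)" using A B(2) by (intro sum.cong) auto
    finally show ?thesis .
  qed
  have "(\<integral>w. indicator D w * iexp (\<Sum>i\<in>A. c i * W (bump a b i) w) \<partial>M)
    = (\<integral>w. indicator D w * iexp (W (bump a b ?h) w) \<partial>M)"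
    using W_bump_sum[OF A(1), of a b c "\<lambda>h. h"] by (intro integral_cong_AE) auto
  also have "\<dots> = (\<integral>w. indicator D w \<partial>M) * (\<integral>w. iexp (W (bump a b ?h) w) \<partial>M)"
    using assms D
    by (intro W_bump_indep_integral[where s=a]) (auto intro!: integrable_const_bound[where B=1] simp: indicator_def)
  also have "(\<integral>w. indicator D w \<partial>M) = complex_of_real (prob D)"
  proof -
    have "(\<integral>w. indicator D w \<partial>M) = (\<integral>w. complex_of_real (indicator D w) \<partial>M)"
      by (intro Bochner_Integration.integral_cong) (auto simp: indicator_def)
    also have "\<dots> = complex_of_real (prob D)"
      unfolding integral_complex_of_real by (simp add: sets.Int_space_eq2)
    finally show ?thesis .
  qed
  also have "of_real (prob D) * (\<integral>w. iexp (W (bump a b ?h) w) \<partial>M) = of_real (prob D) * of_real (\<Prod>h\<in>A. exp (- ((b - a) * (c h)\<^sup>2) / 2))"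
    using A(1) by (simp add: W_bump_char[OF assms(1-3)] n exp_sum sum_distrib_left sum_divide_distrib flip: sum_negf)
  also have "\<dots> = of_real (prob D) * (\<Prod>h\<in>A. char (centered_normal (b - a)) (c h))"
    using assms by (simp add: char_centered_normal)
  finally show "(\<integral>w. indicator D w * iexp (\<Sum>i\<in>A. c i * W (bump a b i) w) \<partial>M)
    = of_real (prob D) * (\<Prod>i\<in>A. char (centered_normal (b - a)) (c i))" .
qed (use assms in simp)

end


section \<open>Hilbert--Schmidt operators\<close>

text \<open>Indices with integrals below \<open>(1 / 2) ^ n\<close> make the series of the
  \<open>g (r n)\<close> integrable, hence almost everywhere finite, so its terms tend to 0. The map
  \<open>r\<close> need not increase; along it only convergence is used.\<close>

lemma AE_subseq_of_nn_integral:
  fixes g :: "nat \<Rightarrow> 'a \<Rightarrow> real"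
  assumes [measurable]: "\<And>n. g n \<in> borel_measurable M" and g0: "\<And>n w. 0 \<le> g n w"
    and lim: "(\<lambda>n. \<integral>\<^sup>+w. ennreal (g n w) \<partial>M) \<longlonglongrightarrow> 0"
  shows "\<exists>r. AE w in M. (\<lambda>n. g (r n) w) \<longlonglongrightarrow> 0"
proof -
  have "\<exists>k. (\<integral>\<^sup>+w. ennreal (g k w) \<partial>M) < ennreal ((1 / 2) ^ n)" for n
    using eventually_happens'[OF _ order_tendstoD(2)[OF lim, of "ennreal ((1 / 2) ^ n)"]]
    by (auto simp: ennreal_less_zero_iff)
  then obtain r where r: "(\<integral>\<^sup>+w. ennreal (g (r n) w) \<partial>M) < ennreal ((1 / 2) ^ n)" for n
    by metis
  have "(\<integral>\<^sup>+w. (\<Sum>n. ennreal (g (r n) w)) \<partial>M) = (\<Sum>n. \<integral>\<^sup>+w. ennreal (g (r n) w) \<partial>M)"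
    by (rule nn_integral_suminf) measurable
  also have "\<dots> \<le> (\<Sum>n. ennreal ((1 / 2) ^ n))"
    using r by (intro suminf_le less_imp_le) auto
  also have "\<dots> < \<infinity>"
    by (subst suminf_ennreal_eq[where x=2]) (use power_half_series geometric_sums[of "1/2 :: real"] in auto)
  finally have "AE w in M. (\<Sum>n. ennreal (g (r n) w)) \<noteq> \<infinity>"
    by (intro nn_integral_PInf_AE) auto
  then have "AE w in M. (\<lambda>n. g (r n) w) \<longlonglongrightarrow> 0"
  proof eventually_elim
    case (elim w)
    then have "summable (\<lambda>n. g (r n) w)"
      using g0 by (intro summable_suminf_not_top) auto
    then show ?case by (rule summable_LIMSEQ_zero)
  qed
  then show ?thesis by blast
qed

lemma norm_add_sq_le: "(norm (x + y))\<^sup>2 \<le> 2 * (norm x)\<^sup>2 + 2 * (norm y)\<^sup>2"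
  for x y :: "'y::real_normed_vector"
proof -
  have "(norm (x + y))\<^sup>2 \<le> (norm x + norm y)\<^sup>2" by (intro power_mono norm_triangle_ineq) auto
  also have "\<dots> \<le> 2 * (norm x)\<^sup>2 + 2 * (norm y)\<^sup>2"
    using sum_squares_bound[of "norm x" "norm y"] by (simp add: power2_sum)
  finally show ?thesis .
qed

locale hs_basis =
  fixes B :: "'h::{real_inner, second_countable_topology} set"
  assumes onb: "orthonormal_basis B"
begin

lemma orthogonal_B: "pairwise orthogonal B"
  and norm_B: "h \<in> B \<Longrightarrow> norm h = 1"
  and closure_span_B: "closure (span B) = UNIV"
  using onb unfolding orthonormal_basis_def by auto

lemma inner_B: "g \<in> B \<Longrightarrow> h \<in> B \<Longrightarrow> g \<bullet> h = (if g = h then 1 else 0)"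
  using orthogonal_B norm_B by (auto simp: pairwise_def orthogonal_def norm_eq_1)

lemma countable_B: "countable B"
proof -
  have "dist g h \<ge> 1" if "g \<in> B" "h \<in> B" "g \<noteq> h" for g h
  proof -
    have "(dist g h)\<^sup>2 = 2"
      using inner_B[OF that(1,2)] inner_B[OF that(1,1)] inner_B[OF that(2,2)] inner_B[OF that(2,1)] that(3)
      by (simp add: dist_norm power2_norm_eq_inner inner_diff_left inner_diff_right)
    then have "1\<^sup>2 \<le> (dist g h)\<^sup>2" by simp
    then show ?thesis by (rule power2_le_imp_le) simp
  qed
  then have disj: "disjnt (ball g (1 / 2)) (ball h (1 / 2))" if "g \<in> B" "h \<in> B" "g \<noteq> h" for g h
    using that unfolding disjnt_iff mem_ball by (smt (verit) dist_triangle2 field_sum_of_halves)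
  have "countable ((\<lambda>h. ball h (1 / 2)) ` B)"
    using disj by (intro countable_disjoint_open_subsets) (auto simp: pairwise_def)
  moreover have "inj_on (\<lambda>h. ball h (1 / 2)) B"
  proof (rule inj_onI, rule ccontr)
    fix g h assume "g \<in> B" "h \<in> B" "ball g (1 / 2) = ball h (1 / 2 :: real)" "g \<noteq> h"
    with disj[of g h] show False by (auto simp: disjnt_def)
  qed
  ultimately show ?thesis by (rule countable_image_inj_on)
qed

text \<open>A sequence of finite sets cofinal among the finite subsets of \<open>B\<close>. It turns
  unordered limits over \<open>B\<close> into sequential ones, as measurability of limits, Fatou's
  lemma and dominated convergence demand. The intersection matters only for empty \<open>B\<close>,
  where \<open>from_nat_into\<close> returns an arbitrary vector.\<close>

definition exhaust :: "nat \<Rightarrow> 'h set" where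
  "exhaust n = B \<inter> from_nat_into B ` {..<n}"

lemma exhaust: "finite (exhaust n)" "exhaust n \<subseteq> B"
  unfolding exhaust_def by auto

lemma filterlim_exhaust: "filterlim exhaust (finite_subsets_at_top B) sequentially"
  unfolding filterlim_finite_subsets_at_top
proof (intro allI impI)
  fix X assume X: "finite X \<and> X \<subseteq> B"
  define m where "m = Suc (Max (to_nat_on B ` X))"
  have "X \<subseteq> exhaust n" if "m \<le> n" for n
  proof
    fix x assume x: "x \<in> X"
    then have "to_nat_on B x \<le> Max (to_nat_on B ` X)" using X by (intro Max_ge) auto
    then have "to_nat_on B x < n" using that unfolding m_def by simp
    moreover have "from_nat_into B (to_nat_on B x) = x"
      using X x countable_B by (intro from_nat_into_to_nat_on) auto
    ultimately show "x \<in> exhaust n" using X x unfolding exhaust_def by (metis IntI image_eqI lessThan_iff subsetD)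
  qed
  then show "\<forall>\<^sub>F n in sequentially. finite (exhaust n) \<and> X \<subseteq> exhaust n \<and> exhaust n \<subseteq> B"
    using exhaust by (auto simp: eventually_sequentially)
qed

lemma hs_ops_sq_summable: "R \<in> hs_ops B \<Longrightarrow> (\<lambda>h. (norm (blinfun_apply R h))\<^sup>2) summable_on B"
  unfolding hs_ops_def by simp

lemma hs_ops_add:
  fixes R Q :: "'h \<Rightarrow>\<^sub>L 'y::real_normed_vector"
  assumes "R \<in> hs_ops B" "Q \<in> hs_ops B"
  shows "R + Q \<in> hs_ops B"
proof -
  have "(\<lambda>h. (norm (R h + Q h))\<^sup>2) summable_on B"
  proof (rule summable_on_comparison_test)
    show "(\<lambda>h. 2 * (norm (R h))\<^sup>2 + 2 * (norm (Q h))\<^sup>2) summable_on B"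
      using assms by (intro summable_on_add summable_on_cmult_right hs_ops_sq_summable)
  qed (auto intro: norm_add_sq_le)
  then show ?thesis by (simp add: hs_ops_def plus_blinfun.rep_eq)
qed

lemma hs_ops_scaleR:
  fixes R :: "'h \<Rightarrow>\<^sub>L 'y::real_normed_vector"
  assumes "R \<in> hs_ops B"
  shows "c *\<^sub>R R \<in> hs_ops B"
  using summable_on_cmult_right[OF hs_ops_sq_summable[OF assms], of "c\<^sup>2"]
  by (simp add: hs_ops_def scaleR_blinfun.rep_eq power_mult_distrib)

lemma hs_ops_diff:
  fixes R Q :: "'h \<Rightarrow>\<^sub>L 'y::real_normed_vector"
  assumes "R \<in> hs_ops B" "Q \<in> hs_ops B"
  shows "R - Q \<in> hs_ops B"
  using hs_ops_add[OF assms(1) hs_ops_scaleR[OF assms(2), of "-1"]] by simp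

lemma hs_norm_nonneg: "0 \<le> hs_norm B R"
  unfolding hs_norm_def by (intro real_sqrt_ge_zero infsum_nonneg) auto

lemma hs_norm_sq: "(hs_norm B R)\<^sup>2 = (\<Sum>\<^sub>\<infinity>h\<in>B. (norm (blinfun_apply R h))\<^sup>2)"
  unfolding hs_norm_def by (simp add: infsum_nonneg)

lemma hs_norm_scaleR: "hs_norm B (c *\<^sub>R R) = \<bar>c\<bar> * hs_norm B R"
  unfolding hs_norm_def
  by (simp add: scaleR_blinfun.rep_eq power_mult_distrib infsum_cmult_right' real_sqrt_mult)

lemma sum_le_hs_norm_sq:
  assumes "R \<in> hs_ops B" "finite A" "A \<subseteq> B"
  shows "(\<Sum>h\<in>A. (norm (blinfun_apply R h))\<^sup>2) \<le> (hs_norm B R)\<^sup>2"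
  unfolding hs_norm_sq using assms by (intro finite_sum_le_infsum hs_ops_sq_summable) auto

lemma norm_le_hs_norm:
  assumes "R \<in> hs_ops B" "h \<in> B"
  shows "norm (blinfun_apply R h) \<le> hs_norm B R"
  using sum_le_hs_norm_sq[OF assms(1), of "{h}"] assms(2) by (intro power2_le_imp_le[OF _ hs_norm_nonneg]) simp

lemma sets_hs_borel: "sets (hs_borel B :: ('h \<Rightarrow>\<^sub>L 'y::real_normed_vector) measure) = sigma_sets (hs_ops B) {V. hs_open B V}"
  unfolding hs_borel_def by (intro sets_measure_of) (auto simp: hs_open_def)

lemma space_hs_borel: "space (hs_borel B :: ('h \<Rightarrow>\<^sub>L 'y::real_normed_vector) measure) = hs_ops B"
  unfolding hs_borel_def by (intro space_measure_of) (auto simp: hs_open_def)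

text \<open>Evaluation at a basis vector is 1-Lipschitz for the Hilbert-Schmidt norm, so preimages
  of open sets are \<open>hs_open\<close>. Through it the measurability of \<open>G\<close> into
  \<open>hs_borel B\<close> is used coordinate by coordinate.\<close>

lemma measurable_hs_eval:
  assumes "h \<in> B"
  shows "(\<lambda>R :: 'h \<Rightarrow>\<^sub>L 'y::real_normed_vector. blinfun_apply R h) \<in> hs_borel B \<rightarrow>\<^sub>M borel"
proof (rule borel_measurableI)
  fix V :: "'y set" assume V: "open V"
  have "hs_open B ((\<lambda>R. blinfun_apply R h) -` V \<inter> hs_ops B)"
    unfolding hs_open_def
  proof (intro conjI ballI)
    fix R assume R: "R \<in> (\<lambda>R. blinfun_apply R h) -` V \<inter> hs_ops B"
    with V obtain e where e: "e > 0" "ball (R h) e \<subseteq> V" by (auto simp: open_contains_ball)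
    have "Q \<in> (\<lambda>R. blinfun_apply R h) -` V \<inter> hs_ops B" if Q: "Q \<in> hs_ops B" "hs_norm B (Q - R) < e" for Q
    proof -
      have "dist (R h) (Q h) < e"
        using norm_le_hs_norm[OF hs_ops_diff[OF Q(1)] assms, of R] R Q(2)
        by (simp add: dist_norm norm_minus_commute minus_blinfun.rep_eq)
      with e Q show ?thesis by auto
    qed
    with e show "\<exists>e>0. \<forall>Q\<in>hs_ops B. hs_norm B (Q - R) < e \<longrightarrow> Q \<in> (\<lambda>R. blinfun_apply R h) -` V \<inter> hs_ops B"
      by blast
  qed auto
  then show "(\<lambda>R. blinfun_apply R h) -` V \<inter> space (hs_borel B) \<in> sets (hs_borel B)"
    unfolding space_hs_borel sets_hs_borel by (intro sigma_sets.Basic) simp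
qed

lemma measurable_hs_norm:
  fixes f :: "'a \<Rightarrow> 'h \<Rightarrow>\<^sub>L 'y::{real_normed_vector, second_countable_topology}"
  assumes hs: "\<And>w. w \<in> space N \<Longrightarrow> f w \<in> hs_ops B"
    and meas: "\<And>h. h \<in> B \<Longrightarrow> (\<lambda>w. blinfun_apply (f w) h) \<in> borel_measurable N"
  shows "(\<lambda>w. hs_norm B (f w)) \<in> borel_measurable N"
proof (rule borel_measurable_LIMSEQ_real)
  show "(\<lambda>w. sqrt (\<Sum>h\<in>exhaust n. (norm (blinfun_apply (f w) h))\<^sup>2)) \<in> borel_measurable N" for n
  proof -
    have [measurable]: "(\<lambda>w. blinfun_apply (f w) h) \<in> borel_measurable N" if "h \<in> exhaust n" for h
      using meas exhaust that by auto
    show ?thesis by (intro measurable_compose[OF _ borel_measurable_sqrt] borel_measurable_sum) measurable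
  qed
  fix w assume "w \<in> space N"
  then have "((\<lambda>A. \<Sum>h\<in>A. (norm (blinfun_apply (f w) h))\<^sup>2) \<longlongrightarrow> (hs_norm B (f w))\<^sup>2) (finite_subsets_at_top B)"
    unfolding hs_norm_sq by (intro infsum_tendsto hs_ops_sq_summable hs)
  from tendsto_real_sqrt[OF filterlim_compose[OF this filterlim_exhaust]]
  show "(\<lambda>n. sqrt (\<Sum>h\<in>exhaust n. (norm (blinfun_apply (f w) h))\<^sup>2)) \<longlonglongrightarrow> hs_norm B (f w)"
    by (simp add: abs_of_nonneg[OF hs_norm_nonneg])
qed

text \<open>The Fourier sum of \<open>x\<close> over \<open>A\<close> is the best approximation of \<open>x\<close> in \<open>span A\<close>, and \<open>span B\<close> is dense.\<close>

lemma parseval: "((\<lambda>h. (x \<bullet> h) * (y \<bullet> h)) has_sum x \<bullet> y) B"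
proof -
  define P where "P A = (\<Sum>h\<in>A. (x \<bullet> h) *\<^sub>R h)" for A
  have P: "norm (x - P A) \<le> norm (x - z)" if A: "finite A" "A \<subseteq> B" and z: "z \<in> span A" for A z
  proof -
    have o: "(x - P A) \<bullet> g = 0" if "g \<in> A" for g
    proof -
      have "P A \<bullet> g = (\<Sum>h\<in>A. if h = g then x \<bullet> h else 0)"
        unfolding P_def inner_sum_left using A that
        by (intro sum.cong) (auto simp: inner_B subset_iff)
      then show ?thesis using A that by (simp add: inner_diff_left)
    qed
    have "P A \<in> span A" unfolding P_def by (intro span_sum span_scale span_base)
    then have "P A - z \<in> span A" using z by (rule span_diff)
    then have "orthogonal (x - P A) (P A - z)"
      by (rule orthogonal_to_span) (simp add: orthogonal_def o)
    then have "(norm ((x - P A) + (P A - z)))\<^sup>2 = (norm (x - P A))\<^sup>2 + (norm (P A - z))\<^sup>2"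
      by (rule norm_add_Pythagorean)
    then have "(norm (x - P A))\<^sup>2 \<le> (norm (x - z))\<^sup>2" by simp
    then show ?thesis by (rule power2_le_imp_le) simp
  qed
  have "(P \<longlongrightarrow> x) (finite_subsets_at_top B)"
  proof (rule tendstoI)
    fix e :: real assume e: "e > 0"
    have "x \<in> closure (span B)" unfolding closure_span_B by simp
    with e obtain z where z: "z \<in> span B" "dist z x < e" unfolding closure_approachable by blast
    from z(1) obtain A where A: "finite A" "A \<subseteq> B" "z \<in> span A"
      unfolding span_explicit by (auto intro!: span_sum span_scale span_base)
    show "\<forall>\<^sub>F A in finite_subsets_at_top B. dist (P A) x < e"
      unfolding eventually_finite_subsets_at_top
    proof (intro exI[of _ A] conjI A allI impI)
      fix Y assume Y: "finite Y \<and> A \<subseteq> Y \<and> Y \<subseteq> B"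
      then have "z \<in> span Y" using A(3) span_mono by blast
      then show "dist (P Y) x < e"
        using P[of Y z] Y z(2) by (simp add: dist_norm norm_minus_commute)
    qed
  qed
  then have "((\<lambda>A. P A \<bullet> y) \<longlongrightarrow> x \<bullet> y) (finite_subsets_at_top B)"
    by (intro tendsto_intros)
  then show ?thesis
    unfolding has_sum_def P_def by (simp add: inner_sum_left inner_commute[of y])
qed

end


section \<open>Moments of increments\<close>

locale cylindrical_brownian_motion_basis = cylindrical_brownian_motion M Fil T W + hs_basis B
  for M :: "'w measure" and Fil T
    and W :: "(real \<Rightarrow> 'h::{real_inner, second_countable_topology}) \<Rightarrow> 'w \<Rightarrow> real" and B :: "'h set"
begin

abbreviation incr :: "real \<Rightarrow> real \<Rightarrow> 'h \<Rightarrow> 'w \<Rightarrow> real" where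
  "incr a b h w \<equiv> W_at W b h w - W_at W a h w"

lemma incr_measurable[measurable]: "incr a b h \<in> borel_measurable M"
  unfolding W_at_bump using W_measurable[OF bump_L2] by measurable

lemma incr_measurable_Fil:
  assumes "0 \<le> a" "a \<le> b" "b \<le> T"
  shows "incr a b h \<in> borel_measurable (Fil b)"
  unfolding W_at_bump using assms by (intro borel_measurable_diff W_bump_measurable_Fil) auto

lemma incr_bump_AE:
  assumes "0 \<le> a" "a \<le> b" "finite A"
  shows "AE w in M. \<forall>h\<in>A. incr a b h w = W (bump a b h) w"
  using assms by (intro AE_finite_allI W_at_diff) auto

lemma measurable_M_Fil:
  assumes "0 \<le> t" "t \<le> T" "f \<in> borel_measurable (Fil t)"
  shows "f \<in> borel_measurable M"
  using measurable_from_subalg[OF subalgebra_Fil[OF assms(1,2)] assms(3)] .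

lemma L2_limit_AE_subseq:
  fixes X :: "'w \<Rightarrow> 'y::{real_normed_vector, second_countable_topology}"
  assumes [measurable]: "\<And>n. Z n \<in> borel_measurable M" "X \<in> borel_measurable M"
    and lim: "(\<lambda>n. \<integral>\<^sup>+w. ennreal ((norm (Z n w - X w))\<^sup>2) \<partial>M) \<longlonglongrightarrow> 0"
  shows "\<exists>r. AE w in M. (\<lambda>n. Z (r n) w) \<longlonglongrightarrow> X w"
proof -
  obtain r where "AE w in M. (\<lambda>n. (norm (Z (r n) w - X w))\<^sup>2) \<longlonglongrightarrow> 0"
    using AE_subseq_of_nn_integral[OF _ _ lim] by auto
  then have "AE w in M. (\<lambda>n. Z (r n) w) \<longlonglongrightarrow> X w"
  proof eventually_elim
    case (elim w)
    from tendsto_real_sqrt[OF this] have "(\<lambda>n. norm (Z (r n) w - X w)) \<longlonglongrightarrow> 0" by simp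
    then show ?case by (simp add: tendsto_norm_zero_iff LIM_zero_iff)
  qed
  then show ?thesis by blast
qed

text \<open>Both the increments of the scheme and the Ito integrals of its continuous extension are
  mean square limits of finite sums of this kind, with coefficients measurable for
  \<open>Fil a\<close>; the results below treat them together.\<close>

context
  fixes a b :: real and y :: "'h \<Rightarrow> 'w \<Rightarrow> 'y::{real_inner, banach, second_countable_topology}"
    and A :: "nat \<Rightarrow> 'h set" and X :: "'w \<Rightarrow> 'y"
  assumes ab: "0 \<le> a" "a \<le> b" "b \<le> T"
    and y: "\<And>h. h \<in> B \<Longrightarrow> y h \<in> borel_measurable (Fil a)"
    and A: "\<And>n. finite (A n)" "\<And>n. A n \<subseteq> B"
    and X: "X \<in> borel_measurable M"
    and lim: "(\<lambda>n. \<integral>\<^sup>+w. ennreal ((norm ((\<Sum>h\<in>A n. incr a b h w *\<^sub>R y h w) - X w))\<^sup>2) \<partial>M) \<longlonglongrightarrow> 0"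
begin

lemma increment_sum_measurable: "(\<lambda>w. \<Sum>h\<in>A n. incr a b h w *\<^sub>R y h w) \<in> borel_measurable (Fil b)"
proof (intro borel_measurable_sum borel_measurable_scaleR incr_measurable_Fil ab)
  fix h assume "h \<in> A n"
  then show "y h \<in> borel_measurable (Fil b)"
    using measurable_from_subalg[OF subalgebra_Fil_mono[OF ab] y] A(2) by blast
qed

lemma increment_sum_measurable_M: "(\<lambda>w. \<Sum>h\<in>A n. incr a b h w *\<^sub>R y h w) \<in> borel_measurable M"
  using measurable_M_Fil[OF _ _ increment_sum_measurable] ab by auto

text \<open>Some selection of the partial sums, all measurable for \<open>Fil b\<close>, converges
  almost everywhere, and \<open>Fil b\<close> contains the null sets. The next step of the scheme
  starts from this measurability.\<close>

lemma increment_measurable: "X \<in> borel_measurable (Fil b)"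
proof -
  obtain r where r: "AE w in M. (\<lambda>n. \<Sum>h\<in>A (r n). incr a b h w *\<^sub>R y h w) \<longlonglongrightarrow> X w"
    using L2_limit_AE_subseq[OF increment_sum_measurable_M X lim] by blast
  show ?thesis
  proof (rule measurable_Fil_AE[OF _ ab(3) _ X])
    show "(\<lambda>w. lim (\<lambda>n. \<Sum>h\<in>A (r n). incr a b h w *\<^sub>R y h w)) \<in> borel_measurable (Fil b)"
      by (intro borel_measurable_lim_metric increment_sum_measurable)
    show "AE w in M. X w = lim (\<lambda>n. \<Sum>h\<in>A (r n). incr a b h w *\<^sub>R y h w)"
      using r by eventually_elim (simp add: limI)
  qed (use ab in simp)
qed

text \<open>Convergence in mean square says nothing about moments of order above 2. The finite sums
  satisfy a bound that does not depend on \<open>n\<close>, and Fatou's lemma along an almost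
  everywhere convergent selection carries it to \<open>X\<close>. A positive \<open>c\<close> keeps
  the base of the power away from 0, where continuity is immediate.\<close>

lemma increment_moment_le:
  fixes c p :: real
  assumes v: "v \<in> borel_measurable (Fil a)"
    and s: "\<And>n w. (\<Sum>h\<in>A n. (norm (y h w))\<^sup>2) \<le> s w"
    and c: "0 < c" and p: "1 \<le> p"
  shows "(\<integral>\<^sup>+w. ennreal ((c + (norm (v w + X w))\<^sup>2) powr p) \<partial>M)
    \<le> (\<integral>\<^sup>+w. ennreal ((c + (2 * p - 1) * ((b - a) * s w) + (norm (v w))\<^sup>2) powr p) \<partial>M)"
proof -
  interpret gaussian_family M "Fil a" "b - a" B "\<lambda>h. W (bump a b h)"
    using ab orthogonal_B norm_B by (rule gaussian_family_bump)
  define Z where "Z n w = (\<Sum>h\<in>A n. incr a b h w *\<^sub>R y h w)" for n w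
  have Z[measurable]: "Z n \<in> borel_measurable M" for n
    unfolding Z_def by (rule increment_sum_measurable_M)
  have [measurable]: "v \<in> borel_measurable M"
    using measurable_M_Fil[OF _ _ v] ab by auto
  obtain r where r: "AE w in M. (\<lambda>n. Z (r n) w) \<longlonglongrightarrow> X w"
    using L2_limit_AE_subseq[OF increment_sum_measurable_M X lim] unfolding Z_def by blast
  have le: "(\<integral>\<^sup>+w. ennreal ((c + (norm (v w + Z n w))\<^sup>2) powr p) \<partial>M)
    \<le> (\<integral>\<^sup>+w. ennreal ((c + (2 * p - 1) * ((b - a) * s w) + (norm (v w))\<^sup>2) powr p) \<partial>M)" for n
  proof -
    have "AE w in M. Z n w = (\<Sum>h\<in>A n. W (bump a b h) w *\<^sub>R y h w)"
      using incr_bump_AE[OF ab(1,2) A(1)[of n]] unfolding Z_def by eventually_elim simp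
    then have "(\<integral>\<^sup>+w. ennreal ((c + (norm (v w + Z n w))\<^sup>2) powr p) \<partial>M)
      = (\<integral>\<^sup>+w. ennreal ((c + (norm (v w + (\<Sum>h\<in>A n. W (bump a b h) w *\<^sub>R y h w)))\<^sup>2) powr p) \<partial>M)"
      by (intro nn_integral_cong_AE) (auto elim: eventually_mono)
    also have "\<dots> \<le> (\<integral>\<^sup>+w. ennreal ((c + (2 * p - 1) * ((b - a) * (\<Sum>h\<in>A n. (norm (y h w))\<^sup>2)) + (norm (v w))\<^sup>2) powr p) \<partial>M)"
      using A y v c p by (intro gaussian_sum_moment_le) auto
    also have "\<dots> \<le> (\<integral>\<^sup>+w. ennreal ((c + (2 * p - 1) * ((b - a) * s w) + (norm (v w))\<^sup>2) powr p) \<partial>M)"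
      using s c p ab by (intro nn_integral_mono ennreal_leI powr_mono2 add_mono mult_left_mono order.refl)
        (auto intro!: add_nonneg_nonneg mult_nonneg_nonneg sum_nonneg)
    finally show ?thesis .
  qed
  have "AE w in M. ennreal ((c + (norm (v w + X w))\<^sup>2) powr p)
    = liminf (\<lambda>n. ennreal ((c + (norm (v w + Z (r n) w))\<^sup>2) powr p))"
    using r
  proof eventually_elim
    case (elim w)
    have "(\<lambda>n. ennreal ((c + (norm (v w + Z (r n) w))\<^sup>2) powr p)) \<longlonglongrightarrow> ennreal ((c + (norm (v w + X w))\<^sup>2) powr p)"
      using c by (intro tendsto_ennrealI tendsto_powr tendsto_intros elim) (smt (verit) zero_le_power2)
    then show ?case by (rule lim_imp_Liminf[OF trivial_limit_sequentially, symmetric])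
  qed
  then have "(\<integral>\<^sup>+w. ennreal ((c + (norm (v w + X w))\<^sup>2) powr p) \<partial>M)
    = (\<integral>\<^sup>+w. liminf (\<lambda>n. ennreal ((c + (norm (v w + Z (r n) w))\<^sup>2) powr p)) \<partial>M)"
    by (rule nn_integral_cong_AE)
  also have "\<dots> \<le> liminf (\<lambda>n. \<integral>\<^sup>+w. ennreal ((c + (norm (v w + Z (r n) w))\<^sup>2) powr p) \<partial>M)"
    by (rule nn_integral_liminf) measurable
  also have "\<dots> \<le> liminf (\<lambda>n::nat. \<integral>\<^sup>+w. ennreal ((c + (2 * p - 1) * ((b - a) * s w) + (norm (v w))\<^sup>2) powr p) \<partial>M)"
    using le by (intro Liminf_mono) auto
  also have "\<dots> = (\<integral>\<^sup>+w. ennreal ((c + (2 * p - 1) * ((b - a) * s w) + (norm (v w))\<^sup>2) powr p) \<partial>M)"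
    by (simp add: Liminf_const)
  finally show ?thesis .
qed

end

end


section \<open>The Ito integral of a random operator constant in time\<close>

lemma has_sum_finite_sum:
  fixes f :: "'i \<Rightarrow> 'a \<Rightarrow> 'b::topological_comm_monoid_add"
  assumes "finite I" "\<And>i. i \<in> I \<Longrightarrow> (f i has_sum s i) A"
  shows "((\<lambda>x. \<Sum>i\<in>I. f i x) has_sum (\<Sum>i\<in>I. s i)) A"
  using assms by (induction I rule: finite_induct) (auto intro: has_sum_add)

lemma sum_list_map_nth: "(\<Sum>x\<leftarrow>xs. f x) = (\<Sum>i<length xs. f (xs ! i))"
  by (simp add: sum_list_sum_nth atLeast0LessThan)

section \<open>Covariances of increments weighted by the past\<close>

context cylindrical_brownian_motion
begin

lemma L2_time_add:
  assumes "f \<in> L2_time T" "g \<in> L2_time T"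
  shows "(\<lambda>s. f s + g s :: 'h) \<in> L2_time T"
proof -
  have [measurable]: "f \<in> borel_measurable (time_measure T)" "g \<in> borel_measurable (time_measure T)"
    using assms by (auto simp: L2_time_def)
  have "integrable (time_measure T) (\<lambda>t. (norm (f t + g t))\<^sup>2)"
  proof (rule Bochner_Integration.integrable_bound)
    show "integrable (time_measure T) (\<lambda>t. 2 * (norm (f t))\<^sup>2 + 2 * (norm (g t))\<^sup>2)"
      using assms by (auto simp: L2_time_def)
    have "(norm (x + y))\<^sup>2 \<le> 2 * (norm x)\<^sup>2 + 2 * (norm y)\<^sup>2" for x y :: 'h
      by (rule norm_add_sq_le)
    then show "AE t in time_measure T. norm ((norm (f t + g t))\<^sup>2) \<le> norm (2 * (norm (f t))\<^sup>2 + 2 * (norm (g t))\<^sup>2)"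
      by simp
  qed measurable
  then show ?thesis unfolding L2_time_def by auto
qed

lemma W_indep_integral_sq:
  assumes s: "0 \<le> s" "s \<le> T" and f: "f \<in> L2_time T" "supported_in T f {s..T}"
    and X: "X \<in> borel_measurable (Fil s)" "integrable M X"
  shows "(\<integral>w. X w * (W f w)\<^sup>2 \<partial>M) = (\<integral>w. X w \<partial>M) * (\<integral>w. (W f w)\<^sup>2 \<partial>M)"
proof -
  have "indep_set (sets (Fil s)) (sets (vimage_algebra (space M) (W f) borel))"
    using W s f unfolding cylindrical_BM_def by simp
  from indep_var_of_indep_set[OF subalgebra_Fil[OF s] this W_measurable[OF f(1)] X(1), of "\<lambda>x. x\<^sup>2"]
  have "indep_var borel X borel (\<lambda>w. (W f w)\<^sup>2)" by simp
  from indep_var_lebesgue_integral[OF this X(2) W_sq_integrable[OF f(1)]] show ?thesis .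
qed

lemma integrable_bounded_mult:
  fixes X \<psi> :: "'w \<Rightarrow> real"
  assumes "integrable M X" "\<psi> \<in> borel_measurable M" "\<And>w. \<bar>\<psi> w\<bar> \<le> K"
  shows "integrable M (\<lambda>w. \<psi> w * X w)"
proof (rule Bochner_Integration.integrable_bound)
  show "integrable M (\<lambda>w. K * X w)" using assms by simp
  show "(\<lambda>w. \<psi> w * X w) \<in> borel_measurable M" using assms by measurable
  have "\<bar>\<psi> w * X w\<bar> \<le> \<bar>K * X w\<bar>" for w
    using assms(3)[of w] by (auto simp: abs_mult intro!: mult_right_mono)
  then show "AE w in M. norm (\<psi> w * X w) \<le> norm (K * X w)" by simp
qed

text \<open>The part of the first interval that precedes \<open>a'\<close> contributes nothing, because the second increment is
  centred and independent of it; on the rest \<open>\<psi>\<close> is independent of both increments, by polarization.\<close>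

lemma weighted_cov_ordered:
  assumes I: "0 \<le> a" "a \<le> b" "b \<le> T" and I': "a' \<le> b'" "b' \<le> T" and le: "a \<le> a'"
    and \<psi>: "\<psi> \<in> borel_measurable (Fil a')" "\<And>w. \<bar>\<psi> w\<bar> \<le> K"
  shows "(\<integral>w. \<psi> w * (W (bump a b h) w * W (bump a' b' h') w) \<partial>M)
    = (\<integral>w. \<psi> w \<partial>M) * (max 0 (min b b' - max a a') * (h \<bullet> h'))"
proof -
  note a' = order_trans[OF I(1) le] order_trans[OF I'(1,2)]
  note L = bump_L2
  \<comment> \<open>The first interval is cut so that its left part ends by time \<open>a'\<close>;
    the right part either starts at \<open>a'\<close> or, when \<open>b \<le> a'\<close>, is empty,
    so in both cases it is supported in \<open>{a'..T}\<close>.\<close>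
  define m where "m = min a' b"
  have m: "a \<le> m" "m \<le> b" "m \<le> a'" using I le by (auto simp: m_def)
  have \<psi>M[measurable]: "\<psi> \<in> borel_measurable M"
    using measurable_from_subalg[OF subalgebra_Fil[OF a'] \<psi>(1)] .
  note [measurable] = W_measurable[OF L]
  note bnd = integrable_bounded_mult[OF _ \<psi>M \<psi>(2)]
  have int\<psi>: "integrable M \<psi>" using \<psi>(2) by (intro integrable_const_bound[where B=K]) auto
  have "(\<integral>w. \<psi> w * (W (bump a b h) w * W (bump a' b' h') w) \<partial>M)
    = (\<integral>w. (\<psi> w * W (bump a m h) w) * W (bump a' b' h') w + \<psi> w * (W (bump m b h) w * W (bump a' b' h') w) \<partial>M)"
  proof (rule integral_cong_AE)
    show "AE w in M. \<psi> w * (W (bump a b h) w * W (bump a' b' h') w)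
      = (\<psi> w * W (bump a m h) w) * W (bump a' b' h') w + \<psi> w * (W (bump m b h) w * W (bump a' b' h') w)"
      using W_bump_split[OF I(1) m(1,2), of h] by eventually_elim (simp add: algebra_simps)
  qed measurable
  also have "\<dots> = (\<integral>w. (\<psi> w * W (bump a m h) w) * W (bump a' b' h') w \<partial>M)
     + (\<integral>w. \<psi> w * (W (bump m b h) w * W (bump a' b' h') w) \<partial>M)"
  proof (rule Bochner_Integration.integral_add)
    show "integrable M (\<lambda>w. (\<psi> w * W (bump a m h) w) * W (bump a' b' h') w)"
      using bnd[OF W_mult_integrable[OF L L]] by (simp add: mult.assoc)
    show "integrable M (\<lambda>w. \<psi> w * (W (bump m b h) w * W (bump a' b' h') w))"
      by (rule bnd[OF W_mult_integrable[OF L L]])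
  qed
  also have "(\<integral>w. (\<psi> w * W (bump a m h) w) * W (bump a' b' h') w \<partial>M)
    = (\<integral>w. \<psi> w * W (bump a m h) w \<partial>M) * (\<integral>w. W (bump a' b' h') w \<partial>M)"
    using a' m I \<psi>(1)
    by (intro W_bump_indep_integral[where s=a' and g="\<lambda>x. x"] borel_measurable_times W_bump_measurable_Fil
        bnd W_integrable L) auto
  also have "(\<integral>w. W (bump a' b' h') w \<partial>M) = 0" using a' I' by (intro W_bump_mean) auto
  also have "(\<integral>w. \<psi> w * (W (bump m b h) w * W (bump a' b' h') w) \<partial>M)
    = (\<integral>w. \<psi> w \<partial>M) * (\<integral>w. W (bump m b h) w * W (bump a' b' h') w \<partial>M)"
  proof -
    \<comment> \<open>Independence of \<open>Fil a'\<close> is available for one value of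
      \<open>W\<close> at a time, not for the pair of increments. Almost surely, \<open>W e\<close>
      is their sum, so the squares of three single values determine the product, and each of them is
      independent of \<open>\<psi>\<close>.\<close>
    define e where "e s = bump m b h s + bump a' b' h' s" for s
    have e: "e \<in> L2_time T" unfolding e_def[abs_def] by (intro L2_time_add L)
    note [measurable] = W_measurable[OF e]
    have "AE s in time_measure T. e s = bump m b h s + 1 *\<^sub>R bump a' b' h' s" by (simp add: e_def)
    from W_linear[OF L L e this] have We: "AE w in M. W e w = W (bump m b h) w + W (bump a' b' h') w" by simp
    have sup: "supported_in T (bump m b h) {a'..T}" "supported_in T (bump a' b' h') {a'..T}" "supported_in T e {a'..T}"
      using a' unfolding supported_in_def e_def bump_def m_def
      by (intro AE_I2; auto simp: indicator_def space_restrict_space)+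
    note sq = W_indep_integral_sq[OF a' _ _ \<psi>(1) int\<psi>]
    have pol: "(\<integral>w. f w * (W (bump m b h) w * W (bump a' b' h') w) \<partial>M)
      = ((\<integral>w. f w * (W e w)\<^sup>2 \<partial>M) - (\<integral>w. f w * (W (bump m b h) w)\<^sup>2 \<partial>M) - (\<integral>w. f w * (W (bump a' b' h') w)\<^sup>2 \<partial>M)) / 2"
      if [measurable]: "f \<in> borel_measurable M" and f: "\<And>w. \<bar>f w\<bar> \<le> L" for f L
    proof -
      note i = integrable_bounded_mult[OF W_sq_integrable that]
      have "(\<integral>w. f w * (W (bump m b h) w * W (bump a' b' h') w) \<partial>M)
        = (\<integral>w. (f w * (W e w)\<^sup>2 - f w * (W (bump m b h) w)\<^sup>2 - f w * (W (bump a' b' h') w)\<^sup>2) / 2 \<partial>M)"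
      proof (rule integral_cong_AE)
        show "AE w in M. f w * (W (bump m b h) w * W (bump a' b' h') w)
          = (f w * (W e w)\<^sup>2 - f w * (W (bump m b h) w)\<^sup>2 - f w * (W (bump a' b' h') w)\<^sup>2) / 2"
          using We by eventually_elim (simp add: power2_eq_square algebra_simps)
      qed measurable
      also have "\<dots> = ((\<integral>w. f w * (W e w)\<^sup>2 \<partial>M) - (\<integral>w. f w * (W (bump m b h) w)\<^sup>2 \<partial>M) - (\<integral>w. f w * (W (bump a' b' h') w)\<^sup>2 \<partial>M)) / 2"
        using i[OF e] i[OF L] by simp
      finally show ?thesis .
    qed
    have cov: "(\<integral>w. W (bump m b h) w * W (bump a' b' h') w \<partial>M)
      = ((\<integral>w. (W e w)\<^sup>2 \<partial>M) - (\<integral>w. (W (bump m b h) w)\<^sup>2 \<partial>M) - (\<integral>w. (W (bump a' b' h') w)\<^sup>2 \<partial>M)) / 2"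
      using pol[of "\<lambda>_. 1" 1] by simp
    show ?thesis
      unfolding pol[OF \<psi>M \<psi>(2)] sq[OF e sup(3)] sq[OF L sup(1)] sq[OF L sup(2)] cov
      by (simp add: right_diff_distrib)
  qed
  also have "(\<integral>w. W (bump m b h) w * W (bump a' b' h') w \<partial>M) = max 0 (min b b' - max a a') * (h \<bullet> h')"
    using a' m I I' le by (subst W_bump_cov) (auto simp: max_def)
  finally show ?thesis by simp
qed

lemma weighted_cov:
  assumes "0 \<le> a" "a \<le> b" "b \<le> T" "0 \<le> a'" "a' \<le> b'" "b' \<le> T"
    and \<psi>: "\<psi> \<in> borel_measurable (Fil (max a a'))" "\<And>w. \<bar>\<psi> w\<bar> \<le> K"
  shows "(\<integral>w. \<psi> w * (W (bump a b h) w * W (bump a' b' h') w) \<partial>M)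
    = (\<integral>w. \<psi> w \<partial>M) * (max 0 (min b b' - max a a') * (h \<bullet> h'))"
proof (cases "a \<le> a'")
  case True
  then show ?thesis using weighted_cov_ordered[of a b a' b' \<psi> K h h'] assms by (simp add: max_def)
next
  case False
  have "(\<integral>w. \<psi> w * (W (bump a b h) w * W (bump a' b' h') w) \<partial>M) = (\<integral>w. \<psi> w * (W (bump a' b' h') w * W (bump a b h) w) \<partial>M)"
    by (simp add: mult.commute)
  also have "\<dots> = (\<integral>w. \<psi> w \<partial>M) * (max 0 (min b' b - max a' a) * (h' \<bullet> h))"
    using False assms by (intro weighted_cov_ordered[where K=K]) (auto simp: max_def)
  finally show ?thesis by (simp add: max.commute min.commute inner_commute)
qed

lemma measure_time_Ioc:
  assumes "0 \<le> a" "b \<le> T"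
  shows "measure (time_measure T) ({a<..b} \<inter> {0..T}) = max 0 (b - a)"
proof -
  have "measure (time_measure T) ({a<..b} \<inter> {0..T}) = measure lborel ({a<..b} \<inter> {0..T})"
    by (rule measure_restrict_space) auto
  moreover have "{a<..b} \<inter> {0..T} = {a<..b}" using assms by auto
  ultimately have "measure (time_measure T) ({a<..b} \<inter> {0..T}) = measure lborel {a<..b}" by metis
  also have "\<dots> = max 0 (b - a)" by (cases "a \<le> b") auto
  finally show ?thesis .
qed

end

section \<open>The Ito isometry for finitely many adapted coefficients\<close>

context cylindrical_brownian_motion_basis
begin

text \<open>The common value of the two sides of the Ito isometry for the integrand that sums, over
  \<open>i\<close>, the tensor of \<open>h i\<close> and \<open>\<eta> i\<close> on the interval
  from \<open>a i\<close> to \<open>b i\<close>. The factor with \<open>max\<close> and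
  \<open>min\<close> is the length of the intersection of two intervals.\<close>

definition ito_energy ::
  "'i set \<Rightarrow> ('i \<Rightarrow> real) \<Rightarrow> ('i \<Rightarrow> real) \<Rightarrow> ('i \<Rightarrow> 'h) \<Rightarrow> ('i \<Rightarrow> 'w \<Rightarrow> 'y::real_inner) \<Rightarrow> real" where
  "ito_energy I a b h \<eta> = (\<Sum>i\<in>I. \<Sum>j\<in>I.
     (\<integral>w. \<eta> i w \<bullet> \<eta> j w \<partial>M) * (max 0 (min (b i) (b j) - max (a i) (a j)) * (h i \<bullet> h j)))"

text \<open>The squared Hilbert-Schmidt norm of the same integrand at time \<open>s\<close>, with
  the sum over the basis already carried out by Parseval's identity.\<close>

definition ito_density ::
  "'i set \<Rightarrow> ('i \<Rightarrow> real) \<Rightarrow> ('i \<Rightarrow> real) \<Rightarrow> ('i \<Rightarrow> 'h) \<Rightarrow> ('i \<Rightarrow> 'w \<Rightarrow> 'y::real_inner) \<Rightarrow> real \<Rightarrow> 'w \<Rightarrow> real" where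
  "ito_density I a b h \<eta> s w = (\<Sum>i\<in>I. \<Sum>j\<in>I.
     (\<eta> i w \<bullet> \<eta> j w) * (indicator {max (a i) (a j)<..min (b i) (b j)} s * (h i \<bullet> h j)))"

context
  fixes I :: "'i set" and a b :: "'i \<Rightarrow> real" and h :: "'i \<Rightarrow> 'h"
    and \<eta> :: "'i \<Rightarrow> 'w \<Rightarrow> 'y::{real_inner, banach, second_countable_topology}" and K :: "'i \<Rightarrow> real"
  assumes I: "finite I"
    and ab: "\<And>i. i \<in> I \<Longrightarrow> 0 \<le> a i" "\<And>i. i \<in> I \<Longrightarrow> a i \<le> b i" "\<And>i. i \<in> I \<Longrightarrow> b i \<le> T"
    and \<eta>: "\<And>i. i \<in> I \<Longrightarrow> \<eta> i \<in> borel_measurable (Fil (a i))"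
    and K: "\<And>i w. i \<in> I \<Longrightarrow> norm (\<eta> i w) \<le> K i"
begin

lemma \<eta>_M: "i \<in> I \<Longrightarrow> \<eta> i \<in> borel_measurable M"
  using \<eta>[of i] ab(1,2,3)[of i] by (intro measurable_M_Fil[of "a i" "\<eta> i"]) auto

lemma \<eta>_inner_bound: "i \<in> I \<Longrightarrow> j \<in> I \<Longrightarrow> \<bar>\<eta> i w \<bullet> \<eta> j w\<bar> \<le> K i * K j"
  by (rule order_trans[OF Cauchy_Schwarz_ineq2 mult_mono[OF K K order_trans[OF norm_ge_zero K] norm_ge_zero]])

lemma \<eta>_inner_integrable: "i \<in> I \<Longrightarrow> j \<in> I \<Longrightarrow> integrable M (\<lambda>w. \<eta> i w \<bullet> \<eta> j w)"
  using \<eta>_inner_bound \<eta>_M by (intro integrable_const_bound[where B="K i * K j"]) auto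

text \<open>For each pair the weight \<open>\<eta> i w \<bullet> \<eta> j w\<close> is known at the
  later starting time \<open>max (a i) (a j)\<close>, as \<open>weighted_cov\<close> requires;
  boundedness of the coefficients makes the cross terms integrable.\<close>

lemma ito_sum_energy:
  "(\<integral>\<^sup>+w. ennreal ((norm (\<Sum>i\<in>I. W (bump (a i) (b i) (h i)) w *\<^sub>R \<eta> i w))\<^sup>2) \<partial>M) = ennreal (ito_energy I a b h \<eta>)"
proof -
  let ?W = "\<lambda>i. W (bump (a i) (b i) (h i))"
  have sq: "(norm (\<Sum>i\<in>I. ?W i w *\<^sub>R \<eta> i w))\<^sup>2 = (\<Sum>i\<in>I. \<Sum>j\<in>I. (\<eta> i w \<bullet> \<eta> j w) * (?W i w * ?W j w))" for w
    unfolding power2_norm_eq_inner inner_sum_left inner_sum_right by (simp add: mult_ac inner_commute)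
  have int: "integrable M (\<lambda>w. (\<eta> i w \<bullet> \<eta> j w) * (?W i w * ?W j w))" if "i \<in> I" "j \<in> I" for i j
    using that \<eta>_M
    by (intro integrable_bounded_mult[OF W_mult_integrable[OF bump_L2 bump_L2] _ \<eta>_inner_bound]) auto
  have cov: "(\<integral>w. (\<eta> i w \<bullet> \<eta> j w) * (?W i w * ?W j w) \<partial>M)
    = (\<integral>w. \<eta> i w \<bullet> \<eta> j w \<partial>M) * (max 0 (min (b i) (b j) - max (a i) (a j)) * (h i \<bullet> h j))"
    if ij: "i \<in> I" "j \<in> I" for i j
  proof (rule weighted_cov[OF _ _ _ _ _ _ _ \<eta>_inner_bound[OF ij]])
    have "\<eta> l \<in> borel_measurable (Fil (max (a i) (a j)))" if "l = i \<or> l = j" for l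
    proof (rule measurable_from_subalg[OF subalgebra_Fil_mono \<eta>])
      show "l \<in> I" "0 \<le> a l" using that ij ab(1) by auto
      show "a l \<le> max (a i) (a j)" using that by auto
      show "max (a i) (a j) \<le> T" using ij order_trans[OF ab(2,3)] by simp
    qed
    then show "(\<lambda>w. \<eta> i w \<bullet> \<eta> j w) \<in> borel_measurable (Fil (max (a i) (a j)))" by simp
  qed (use ij ab in auto)
  have "(\<integral>\<^sup>+w. ennreal ((norm (\<Sum>i\<in>I. ?W i w *\<^sub>R \<eta> i w))\<^sup>2) \<partial>M) = ennreal (\<integral>w. (norm (\<Sum>i\<in>I. ?W i w *\<^sub>R \<eta> i w))\<^sup>2 \<partial>M)"
  proof (rule nn_integral_eq_integral)
    show "integrable M (\<lambda>w. (norm (\<Sum>i\<in>I. ?W i w *\<^sub>R \<eta> i w))\<^sup>2)"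
      unfolding sq using int by (intro Bochner_Integration.integrable_sum)
  qed simp
  also have "(\<integral>w. (norm (\<Sum>i\<in>I. ?W i w *\<^sub>R \<eta> i w))\<^sup>2 \<partial>M) = ito_energy I a b h \<eta>"
    unfolding sq ito_energy_def using int cov by (simp add: Bochner_Integration.integral_sum)
  finally show ?thesis .
qed

lemma has_sum_ito_density:
  "((\<lambda>x. (norm (\<Sum>i\<in>I. (indicator {a i<..b i} s * (h i \<bullet> x)) *\<^sub>R \<eta> i w))\<^sup>2) has_sum ito_density I a b h \<eta> s w) B"
proof -
  have "(norm (\<Sum>i\<in>I. (indicator {a i<..b i} s * (h i \<bullet> x)) *\<^sub>R \<eta> i w))\<^sup>2
    = (\<Sum>i\<in>I. \<Sum>j\<in>I. (\<eta> i w \<bullet> \<eta> j w) * (indicator {max (a i) (a j)<..min (b i) (b j)} s * ((h i \<bullet> x) * (h j \<bullet> x))))" for x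
    unfolding power2_norm_eq_inner inner_sum_left inner_sum_right
    by (intro sum.cong refl) (auto simp: indicator_def inner_commute)
  moreover have "((\<lambda>x. \<Sum>i\<in>I. \<Sum>j\<in>I. (\<eta> i w \<bullet> \<eta> j w) * (indicator {max (a i) (a j)<..min (b i) (b j)} s * ((h i \<bullet> x) * (h j \<bullet> x))))
    has_sum ito_density I a b h \<eta> s w) B"
    unfolding ito_density_def by (intro has_sum_finite_sum I has_sum_cmult_right parseval)
  ultimately show ?thesis by simp
qed

lemma ito_density_nonneg: "0 \<le> ito_density I a b h \<eta> s w"
  by (rule has_sum_nonneg[OF has_sum_ito_density]) simp

text \<open>The other half of the isometry: integrating \<open>s\<close> over an intersection of
  intervals produces its length. The halves are stated separately so that the density can be
  estimated pointwise before it is integrated.\<close>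

lemma ito_density_energy:
  "(\<integral>\<^sup>+z. ennreal (ito_density I a b h \<eta> (fst z) (snd z)) \<partial>(time_measure T \<Otimes>\<^sub>M M)) = ennreal (ito_energy I a b h \<eta>)"
proof -
  interpret t: finite_measure "time_measure T" by (rule finite_time_measure)
  have [measurable]: "(\<lambda>z. ennreal (ito_density I a b h \<eta> (fst z) (snd z))) \<in> borel_measurable (time_measure T \<Otimes>\<^sub>M M)"
  proof -
    have [measurable]: "(\<lambda>z. \<eta> i (snd z)) \<in> borel_measurable (time_measure T \<Otimes>\<^sub>M M)" if "i \<in> I" for i
      using \<eta>_M[OF that] by measurable
    have [measurable]: "(\<lambda>z. indicator {c<..d} (fst z) :: real) \<in> borel_measurable (time_measure T \<Otimes>\<^sub>M M)" for c d
      by (intro measurable_compose[OF measurable_fst] measurable_time) measurable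
    show ?thesis unfolding ito_density_def
      by (intro measurable_compose[OF _ measurable_ennreal] borel_measurable_sum borel_measurable_times borel_measurable_inner) measurable
  qed
  have inner: "(\<integral>\<^sup>+w. ennreal (ito_density I a b h \<eta> s w) \<partial>M) = ennreal (\<integral>w. ito_density I a b h \<eta> s w \<partial>M)" for s
    using ito_density_nonneg \<eta>_inner_integrable
    by (intro nn_integral_eq_integral)
       (auto simp: ito_density_def intro!: Bochner_Integration.integrable_sum integrable_mult_left)
  have inner': "(\<integral>w. ito_density I a b h \<eta> s w \<partial>M)
    = (\<Sum>i\<in>I. \<Sum>j\<in>I. (\<integral>w. \<eta> i w \<bullet> \<eta> j w \<partial>M) * (indicator {max (a i) (a j)<..min (b i) (b j)} s * (h i \<bullet> h j)))" for s
    unfolding ito_density_def using \<eta>_inner_integrable by (simp add: Bochner_Integration.integral_sum)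
  have int: "integrable (time_measure T) (\<lambda>s. indicator {c<..d} s :: real)" for c d
  proof (rule t.integrable_const_bound[where B=1])
    show "(\<lambda>s. indicator {c<..d} s :: real) \<in> borel_measurable (time_measure T)"
      by (intro measurable_time) measurable
  qed (auto simp: indicator_def)
  have "(\<integral>\<^sup>+z. ennreal (ito_density I a b h \<eta> (fst z) (snd z)) \<partial>(time_measure T \<Otimes>\<^sub>M M))
    = (\<integral>\<^sup>+s. \<integral>\<^sup>+w. ennreal (ito_density I a b h \<eta> s w) \<partial>M \<partial>time_measure T)"
    by (subst nn_integral_fst[symmetric]) auto
  also have "\<dots> = (\<integral>\<^sup>+s. ennreal (\<integral>w. ito_density I a b h \<eta> s w \<partial>M) \<partial>time_measure T)"
    by (simp add: inner)
  also have "\<dots> = ennreal (\<integral>s. (\<integral>w. ito_density I a b h \<eta> s w \<partial>M) \<partial>time_measure T)"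
  proof (rule nn_integral_eq_integral)
    show "integrable (time_measure T) (\<lambda>s. \<integral>w. ito_density I a b h \<eta> s w \<partial>M)"
      unfolding inner' using int
      by (intro Bochner_Integration.integrable_sum integrable_mult_right integrable_mult_left) auto
    show "AE s in time_measure T. 0 \<le> (\<integral>w. ito_density I a b h \<eta> s w \<partial>M)"
      using ito_density_nonneg by simp
  qed
  also have "(\<integral>s. (\<integral>w. ito_density I a b h \<eta> s w \<partial>M) \<partial>time_measure T) = ito_energy I a b h \<eta>"
  proof -
    have ind: "(\<integral>s. indicator {max (a i) (a j)<..min (b i) (b j)} s \<partial>time_measure T) = max 0 (min (b i) (b j) - max (a i) (a j))"
      if "i \<in> I" "j \<in> I" for i j
    proof -
      have "(\<integral>s. indicator {max (a i) (a j)<..min (b i) (b j)} s \<partial>time_measure T)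
        = measure (time_measure T) ({max (a i) (a j)<..min (b i) (b j)} \<inter> {0..T})"
        by (simp add: space_restrict_space)
      also have "\<dots> = max 0 (min (b i) (b j) - max (a i) (a j))"
        using ab that by (intro measure_time_Ioc) (auto simp: max_def min_def)
      finally show ?thesis .
    qed
    have "(\<integral>s. (\<integral>w. ito_density I a b h \<eta> s w \<partial>M) \<partial>time_measure T)
      = (\<Sum>i\<in>I. \<Sum>j\<in>I. (\<integral>w. \<eta> i w \<bullet> \<eta> j w \<partial>M) * ((\<integral>s. indicator {max (a i) (a j)<..min (b i) (b j)} s \<partial>time_measure T) * (h i \<bullet> h j)))"
      unfolding inner' using int
      by (subst Bochner_Integration.integral_sum integral_mult_right_zero integral_mult_left_zero
           | intro Bochner_Integration.integrable_sum integrable_mult_right integrable_mult_left sum.cong refl | simp only: )+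
    also have "\<dots> = ito_energy I a b h \<eta>"
      unfolding ito_energy_def using ind by (intro sum.cong refl) auto
    finally show ?thesis .
  qed
  finally show ?thesis .
qed

end

text \<open>Both the step processes approximating the integrand and the finite sums over the basis are of the
  form treated by the isometry above; the latter involve the possibly infinitely many values of \<open>R\<close>
  directly, so that no approximation of \<open>R\<close> by simple functions is required.\<close>

lemma step_integral_minus_increment_le:
  fixes e :: "('w, 'h, 'y::{real_inner, banach, second_countable_topology}) step_process"
    and R :: "'w \<Rightarrow> 'h \<Rightarrow>\<^sub>L 'y"
  assumes e: "adapted_step Fil T e" and ab: "0 \<le> a" "a \<le> b" "b \<le> T"
    and R: "\<And>w. R w \<in> hs_ops B" "\<And>h. h \<in> B \<Longrightarrow> (\<lambda>w. R w h) \<in> borel_measurable (Fil a)" "\<And>w. hs_norm B (R w) \<le> K"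
    and A: "finite A" "A \<subseteq> B"
  shows "(\<integral>\<^sup>+w. ennreal ((norm (step_integral W e w - (\<Sum>h\<in>A. incr a b h w *\<^sub>R R w h)))\<^sup>2) \<partial>M)
    \<le> 2 * (\<integral>\<^sup>+(s, w). ennreal ((hs_norm B (step_val e s w - indicator {a<..b} s *\<^sub>R R w))\<^sup>2) \<partial>(time_measure T \<Otimes>\<^sub>M M))
      + 2 * ennreal T * (\<integral>\<^sup>+w. ennreal ((hs_norm B (R w))\<^sup>2 - (\<Sum>h\<in>A. (norm (R w h))\<^sup>2)) \<partial>M)"
proof -
  \<comment> \<open>Pieces of the step process and basis vectors in \<open>A\<close> are indexed
    together, the latter with coefficient \<open>- R w g\<close>, so that the difference to be
    estimated is a single sum covered by the isometry.\<close>
  define I where "I = {..<length e} <+> A"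
  define ia where "ia = case_sum (\<lambda>i. case e ! i of (a, b, D, h, y) \<Rightarrow> a) (\<lambda>_::'h. a)"
  define ib where "ib = case_sum (\<lambda>i. case e ! i of (a, b, D, h, y) \<Rightarrow> b) (\<lambda>_::'h. b)"
  define ih where "ih = case_sum (\<lambda>i. case e ! i of (a, b, D, h, y) \<Rightarrow> h) (\<lambda>g::'h. g)"
  define \<eta> where "\<eta> = case_sum (\<lambda>i w. case e ! i of (a, b, D, h, y) \<Rightarrow> indicator D w *\<^sub>R y) (\<lambda>(g::'h) w. - R w g)"
  define iK where "iK = case_sum (\<lambda>i. case e ! i of (a, b, D, h, y) \<Rightarrow> norm y) (\<lambda>_::'h. K)"
  note defs = ia_def ib_def ih_def \<eta>_def iK_def
  have finI: "finite I" unfolding I_def using A by simp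
  have e_nth: "0 \<le> c \<and> c \<le> d \<and> d \<le> T \<and> D \<in> sets (Fil c)"
    if "i < length e" "e ! i = (c, d, D, h, y)" for i c d D h y
    using e nth_mem[OF that(1)] unfolding that(2) adapted_step_def by auto
  have iab: "0 \<le> ia i" "ia i \<le> ib i" "ib i \<le> T" if "i \<in> I" for i
    using that ab e_nth unfolding I_def defs by (auto split: prod.split)
  have i\<eta>: "\<eta> i \<in> borel_measurable (Fil (ia i))" if "i \<in> I" for i
    using that
  proof (cases i)
    case (Inl n)
    obtain c d D h y where en: "e ! n = (c, d, D, h, y)" by (metis prod_cases5)
    have "D \<in> sets (Fil c)" using that Inl e_nth[OF _ en] by (auto simp: I_def)
    then show ?thesis unfolding Inl defs by (simp add: en)
  next
    case (Inr g)
    then have "g \<in> B" using that A by (auto simp: I_def)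
    from R(2)[OF this] show ?thesis unfolding Inr defs by simp
  qed
  have iK: "norm (\<eta> i w) \<le> iK i" if "i \<in> I" for i w
    using that
  proof (cases i)
    case (Inr g)
    then have "g \<in> B" using that A by (auto simp: I_def)
    from norm_le_hs_norm[OF R(1) this, of w] R(3)[of w] show ?thesis unfolding Inr defs by simp
  qed (auto simp: defs indicator_def split: prod.split)
  note ctx = finI iab i\<eta> iK
  let ?X = "\<lambda>w. \<Sum>i\<in>I. W (bump (ia i) (ib i) (ih i)) w *\<^sub>R \<eta> i w"
  have AE: "AE w in M. step_integral W e w - (\<Sum>h\<in>A. incr a b h w *\<^sub>R R w h) = ?X w"
  proof -
    have "AE w in M. \<forall>i\<in>I. incr (ia i) (ib i) (ih i) w = W (bump (ia i) (ib i) (ih i)) w"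
      using finI iab by (intro AE_finite_allI W_at_diff) auto
    then show ?thesis
    proof eventually_elim
      case (elim w)
      have "?X w = (\<Sum>i\<in>I. incr (ia i) (ib i) (ih i) w *\<^sub>R \<eta> i w)"
        using elim by (intro sum.cong) auto
      also have "\<dots> = step_integral W e w - (\<Sum>h\<in>A. incr a b h w *\<^sub>R R w h)"
        unfolding I_def step_integral_def sum_list_map_nth using A
        by (subst sum.Plus) (auto simp: defs sum_negf mult.commute intro!: sum.cong split: prod.split)
      finally show ?case by simp
    qed
  qed
  define \<Delta> where "\<Delta> s w = step_val e s w - indicator {a<..b} s *\<^sub>R R w" for s w
  have val: "blinfun_apply (step_val e s w) x
    = (\<Sum>i<length e. (indicator {ia (Inl i)<..ib (Inl i)} s * (ih (Inl i) \<bullet> x)) *\<^sub>R \<eta> (Inl i) w)" for s w x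
    unfolding step_val_def sum_list_map_nth blinfun.sum_left
    by (intro sum.cong refl)
       (auto simp: defs scaleR_blinfun.rep_eq blinfun.bilinear_simps inner_commute mult_ac split: prod.split)
  have step_hs: "step_val e s w \<in> hs_ops B" for s w
  proof -
    have "((\<lambda>x. (norm (\<Sum>i\<in>Inl ` {..<length e}. (indicator {ia i<..ib i} s * (ih i \<bullet> x)) *\<^sub>R \<eta> i w))\<^sup>2) has_sum
      ito_density (Inl ` {..<length e}) ia ib ih \<eta> s w) B"
      by (rule has_sum_ito_density[OF _ iab i\<eta> iK]) (auto simp: I_def)
    then show ?thesis by (auto simp: hs_ops_def val sum.reindex summable_on_def)
  qed
  have \<Delta>_hs: "\<Delta> s w \<in> hs_ops B" for s w
    unfolding \<Delta>_def by (intro hs_ops_diff step_hs hs_ops_scaleR R)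
  \<comment> \<open>The part of the squared norm of \<open>R w\<close> carried by basis vectors
    outside \<open>A\<close>: the error from replacing the series by a finite sum.\<close>
  define t where "t w = (hs_norm B (R w))\<^sup>2 - (\<Sum>h\<in>A. (norm (R w h))\<^sup>2)" for w
  have t0: "0 \<le> t w" for w unfolding t_def using sum_le_hs_norm_sq[OF R(1) A] by simp
  have dens: "ito_density I ia ib ih \<eta> s w \<le> 2 * (hs_norm B (\<Delta> s w))\<^sup>2 + 2 * t w" for s w
  proof (rule has_sum_mono)
    show "((\<lambda>x. (norm (\<Sum>i\<in>I. (indicator {ia i<..ib i} s * (ih i \<bullet> x)) *\<^sub>R \<eta> i w))\<^sup>2) has_sum
      ito_density I ia ib ih \<eta> s w) B"
      by (rule has_sum_ito_density[OF ctx])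
    have 1: "((\<lambda>x. (norm (blinfun_apply (\<Delta> s w) x))\<^sup>2) has_sum (hs_norm B (\<Delta> s w))\<^sup>2) B"
      unfolding hs_norm_sq by (intro has_sum_infsum hs_ops_sq_summable \<Delta>_hs)
    have 2: "((\<lambda>x. (norm (R w x))\<^sup>2) has_sum (hs_norm B (R w))\<^sup>2) B"
      unfolding hs_norm_sq by (intro has_sum_infsum hs_ops_sq_summable R)
    have "((\<lambda>x. (norm (R w x))\<^sup>2) has_sum (\<Sum>h\<in>A. (norm (R w h))\<^sup>2)) A"
      using A by simp
    then have 3: "((\<lambda>x. if x \<in> A then (norm (R w x))\<^sup>2 else 0) has_sum (\<Sum>h\<in>A. (norm (R w h))\<^sup>2)) B"
      by (rule has_sum_cong_neutral[THEN iffD1, rotated -1]) (use A in auto)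
    from has_sum_add[OF 2 has_sum_cmult_right[OF 3, of "-1"]]
    have 4: "((\<lambda>x. (norm (R w x))\<^sup>2 - (if x \<in> A then (norm (R w x))\<^sup>2 else 0)) has_sum t w) B"
      by (simp add: t_def)
    show "((\<lambda>x. 2 * (norm (blinfun_apply (\<Delta> s w) x))\<^sup>2 + 2 * ((norm (R w x))\<^sup>2 - (if x \<in> A then (norm (R w x))\<^sup>2 else 0)))
      has_sum (2 * (hs_norm B (\<Delta> s w))\<^sup>2 + 2 * t w)) B"
      by (intro has_sum_add has_sum_cmult_right 1 4)
    fix x assume x: "x \<in> B"
    have "(\<Sum>h\<in>A. (h \<bullet> x) *\<^sub>R R w h) = (\<Sum>h\<in>A. if h = x then R w x else 0)"
      using A x by (intro sum.cong) (auto simp: inner_B subset_iff)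
    also have "\<dots> = (if x \<in> A then R w x else 0)" using A by simp
    finally have RA: "(\<Sum>h\<in>A. (h \<bullet> x) *\<^sub>R R w h) = (if x \<in> A then R w x else 0)" .
    \<comment> \<open>At a basis vector \<open>x\<close> the combined integrand is the approximation
      error \<open>\<Delta> s w\<close> plus, on \<open>{a<..b}\<close> and for \<open>x\<close>
      outside \<open>A\<close> only, the value of \<open>R w\<close>, because the finite sum
      reproduces \<open>R w x\<close> for \<open>x \<in> A\<close>. Separating the two costs a
      factor 2.\<close>
    have "(\<Sum>i\<in>I. (indicator {ia i<..ib i} s * (ih i \<bullet> x)) *\<^sub>R \<eta> i w)
      = blinfun_apply (step_val e s w) x - indicator {a<..b} s *\<^sub>R (\<Sum>h\<in>A. (h \<bullet> x) *\<^sub>R R w h)"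
      unfolding I_def val using A
      by (subst sum.Plus) (auto simp: defs scaleR_sum_right sum_negf)
    also have "\<dots> = blinfun_apply (\<Delta> s w) x + indicator {a<..b} s *\<^sub>R (if x \<in> A then 0 else R w x)"
      unfolding RA \<Delta>_def by (simp add: minus_blinfun.rep_eq scaleR_blinfun.rep_eq)
    finally have sum_eq: "(\<Sum>i\<in>I. (indicator {ia i<..ib i} s * (ih i \<bullet> x)) *\<^sub>R \<eta> i w)
      = blinfun_apply (\<Delta> s w) x + indicator {a<..b} s *\<^sub>R (if x \<in> A then 0 else R w x)" .
    have "(norm (\<Sum>i\<in>I. (indicator {ia i<..ib i} s * (ih i \<bullet> x)) *\<^sub>R \<eta> i w))\<^sup>2
      \<le> 2 * (norm (blinfun_apply (\<Delta> s w) x))\<^sup>2 + 2 * (norm (indicator {a<..b} s *\<^sub>R (if x \<in> A then 0 else R w x)))\<^sup>2"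
      unfolding sum_eq by (rule norm_add_sq_le)
    also have "\<dots> \<le> 2 * (norm (blinfun_apply (\<Delta> s w) x))\<^sup>2 + 2 * ((norm (R w x))\<^sup>2 - (if x \<in> A then (norm (R w x))\<^sup>2 else 0))"
      by (auto simp: indicator_def)
    finally show "(norm (\<Sum>i\<in>I. (indicator {ia i<..ib i} s * (ih i \<bullet> x)) *\<^sub>R \<eta> i w))\<^sup>2
      \<le> 2 * (norm (blinfun_apply (\<Delta> s w) x))\<^sup>2 + 2 * ((norm (R w x))\<^sup>2 - (if x \<in> A then (norm (R w x))\<^sup>2 else 0))" .
  qed
  have RM: "(\<lambda>w. R w h) \<in> borel_measurable M" if "h \<in> B" for h
    using measurable_M_Fil[OF _ _ R(2)[OF that]] ab by auto
  have [measurable]: "(\<lambda>w. hs_norm B (R w)) \<in> borel_measurable M"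
    by (intro measurable_hs_norm R RM)
  have tM[measurable]: "t \<in> borel_measurable M"
    unfolding t_def using A RM by (intro borel_measurable_diff borel_measurable_sum borel_measurable_power borel_measurable_norm) auto
  have \<eta>M: "\<eta> i \<in> borel_measurable M" if "i \<in> I" for i
    using measurable_M_Fil[OF _ _ i\<eta>[OF that]] iab[OF that] by auto
  have indM: "(\<lambda>z. indicator {c<..d} (fst z) :: real) \<in> borel_measurable (time_measure T \<Otimes>\<^sub>M M)" for c d
    by (intro measurable_compose[OF measurable_fst] measurable_time) measurable
  have "(\<lambda>z. hs_norm B (\<Delta> (fst z) (snd z))) \<in> borel_measurable (time_measure T \<Otimes>\<^sub>M M)"
  proof (intro measurable_hs_norm \<Delta>_hs)
    fix x assume x: "x \<in> B"
    have "(\<lambda>z. blinfun_apply (step_val e (fst z) (snd z)) x) \<in> borel_measurable (time_measure T \<Otimes>\<^sub>M M)"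
      unfolding val
      by (intro borel_measurable_sum borel_measurable_scaleR borel_measurable_times indM borel_measurable_const
          measurable_compose[OF measurable_snd \<eta>M]) (auto simp: I_def)
    then show "(\<lambda>z. blinfun_apply (\<Delta> (fst z) (snd z)) x) \<in> borel_measurable (time_measure T \<Otimes>\<^sub>M M)"
      unfolding \<Delta>_def minus_blinfun.rep_eq scaleR_blinfun.rep_eq
      by (intro borel_measurable_diff borel_measurable_scaleR indM measurable_compose[OF measurable_snd RM[OF x]])
  qed
  then have m1[measurable]: "(\<lambda>z. ennreal ((hs_norm B (\<Delta> (fst z) (snd z)))\<^sup>2)) \<in> borel_measurable (time_measure T \<Otimes>\<^sub>M M)"
    by measurable
  have m2[measurable]: "(\<lambda>z. ennreal (t (snd z))) \<in> borel_measurable (time_measure T \<Otimes>\<^sub>M M)"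
    using tM by measurable
  have "(\<integral>\<^sup>+w. ennreal ((norm (step_integral W e w - (\<Sum>h\<in>A. incr a b h w *\<^sub>R R w h)))\<^sup>2) \<partial>M)
    = (\<integral>\<^sup>+w. ennreal ((norm (?X w))\<^sup>2) \<partial>M)"
    using AE by (intro nn_integral_cong_AE) (auto elim: eventually_mono)
  also have "\<dots> = (\<integral>\<^sup>+z. ennreal (ito_density I ia ib ih \<eta> (fst z) (snd z)) \<partial>(time_measure T \<Otimes>\<^sub>M M))"
    by (rule trans[OF ito_sum_energy[OF ctx] ito_density_energy[OF ctx, symmetric]])
  also have "\<dots> \<le> (\<integral>\<^sup>+z. 2 * ennreal ((hs_norm B (\<Delta> (fst z) (snd z)))\<^sup>2) + 2 * ennreal (t (snd z)) \<partial>(time_measure T \<Otimes>\<^sub>M M))"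
  proof (intro nn_integral_mono)
    fix z
    have "ennreal (ito_density I ia ib ih \<eta> (fst z) (snd z)) \<le> ennreal (2 * (hs_norm B (\<Delta> (fst z) (snd z)))\<^sup>2 + 2 * t (snd z))"
      by (rule ennreal_leI[OF dens])
    then show "ennreal (ito_density I ia ib ih \<eta> (fst z) (snd z))
      \<le> 2 * ennreal ((hs_norm B (\<Delta> (fst z) (snd z)))\<^sup>2) + 2 * ennreal (t (snd z))"
      using t0 by (simp add: ennreal_plus ennreal_mult)
  qed
  also have "\<dots> = 2 * (\<integral>\<^sup>+z. ennreal ((hs_norm B (\<Delta> (fst z) (snd z)))\<^sup>2) \<partial>(time_measure T \<Otimes>\<^sub>M M))
    + 2 * (\<integral>\<^sup>+z. ennreal (t (snd z)) \<partial>(time_measure T \<Otimes>\<^sub>M M))"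
    unfolding nn_integral_cmult[OF m1, symmetric] nn_integral_cmult[OF m2, symmetric]
    by (rule nn_integral_add) measurable
  also have "(\<integral>\<^sup>+z. ennreal (t (snd z)) \<partial>(time_measure T \<Otimes>\<^sub>M M)) = (\<integral>\<^sup>+s. \<integral>\<^sup>+w. ennreal (t w) \<partial>M \<partial>time_measure T)"
    by (subst nn_integral_fst[symmetric]) auto
  also have "\<dots> = ennreal T * (\<integral>\<^sup>+w. ennreal (t w) \<partial>M)"
    using T_pos by (simp add: emeasure_restrict_space space_restrict_space mult.commute)
  finally show ?thesis
    unfolding \<Delta>_def t_def by (simp add: split_beta' mult.assoc)
qed

text \<open>The step processes defining \<open>J\<close> are unknown, so the finite sums are
  compared with \<open>J\<close> through them. For a fixed number of basis vectors the step index
  tends to infinity first and only the tail of \<open>R\<close> remains; that tail vanishes by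
  dominated convergence, for which \<open>K\<close> bounds the norm. The Ito integral thereby takes
  the form treated by \<open>increment_moment_le\<close>.\<close>

lemma ito_integral_is_increment_limit:
  fixes R :: "'w \<Rightarrow> 'h \<Rightarrow>\<^sub>L 'y::{real_inner, banach, second_countable_topology}"
  assumes J: "has_ito_integral M Fil T B W (\<lambda>s w. R w) a b J" and ab: "0 \<le> a" "a \<le> b" "b \<le> T"
    and R: "\<And>w. R w \<in> hs_ops B" "\<And>h. h \<in> B \<Longrightarrow> (\<lambda>w. R w h) \<in> borel_measurable (Fil a)" "\<And>w. hs_norm B (R w) \<le> K"
  shows "(\<lambda>n. \<integral>\<^sup>+w. ennreal ((norm ((\<Sum>h\<in>exhaust n. incr a b h w *\<^sub>R R w h) - J w))\<^sup>2) \<partial>M) \<longlonglongrightarrow> 0"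
proof -
  have JM[measurable]: "J \<in> borel_measurable M" using J by (simp add: has_ito_integral_def)
  obtain e where e: "\<And>n. adapted_step Fil T (e n)"
    and e1: "(\<lambda>n. \<integral>\<^sup>+(s, w). ennreal ((hs_norm B (step_val (e n) s w - indicator {a<..b} s *\<^sub>R R w))\<^sup>2)
               \<partial>(time_measure T \<Otimes>\<^sub>M M)) \<longlonglongrightarrow> 0"
    and e2: "(\<lambda>n. \<integral>\<^sup>+w. ennreal ((norm (step_integral W (e n) w - J w))\<^sup>2) \<partial>M) \<longlonglongrightarrow> 0"
    using J unfolding has_ito_integral_def by auto
  have RM: "(\<lambda>w. R w h) \<in> borel_measurable M" if "h \<in> B" for h
    using measurable_M_Fil[OF _ _ R(2)[OF that]] ab by auto
  have RMe[measurable]: "(\<lambda>w. R w h) \<in> borel_measurable M" if "h \<in> exhaust n" for h n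
    using RM exhaust that by blast
  define t where "t m w = (hs_norm B (R w))\<^sup>2 - (\<Sum>h\<in>exhaust m. (norm (R w h))\<^sup>2)" for m w
  have t0: "0 \<le> t m w" for m w unfolding t_def using sum_le_hs_norm_sq[OF R(1) exhaust] by simp
  have [measurable]: "(\<lambda>w. hs_norm B (R w)) \<in> borel_measurable M"
    by (intro measurable_hs_norm R RM)
  have tM[measurable]: "t m \<in> borel_measurable M" for m
    unfolding t_def by (intro borel_measurable_diff borel_measurable_sum borel_measurable_power borel_measurable_norm RMe) auto
  let ?Z = "\<lambda>m w. \<Sum>h\<in>exhaust m. incr a b h w *\<^sub>R R w h"
  have ZM[measurable]: "?Z m \<in> borel_measurable M" for m
    by (intro borel_measurable_sum borel_measurable_scaleR incr_measurable RMe)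
  have SM[measurable]: "step_integral W (e n) \<in> borel_measurable M" for n
  proof -
    have "(\<lambda>w. case e n ! i of (a, b, D, h, y) \<Rightarrow> (indicator D w * incr a b h w) *\<^sub>R y) \<in> borel_measurable M"
      if "i < length (e n)" for i
    proof -
      obtain c d D h y where en: "e n ! i = (c, d, D, h, y)" by (metis prod_cases5)
      have "0 \<le> c" "c \<le> T" "D \<in> sets (Fil c)"
        using e[of n] nth_mem[OF that] unfolding en adapted_step_def by auto
      then have [measurable]: "D \<in> sets M" using subalgebra_Fil[of c] unfolding subalgebra_def by auto
      show ?thesis unfolding en by simp
    qed
    then show ?thesis
      unfolding step_integral_def[abs_def] sum_list_map_nth by (intro borel_measurable_sum) auto
  qed
  have bound: "(\<integral>\<^sup>+w. ennreal ((norm (?Z m w - J w))\<^sup>2) \<partial>M) \<le> 4 * ennreal T * (\<integral>\<^sup>+w. ennreal (t m w) \<partial>M)" for m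
  proof -
    let ?E = "\<lambda>n. \<integral>\<^sup>+(s, w). ennreal ((hs_norm B (step_val (e n) s w - indicator {a<..b} s *\<^sub>R R w))\<^sup>2)
               \<partial>(time_measure T \<Otimes>\<^sub>M M)"
    let ?D = "\<lambda>n. \<integral>\<^sup>+w. ennreal ((norm (step_integral W (e n) w - J w))\<^sup>2) \<partial>M"
    let ?t = "2 * ennreal T * (\<integral>\<^sup>+w. ennreal (t m w) \<partial>M)"
    have le: "(\<integral>\<^sup>+w. ennreal ((norm (?Z m w - J w))\<^sup>2) \<partial>M) \<le> 2 * (2 * ?E n + ?t) + 2 * ?D n" for n
    proof -
      have "(\<integral>\<^sup>+w. ennreal ((norm (?Z m w - J w))\<^sup>2) \<partial>M)
        \<le> (\<integral>\<^sup>+w. 2 * ennreal ((norm (step_integral W (e n) w - ?Z m w))\<^sup>2) + 2 * ennreal ((norm (step_integral W (e n) w - J w))\<^sup>2) \<partial>M)"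
      proof (intro nn_integral_mono)
        fix w
        have "(norm (?Z m w - J w))\<^sup>2 \<le> 2 * (norm (step_integral W (e n) w - ?Z m w))\<^sup>2 + 2 * (norm (step_integral W (e n) w - J w))\<^sup>2"
          using norm_add_sq_le[of "?Z m w - step_integral W (e n) w" "step_integral W (e n) w - J w"]
          by (simp add: norm_minus_commute)
        from ennreal_leI[OF this]
        show "ennreal ((norm (?Z m w - J w))\<^sup>2)
          \<le> 2 * ennreal ((norm (step_integral W (e n) w - ?Z m w))\<^sup>2) + 2 * ennreal ((norm (step_integral W (e n) w - J w))\<^sup>2)"
          by (simp add: ennreal_plus ennreal_mult)
      qed
      also have "\<dots> = 2 * (\<integral>\<^sup>+w. ennreal ((norm (step_integral W (e n) w - ?Z m w))\<^sup>2) \<partial>M) + 2 * ?D n"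
        by (simp add: nn_integral_add nn_integral_cmult)
      also have "\<dots> \<le> 2 * (2 * ?E n + ?t) + 2 * ?D n"
        using step_integral_minus_increment_le[OF e ab R exhaust]
        unfolding t_def by (intro add_mono mult_left_mono) auto
      finally show ?thesis .
    qed
    have "(\<lambda>n. 2 * (2 * ?E n + ?t) + 2 * ?D n) \<longlonglongrightarrow> 2 * (2 * 0 + ?t) + 2 * 0"
      by (intro tendsto_add ennreal_tendsto_cmult tendsto_const e1 e2) auto
    from LIMSEQ_le_const[OF this] le
    have "(\<integral>\<^sup>+w. ennreal ((norm (?Z m w - J w))\<^sup>2) \<partial>M) \<le> 2 * (2 * 0 + ?t) + 2 * 0" by blast
    also have "\<dots> = 4 * ennreal T * (\<integral>\<^sup>+w. ennreal (t m w) \<partial>M)" by (simp flip: mult.assoc)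
    finally show ?thesis .
  qed
  have "(\<lambda>m. \<integral>\<^sup>+w. ennreal (t m w) \<partial>M) \<longlonglongrightarrow> (\<integral>\<^sup>+w. 0 \<partial>M)"
  proof (rule nn_integral_dominated_convergence[where w="\<lambda>_. ennreal (K\<^sup>2)"])
    have "t m w \<le> K\<^sup>2" for m w
    proof -
      have "t m w \<le> (hs_norm B (R w))\<^sup>2" unfolding t_def by (simp add: sum_nonneg)
      also have "\<dots> \<le> K\<^sup>2" using R(3) hs_norm_nonneg by (intro power_mono)
      finally show ?thesis .
    qed
    then show "AE w in M. ennreal (t m w) \<le> ennreal (K\<^sup>2)" for m by (simp add: ennreal_leI)
    have "(\<lambda>m. ennreal (t m w)) \<longlonglongrightarrow> 0" for w
    proof -
      have "((\<lambda>A. \<Sum>h\<in>A. (norm (R w h))\<^sup>2) \<longlongrightarrow> (hs_norm B (R w))\<^sup>2) (finite_subsets_at_top B)"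
        unfolding hs_norm_sq by (intro infsum_tendsto hs_ops_sq_summable R)
      from tendsto_diff[OF tendsto_const[of "(hs_norm B (R w))\<^sup>2"] filterlim_compose[OF this filterlim_exhaust]]
      have "(\<lambda>m. t m w) \<longlonglongrightarrow> 0" unfolding t_def by simp
      then show ?thesis using tendsto_ennrealI by fastforce
    qed
    then show "AE w in M. (\<lambda>m. ennreal (t m w)) \<longlonglongrightarrow> 0" by simp
  qed (auto simp: emeasure_space_1)
  then have "(\<lambda>m. 4 * ennreal T * (\<integral>\<^sup>+w. ennreal (t m w) \<partial>M)) \<longlonglongrightarrow> 4 * ennreal T * 0"
    by (intro ennreal_tendsto_cmult) (auto simp: ennreal_mult_less_top)
  then have lim: "(\<lambda>m. 4 * ennreal T * (\<integral>\<^sup>+w. ennreal (t m w) \<partial>M)) \<longlonglongrightarrow> 0" by simp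
  show ?thesis
    by (rule tendsto_sandwich[OF _ _ tendsto_const lim]) (use bound in simp_all)
qed

end


section \<open>Stability of the scheme\<close>

text \<open>The definition ties \<open>ip\<close> to the real inner product only through the norm.
  Hermitian symmetry makes the cross terms in the square of \<open>x + y\<close> twice the real
  part, and comparison with the real expansion gives the claim.\<close>

lemma inner_eq_Re_ip:
  assumes "hilbert_scalars K sc ip"
  shows "Re (ip x y) = x \<bullet> y"
proof -
  have add: "ip (u + v) z = ip u z + ip v z" and cj: "ip v u = cnj (ip u v)"
    and sq: "ip u u = complex_of_real ((norm u)\<^sup>2)" for u v z
    using assms unfolding hilbert_scalars_def by blast+
  have add': "ip z (u + v) = ip z u + ip z v" for u v z
    using add[of u v z] cj[of z "u + v"] cj[of z u] cj[of z v] by simp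
  have "Re (ip (x + y) (x + y)) = Re (ip x x) + 2 * Re (ip x y) + Re (ip y y)"
    unfolding add add' cj[of y x] by simp
  then have "(norm (x + y))\<^sup>2 = (norm x)\<^sup>2 + 2 * Re (ip x y) + (norm y)\<^sup>2"
    unfolding sq by simp
  then show ?thesis
    by (simp add: power2_norm_eq_inner inner_add_left inner_add_right inner_commute)
qed

section \<open>From moments of \<open>1 + (norm X)\<^sup>2\<close> to norms in
  \<open>L\<^sup>q\<close>\<close>

lemma powr_one_add_sq_le:
  fixes x q :: real
  assumes "0 \<le> x" "2 \<le> q"
  shows "(1 + x\<^sup>2) powr (q / 2) \<le> 2 powr (q / 2) * (1 + x powr q)"
proof -
  have "(1 + x\<^sup>2) powr (q / 2) \<le> (2 * max 1 (x\<^sup>2)) powr (q / 2)"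
    using assms by (intro powr_mono2) (auto simp: max_def)
  also have "\<dots> = 2 powr (q / 2) * max 1 (x\<^sup>2) powr (q / 2)"
    by (rule powr_mult)
  also have "max 1 (x\<^sup>2) powr (q / 2) \<le> 1 + x powr q"
  proof (cases "x = 0")
    case False
    then have "x\<^sup>2 powr (q / 2) = x powr q"
      using assms by (simp add: powr_powr flip: powr_numeral)
    then show ?thesis by (auto simp: max_def)
  qed simp
  finally show ?thesis by (simp add: mult_left_mono)
qed

lemma one_add_powr_le:
  fixes x q :: real
  assumes "0 \<le> x" "1 \<le> q"
  shows "1 + x powr q \<le> (1 + x) powr q"
proof -
  have "1 + x powr q = 1 * 1 + x * x powr (q - 1)"
    using assms by (cases "x = 0") (auto simp: powr_mult_base)
  also have "\<dots> \<le> 1 * (1 + x) powr (q - 1) + x * (1 + x) powr (q - 1)"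
    using assms by (intro add_mono mult_left_mono powr_mono2 ge_one_powr_ge_zero) auto
  also have "\<dots> = (1 + x) powr q"
    using assms powr_mult_base[of "1 + x" "q - 1"] by (simp add: distrib_right)
  finally show ?thesis .
qed

text \<open>Origin of the final constant. For \<open>u\<close> the integrand is at most
  \<open>2 powr (q / 2) * (1 + norm (u w) powr q)\<close>, and
  \<open>1 + L powr q \<le> (1 + L) powr q\<close> for its norm \<open>L\<close>; the root of order
  \<open>q\<close> leaves \<open>sqrt 2\<close>, and the growth factor \<open>E\<close> contributes
  \<open>E powr (1 / q)\<close>. Integrability of \<open>norm (X w) powr q\<close> is a consequence,
  since the moments are taken in \<open>ennreal\<close>.\<close>

lemma (in prob_space) Lq_norm_le_of_moment:
  fixes X u :: "'a \<Rightarrow> 'y::{real_normed_vector, second_countable_topology}"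
  assumes X: "X \<in> borel_measurable M" and q: "2 \<le> q" and E: "0 \<le> E"
    and u: "Lq_norm M q u < \<infinity>"
    and le: "(\<integral>\<^sup>+w. ennreal ((1 + (norm (X w))\<^sup>2) powr (q / 2)) \<partial>M)
      \<le> ennreal E * (\<integral>\<^sup>+w. ennreal ((1 + (norm (u w))\<^sup>2) powr (q / 2)) \<partial>M)"
  shows "Lq_norm M q X \<le> ennreal (sqrt 2 * E powr (1 / q)) * (1 + Lq_norm M q u)"
proof -
  note [measurable] = X
  have um[measurable]: "u \<in> borel_measurable M" and ui: "integrable M (\<lambda>w. norm (u w) powr q)"
    using u by (auto simp: Lq_norm_def split: if_splits)
  define m where "m = (\<integral>w. norm (u w) powr q \<partial>M)"
  define L where "L = m powr (1 / q)"
  have m: "0 \<le> m" unfolding m_def by (intro integral_nonneg_AE) simp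
  have L: "0 \<le> L" "L powr q = m" unfolding L_def using m q by (auto simp: powr_powr)
  have Lu: "Lq_norm M q u = ennreal L" using um ui by (simp add: Lq_norm_def L_def m_def)
  have "(\<integral>\<^sup>+w. ennreal ((1 + (norm (u w))\<^sup>2) powr (q / 2)) \<partial>M)
    \<le> (\<integral>\<^sup>+w. ennreal (2 powr (q / 2) * (1 + norm (u w) powr q)) \<partial>M)"
    using q by (intro nn_integral_mono ennreal_leI powr_one_add_sq_le) auto
  also have "\<dots> = ennreal (\<integral>w. 2 powr (q / 2) * (1 + norm (u w) powr q) \<partial>M)"
    using ui by (intro nn_integral_eq_integral) auto
  also have "(\<integral>w. 2 powr (q / 2) * (1 + norm (u w) powr q) \<partial>M) = 2 powr (q / 2) * (1 + L powr q)"
    using ui unfolding L by (simp add: prob_space m_def)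
  also have "\<dots> \<le> 2 powr (q / 2) * (1 + L) powr q"
    using L q by (intro mult_left_mono one_add_powr_le) auto
  finally have ub: "(\<integral>\<^sup>+w. ennreal ((1 + (norm (u w))\<^sup>2) powr (q / 2)) \<partial>M) \<le> ennreal (2 powr (q / 2) * (1 + L) powr q)"
    by (simp add: ennreal_leI)
  define c where "c = E * (2 powr (q / 2) * (1 + L) powr q)"
  have "(\<integral>\<^sup>+w. ennreal (norm (X w) powr q) \<partial>M) \<le> (\<integral>\<^sup>+w. ennreal ((1 + (norm (X w))\<^sup>2) powr (q / 2)) \<partial>M)"
  proof (intro nn_integral_mono ennreal_leI)
    fix w
    have "norm (X w) powr q = ((norm (X w))\<^sup>2) powr (q / 2)"
      by (cases "X w = 0") (use q in \<open>auto simp: powr_powr simp flip: powr_numeral\<close>)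
    also have "\<dots> \<le> (1 + (norm (X w))\<^sup>2) powr (q / 2)" using q by (intro powr_mono2) auto
    finally show "norm (X w) powr q \<le> (1 + (norm (X w))\<^sup>2) powr (q / 2)" .
  qed
  also note le
  also have "ennreal E * (\<integral>\<^sup>+w. ennreal ((1 + (norm (u w))\<^sup>2) powr (q / 2)) \<partial>M) \<le> ennreal E * ennreal (2 powr (q / 2) * (1 + L) powr q)"
    by (intro mult_left_mono ub) simp
  also have "\<dots> = ennreal c" unfolding c_def using E by (simp add: ennreal_mult)
  finally have Xc: "(\<integral>\<^sup>+w. ennreal (norm (X w) powr q) \<partial>M) \<le> ennreal c" .
  have c: "0 \<le> c" unfolding c_def using E by simp
  have Xi: "integrable M (\<lambda>w. norm (X w) powr q)"
    using Xc by (intro integrableI_bounded) (auto intro: le_less_trans)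
  have "(\<integral>w. norm (X w) powr q \<partial>M) \<le> c"
    using Xc c Xi by (subst (asm) nn_integral_eq_integral) auto
  then have "(\<integral>w. norm (X w) powr q \<partial>M) powr (1 / q) \<le> c powr (1 / q)"
    using q by (intro powr_mono2 integral_nonneg_AE) auto
  also have "\<dots> = sqrt 2 * E powr (1 / q) * (1 + L)"
    unfolding c_def using E L q by (simp add: powr_mult powr_powr powr_half_sqrt)
  finally have "Lq_norm M q X \<le> ennreal (sqrt 2 * E powr (1 / q) * (1 + L))"
    using X Xi by (simp add: Lq_norm_def ennreal_leI)
  also have "\<dots> = ennreal (sqrt 2 * E powr (1 / q)) * (1 + Lq_norm M q u)"
    unfolding Lu using L by (simp add: ennreal_mult ennreal_plus)
  finally show ?thesis .
qed

section \<open>One step of the stopped scheme\<close>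

context cylindrical_brownian_motion_basis
begin

context
  fixes S :: "real \<Rightarrow> 'y \<Rightarrow>\<^sub>L 'y::{real_inner, banach, second_countable_topology}"
    and F :: "'y \<Rightarrow> 'y" and G :: "'y \<Rightarrow> 'h \<Rightarrow>\<^sub>L 'y" and q c k \<theta> :: real
  assumes S: "\<And>t. 0 \<le> t \<Longrightarrow> norm (S t) \<le> 1"
    and F[measurable]: "F \<in> borel_measurable borel" and G: "G \<in> borel \<rightarrow>\<^sub>M hs_borel B"
    and q: "2 \<le> q" and c: "0 \<le> c"
    and coercive: "\<And>x. x \<bullet> F x + (q - 1) / 2 * (hs_norm B (G x))\<^sup>2 \<le> c * (1 + (norm x)\<^sup>2)"
    and k: "0 < k" "k \<le> T" and \<theta>: "0 < \<theta>" "\<theta> \<le> 1 / 4"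
begin

abbreviation ind :: "'y \<Rightarrow> real" where "ind \<equiv> stopping_ind B F G \<theta> k"
abbreviation rate :: real where "rate \<equiv> 2 * c + 1 + T"
abbreviation moment :: "('w \<Rightarrow> 'y) \<Rightarrow> ennreal" where
  "moment X \<equiv> \<integral>\<^sup>+w. ennreal ((1 + (norm (X w))\<^sup>2) powr (q / 2)) \<partial>M"

lemma G_hs: "G x \<in> hs_ops B"
  using measurable_space[OF G, of x] space_hs_borel by auto

lemma G_eval_measurable: "h \<in> B \<Longrightarrow> (\<lambda>x. G x h) \<in> borel_measurable borel"
  using measurable_compose[OF G measurable_hs_eval] .

lemma ind_measurable[measurable]: "ind \<in> borel_measurable borel"
proof -
  have [measurable]: "(\<lambda>x. hs_norm B (G x)) \<in> borel_measurable borel"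
    by (intro measurable_hs_norm G_hs G_eval_measurable)
  show ?thesis unfolding stopping_ind_def[abs_def] by measurable
qed

lemma ind_cases: obtains "ind x = 0" | "ind x = 1" "norm (F x) \<le> k powr (- \<theta>)" "hs_norm B (G x) \<le> k powr (- \<theta>)"
proof (cases "norm (F x) + hs_norm B (G x) \<le> k powr (- \<theta>)")
  case True
  then show ?thesis
    using that(2) hs_norm_nonneg[of "G x"] norm_ge_zero[of "F x"] unfolding stopping_ind_def by simp
qed (use that(1) in \<open>simp add: stopping_ind_def\<close>)

lemma tamed_step_le:
  assumes \<tau>: "0 \<le> \<tau>" "\<tau> \<le> k"
  shows "1 + (q - 1) * (\<tau> * (ind x * hs_norm B (G x))\<^sup>2) + (norm (x + \<tau> *\<^sub>R ind x *\<^sub>R F x))\<^sup>2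
    \<le> (1 + rate * \<tau>) * (1 + (norm x)\<^sup>2)"
proof (rule ind_cases[of x])
  assume "ind x = 0"
  then show ?thesis using \<tau> c T_pos by (simp add: algebra_simps)
next
  assume i: "ind x = 1" "norm (F x) \<le> k powr (- \<theta>)"
  have "k * (k powr (- \<theta>))\<^sup>2 = k powr (1 - 2 * \<theta>)"
    using k by (simp add: powr_diff powr_minus powr_add[symmetric] power2_eq_square field_simps)
  also have "\<dots> \<le> 1 + T"
  proof (cases "k \<le> 1")
    case True
    then have "k powr (1 - 2 * \<theta>) \<le> 1" using k \<theta> by (intro powr_le1) auto
    then show ?thesis using T_pos by simp
  next
    case False
    then have "k powr (1 - 2 * \<theta>) \<le> k powr 1" using \<theta> by (intro powr_mono) auto
    then show ?thesis using k by simp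
  qed
  finally have kT: "k * (k powr (- \<theta>))\<^sup>2 \<le> 1 + T" .
  have "\<tau> * (norm (F x))\<^sup>2 \<le> k * (k powr (- \<theta>))\<^sup>2"
    using \<tau> k i(2) by (intro mult_mono power_mono) auto
  then have "\<tau> * (\<tau> * (norm (F x))\<^sup>2) \<le> \<tau> * (1 + T)"
    using kT \<tau> by (intro mult_left_mono) auto
  moreover have "(norm (x + \<tau> *\<^sub>R F x))\<^sup>2 = (norm x)\<^sup>2 + 2 * \<tau> * (x \<bullet> F x) + \<tau> * (\<tau> * (norm (F x))\<^sup>2)"
    unfolding power2_norm_eq_inner by (simp add: inner_add_left inner_add_right inner_commute algebra_simps)
  moreover have "2 * \<tau> * (x \<bullet> F x) + (q - 1) * (\<tau> * (hs_norm B (G x))\<^sup>2) \<le> 2 * \<tau> * (c * (1 + (norm x)\<^sup>2))"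
  proof -
    have "2 * \<tau> * (x \<bullet> F x) + (q - 1) * (\<tau> * (hs_norm B (G x))\<^sup>2)
      = 2 * \<tau> * (x \<bullet> F x + (q - 1) / 2 * (hs_norm B (G x))\<^sup>2)"
      by (simp add: field_simps)
    also have "\<dots> \<le> 2 * \<tau> * (c * (1 + (norm x)\<^sup>2))"
      using coercive[of x] \<tau> by (intro mult_left_mono) auto
    finally show ?thesis .
  qed
  moreover have "0 \<le> \<tau> * (1 + T) * (norm x)\<^sup>2" using \<tau> T_pos by simp
  ultimately show ?thesis using i by (simp add: algebra_simps)
qed

text \<open>\<open>L\<close> is \<open>S k\<close> for the scheme, whose noise term contains the
  semigroup inside the series, and the identity for the continuous extension, whose semigroup stands
  outside the bracket. A contraction enlarges neither the drift part nor the coefficients of the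
  noise, so both cases lead to the same bound.\<close>

lemma step_moment_le:
  fixes L :: "'y \<Rightarrow>\<^sub>L 'y" and U X :: "'w \<Rightarrow> 'y"
  assumes ab: "0 \<le> a" "a \<le> b" "b \<le> T" "b - a \<le> k" and L: "norm L \<le> 1"
    and U: "U \<in> borel_measurable (Fil a)" and X: "X \<in> borel_measurable M"
    and lim: "(\<lambda>n. \<integral>\<^sup>+w. ennreal ((norm ((\<Sum>h\<in>exhaust n. incr a b h w *\<^sub>R L (ind (U w) *\<^sub>R G (U w) h)) - X w))\<^sup>2) \<partial>M) \<longlonglongrightarrow> 0"
  shows "moment (\<lambda>w. L (U w + (b - a) *\<^sub>R ind (U w) *\<^sub>R F (U w)) + X w)
      \<le> ennreal ((1 + rate * (b - a)) powr (q / 2)) * moment U"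
    and "X \<in> borel_measurable (Fil b)"
    and "(\<lambda>w. L (U w + (b - a) *\<^sub>R ind (U w) *\<^sub>R F (U w))) \<in> borel_measurable (Fil a)"
proof -
  have Lle: "norm (L z) \<le> norm z" for z
    using norm_blinfun[of L z] mult_right_mono[OF L norm_ge_zero[of z]] by simp
  have [measurable]: "blinfun_apply L \<in> borel_measurable borel"
    by (intro borel_measurable_continuous_onI linear_continuous_on blinfun.bounded_linear_right)
  have UM[measurable]: "U \<in> borel_measurable M" using measurable_M_Fil[OF _ _ U] ab by auto
  let ?y = "\<lambda>h w. L (ind (U w) *\<^sub>R G (U w) h)"
  have y: "?y h \<in> borel_measurable (Fil a)" if "h \<in> B" for h
  proof -
    have [measurable]: "(\<lambda>x. G x h) \<in> borel_measurable borel" using that by (rule G_eval_measurable)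
    show ?thesis using U by (intro measurable_compose[OF U, of "\<lambda>x. L (ind x *\<^sub>R G x h)"]) measurable
  qed
  show v: "(\<lambda>w. L (U w + (b - a) *\<^sub>R ind (U w) *\<^sub>R F (U w))) \<in> borel_measurable (Fil a)"
    by (intro measurable_compose[OF U, of "\<lambda>x. L (x + (b - a) *\<^sub>R ind x *\<^sub>R F x)"]) measurable
  show "X \<in> borel_measurable (Fil b)"
    by (rule increment_measurable[OF ab(1-3) y exhaust X lim])
  have "(\<Sum>h\<in>exhaust n. (norm (?y h w))\<^sup>2) \<le> (ind (U w) * hs_norm B (G (U w)))\<^sup>2" for n w
  proof -
    have "(\<Sum>h\<in>exhaust n. (norm (?y h w))\<^sup>2) \<le> (\<Sum>h\<in>exhaust n. (norm ((ind (U w) *\<^sub>R G (U w)) h))\<^sup>2)"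
      by (intro sum_mono power_mono) (auto simp: scaleR_blinfun.rep_eq intro: Lle[THEN order_trans])
    also have "\<dots> \<le> (hs_norm B (ind (U w) *\<^sub>R G (U w)))\<^sup>2"
      by (intro sum_le_hs_norm_sq hs_ops_scaleR G_hs exhaust)
    finally show ?thesis by (simp add: hs_norm_scaleR power_mult_distrib)
  qed
  from increment_moment_le[OF ab(1-3) y exhaust X lim v this, of 1 "q / 2"]
  have "moment (\<lambda>w. L (U w + (b - a) *\<^sub>R ind (U w) *\<^sub>R F (U w)) + X w)
    \<le> (\<integral>\<^sup>+w. ennreal ((1 + (q - 1) * ((b - a) * (ind (U w) * hs_norm B (G (U w)))\<^sup>2)
        + (norm (L (U w + (b - a) *\<^sub>R ind (U w) *\<^sub>R F (U w))))\<^sup>2) powr (q / 2)) \<partial>M)"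
    using q by simp
  also have "\<dots> \<le> (\<integral>\<^sup>+w. ennreal ((1 + rate * (b - a)) powr (q / 2)) * ennreal ((1 + (norm (U w))\<^sup>2) powr (q / 2)) \<partial>M)"
  proof (intro nn_integral_mono)
    fix w
    have "1 + (q - 1) * ((b - a) * (ind (U w) * hs_norm B (G (U w)))\<^sup>2) + (norm (L (U w + (b - a) *\<^sub>R ind (U w) *\<^sub>R F (U w))))\<^sup>2
      \<le> 1 + (q - 1) * ((b - a) * (ind (U w) * hs_norm B (G (U w)))\<^sup>2) + (norm (U w + (b - a) *\<^sub>R ind (U w) *\<^sub>R F (U w)))\<^sup>2"
      by (intro add_left_mono power_mono Lle) simp
    also have "\<dots> \<le> (1 + rate * (b - a)) * (1 + (norm (U w))\<^sup>2)"
      using ab by (intro tamed_step_le) auto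
    finally have "(1 + (q - 1) * ((b - a) * (ind (U w) * hs_norm B (G (U w)))\<^sup>2) + (norm (L (U w + (b - a) *\<^sub>R ind (U w) *\<^sub>R F (U w))))\<^sup>2) powr (q / 2)
      \<le> ((1 + rate * (b - a)) * (1 + (norm (U w))\<^sup>2)) powr (q / 2)"
      using q ab by (intro powr_mono2) (auto intro!: add_nonneg_nonneg mult_nonneg_nonneg)
    also have "\<dots> = (1 + rate * (b - a)) powr (q / 2) * (1 + (norm (U w))\<^sup>2) powr (q / 2)"
      by (rule powr_mult)
    finally show "ennreal ((1 + (q - 1) * ((b - a) * (ind (U w) * hs_norm B (G (U w)))\<^sup>2)
        + (norm (L (U w + (b - a) *\<^sub>R ind (U w) *\<^sub>R F (U w))))\<^sup>2) powr (q / 2))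
      \<le> ennreal ((1 + rate * (b - a)) powr (q / 2)) * ennreal ((1 + (norm (U w))\<^sup>2) powr (q / 2))"
      by (simp add: ennreal_leI flip: ennreal_mult)
  qed
  also have "\<dots> = ennreal ((1 + rate * (b - a)) powr (q / 2)) * moment U"
    by (rule nn_integral_cmult) measurable
  finally show "moment (\<lambda>w. L (U w + (b - a) *\<^sub>R ind (U w) *\<^sub>R F (U w)) + X w)
      \<le> ennreal ((1 + rate * (b - a)) powr (q / 2)) * moment U" .
qed

lemma growth_powr_le:
  assumes "0 \<le> \<tau>"
  shows "(1 + rate * \<tau>) powr (q / 2) \<le> exp (rate * (q / 2) * \<tau>)"
proof -
  have "(1 + rate * \<tau>) powr (q / 2) \<le> exp (rate * \<tau>) powr (q / 2)"
    using assms c T_pos q exp_ge_add_one_self[of "rate * \<tau>"] by (intro powr_mono2) auto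
  then show ?thesis by (simp add: exp_powr_real mult_ac)
qed

lemma moment_cong_AE: "AE w in M. X w = Y w \<Longrightarrow> moment X = moment Y"
  by (rule nn_integral_cong_AE, erule eventually_mono) simp

lemma step_moment_exp_le:
  assumes "0 \<le> a" "a \<le> b" and U: "moment U \<le> ennreal (exp (rate * (q / 2) * a)) * m"
    and X: "moment X \<le> ennreal ((1 + rate * (b - a)) powr (q / 2)) * moment U"
  shows "moment X \<le> ennreal (exp (rate * (q / 2) * b)) * m"
proof -
  have "moment X \<le> ennreal (exp (rate * (q / 2) * (b - a))) * (ennreal (exp (rate * (q / 2) * a)) * m)"
    using assms by (intro order_trans[OF X] mult_mono U ennreal_leI growth_powr_le) auto
  also have "\<dots> = ennreal (exp (rate * (q / 2) * (b - a)) * exp (rate * (q / 2) * a)) * m"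
    by (simp add: ennreal_mult mult.assoc)
  also have "exp (rate * (q / 2) * (b - a)) * exp (rate * (q / 2) * a) = exp (rate * (q / 2) * b)"
    by (simp only: exp_add[symmetric] distrib_left[symmetric] diff_add_cancel)
  finally show ?thesis .
qed

section \<open>Iteration over the time grid\<close>

context
  fixes N :: nat and u0 :: "'w \<Rightarrow> 'y" and U :: "nat \<Rightarrow> 'w \<Rightarrow> 'y"
  assumes N: "1 \<le> N" and kN: "k = T / real N"
    and u0: "u0 \<in> borel_measurable (Fil 0)"
    and scheme: "exp_euler_scheme M B W S F G \<theta> T N u0 U"
begin

lemma grid: "j \<le> N \<Longrightarrow> 0 \<le> real j * k \<and> real j * k \<le> T"
proof -
  assume "j \<le> N"
  then have "real j * k \<le> real N * k" using k by (intro mult_right_mono) auto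
  also have "\<dots> = T" using N kN by simp
  finally show ?thesis using k by simp
qed

text \<open>Measurability and moment bound are proved in one induction: independence of the next
  increment requires \<open>U j\<close> to be known at its starting time. The bound is an inequality
  in \<open>ennreal\<close>, so no finiteness is carried along.\<close>

lemma scheme_step:
  assumes "j \<le> N"
  shows "U j \<in> borel_measurable (Fil (real j * k)) \<and>
    moment (U j) \<le> ennreal (exp (rate * (q / 2) * (real j * k))) * moment u0"
  using assms
proof (induction j)
  case 0
  have U0: "U 0 \<in> borel_measurable M" "AE w in M. U 0 w = u0 w"
    using scheme unfolding exp_euler_scheme_def Let_def by blast+
  have "U 0 \<in> borel_measurable (Fil 0)"
    using T_pos by (intro measurable_Fil_AE[OF _ _ u0 U0]) auto
  then show ?case
    using moment_cong_AE[OF U0(2)] by simp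
next
  case (Suc j)
  let ?a = "real j * k" and ?b = "real (Suc j) * k"
  have j: "j < N" and U: "U j \<in> borel_measurable (Fil ?a)"
    and mU: "moment (U j) \<le> ennreal (exp (rate * (q / 2) * ?a)) * moment u0"
    using Suc.IH Suc.prems by simp_all
  have ab: "0 \<le> ?a" "?a \<le> ?b" "?b \<le> T" "?b - ?a = k"
    using grid[of j] grid[of "Suc j"] j k by (auto simp: algebra_simps)
  have UM: "U (Suc j) \<in> borel_measurable M"
    using scheme Suc.prems unfolding exp_euler_scheme_def Let_def by blast
  obtain X where inc: "is_increment M B W ?a ?b (\<lambda>w. S k o\<^sub>L (ind (U j w) *\<^sub>R G (U j w))) X"
    and eq: "AE w in M. U (Suc j) w = S k (U j w) + k *\<^sub>R S k (ind (U j w) *\<^sub>R F (U j w)) + X w"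
    using scheme j unfolding exp_euler_scheme_def Let_def kN[symmetric] Suc_eq_plus1 by blast
  have X: "X \<in> borel_measurable M" using inc by (simp add: is_increment_def)
  have lim: "(\<lambda>n. \<integral>\<^sup>+w. ennreal ((norm ((\<Sum>h\<in>exhaust n. incr ?a ?b h w *\<^sub>R S k (ind (U j w) *\<^sub>R G (U j w) h)) - X w))\<^sup>2) \<partial>M) \<longlonglongrightarrow> 0"
    using filterlim_compose[OF inc[unfolded is_increment_def, THEN conjunct2] filterlim_exhaust]
    by (simp add: blinfun_apply_blinfun_compose scaleR_blinfun.rep_eq)
  have Sk: "norm (S k) \<le> 1" using S k by simp
  have ab': "?b - ?a \<le> k" using ab by simp
  note step = step_moment_le[OF ab(1-3) ab' Sk U X lim, unfolded ab(4)]
  let ?V = "\<lambda>w. S k (U j w + k *\<^sub>R ind (U j w) *\<^sub>R F (U j w)) + X w"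
  have eq': "AE w in M. U (Suc j) w = ?V w"
    using eq by eventually_elim (simp add: blinfun.add_right blinfun.scaleR_right)
  have "?V \<in> borel_measurable (Fil ?b)"
    using step(2) measurable_from_subalg[OF subalgebra_Fil_mono[OF ab(1-3)] step(3)] by simp
  then have "U (Suc j) \<in> borel_measurable (Fil ?b)"
    using ab by (intro measurable_Fil_AE[OF _ _ _ UM eq']) auto
  moreover have "moment (U (Suc j)) \<le> ennreal (exp (rate * (q / 2) * ?b)) * moment u0"
    using step(1) unfolding moment_cong_AE[OF eq']
    by (intro step_moment_exp_le[OF ab(1,2) mU]) (simp only: ab(4))
  ultimately show ?case by blast
qed

lemma exp_rate_le: "s \<le> T \<Longrightarrow> ennreal (exp (rate * (q / 2) * s)) * m \<le> ennreal (exp (rate * (q / 2) * T)) * m"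
  using c T_pos q by (intro mult_right_mono ennreal_leI) (auto intro!: mult_left_mono)

lemma scheme_moment_le:
  assumes "j \<le> N"
  shows "moment (U j) \<le> ennreal (exp (rate * (q / 2) * T)) * moment u0"
  using scheme_step[OF assms] grid[OF assms] exp_rate_le order_trans by blast

lemma scheme_measurable: "j \<le> N \<Longrightarrow> U j \<in> borel_measurable M"
  using scheme unfolding exp_euler_scheme_def Let_def by blast

lemma grid_index:
  assumes "0 \<le> s" "s < T"
  shows "nat \<lfloor>s / k\<rfloor> < N" "s \<in> {real (nat \<lfloor>s / k\<rfloor>) * k..<real (nat \<lfloor>s / k\<rfloor> + 1) * k}"
proof -
  define n where "n = \<lfloor>s / k\<rfloor>"
  have r: "real (nat n) = of_int n" using assms k by (simp add: n_def)
  have n: "of_int n \<le> s / k" "s / k < of_int n + 1" unfolding n_def by linarith+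
  from n have "of_int n * k \<le> s" "s < (of_int n + 1) * k"
    using k by (simp_all add: pos_le_divide_eq pos_divide_less_eq)
  then show "s \<in> {real (nat \<lfloor>s / k\<rfloor>) * k..<real (nat \<lfloor>s / k\<rfloor> + 1) * k}"
    unfolding n_def[symmetric] of_nat_add r by simp
  have "T = real N * k" using kN N by simp
  then have "s / k < real N" using assms k by (simp add: pos_divide_less_eq)
  then have "real (nat n) < real N" unfolding r using n by linarith
  then show "nat \<lfloor>s / k\<rfloor> < N" unfolding n_def by simp
qed

text \<open>A time \<open>s < T\<close> is reached by one shortened step from the grid point below
  it, with \<open>id_blinfun\<close> in place of the semigroup; the operator
  \<open>S (s - real j * k)\<close> acts afterwards on the whole bracket and does not increase the
  norm. The exponential factors of the grid bound and of the shortened step combine to the one at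
  time \<open>s\<close>.\<close>

lemma continuous_ext_moment_le:
  assumes ext: "continuous_ext M Fil B W S F G \<theta> T N U Uhat" and s: "s \<in> {0..T}"
  shows "moment (Uhat s) \<le> ennreal (exp (rate * (q / 2) * T)) * moment u0"
proof (cases "s = T")
  case True
  have "AE w in M. Uhat T w = U N w" using ext unfolding continuous_ext_def Let_def by simp
  from moment_cong_AE[OF this] show ?thesis using scheme_moment_le[of N] True by simp
next
  case False
  define j where "j = nat \<lfloor>s / k\<rfloor>"
  let ?a = "real j * k"
  have s': "0 \<le> s" "s < T" using s False by auto
  have j: "j < N" "s \<in> {?a..<real (j + 1) * k}" using grid_index[OF s'] unfolding j_def by auto
  obtain J where J: "has_ito_integral M Fil T B W (\<lambda>r w. ind (U j w) *\<^sub>R G (U j w)) ?a s J"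
    and eq: "AE w in M. Uhat s w = S (s - ?a) (U j w + (s - ?a) *\<^sub>R ind (U j w) *\<^sub>R F (U j w) + J w)"
    using ext j unfolding continuous_ext_def Let_def kN[symmetric] by blast
  have U: "U j \<in> borel_measurable (Fil ?a)" and mU: "moment (U j) \<le> ennreal (exp (rate * (q / 2) * ?a)) * moment u0"
    using scheme_step[of j] j by auto
  have as: "0 \<le> ?a" "?a \<le> s" "s \<le> T" "s - ?a \<le> k" using j k s' by (auto simp: algebra_simps)
  have JM: "J \<in> borel_measurable M" using J by (simp add: has_ito_integral_def)
  have lim: "(\<lambda>n. \<integral>\<^sup>+w. ennreal ((norm ((\<Sum>h\<in>exhaust n. incr ?a s h w *\<^sub>R (ind (U j w) *\<^sub>R G (U j w)) h) - J w))\<^sup>2) \<partial>M) \<longlonglongrightarrow> 0"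
  proof (rule ito_integral_is_increment_limit[OF J as(1-3)])
    show "ind (U j w) *\<^sub>R G (U j w) \<in> hs_ops B" for w by (intro hs_ops_scaleR G_hs)
    \<comment> \<open>The stopping makes the integrand bounded, as the identification of the Ito
      integral with the limit of finite sums requires.\<close>
    show "hs_norm B (ind (U j w) *\<^sub>R G (U j w)) \<le> k powr (- \<theta>)" for w
      unfolding hs_norm_scaleR by (rule ind_cases[of "U j w"]) auto
    fix h assume "h \<in> B"
    then have [measurable]: "(\<lambda>x. G x h) \<in> borel_measurable borel" by (rule G_eval_measurable)
    show "(\<lambda>w. (ind (U j w) *\<^sub>R G (U j w)) h) \<in> borel_measurable (Fil ?a)"
      unfolding scaleR_blinfun.rep_eq
      by (intro measurable_compose[OF U, of "\<lambda>x. ind x *\<^sub>R G x h"]) measurable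
  qed
  have "moment (\<lambda>w. U j w + (s - ?a) *\<^sub>R ind (U j w) *\<^sub>R F (U j w) + J w)
    \<le> ennreal ((1 + rate * (s - ?a)) powr (q / 2)) * moment (U j)"
    using step_moment_le(1)[OF as, of id_blinfun "U j" J] U JM lim norm_blinfun_id_le
    by (simp add: scaleR_blinfun.rep_eq)
  moreover have "moment (Uhat s) \<le> moment (\<lambda>w. U j w + (s - ?a) *\<^sub>R ind (U j w) *\<^sub>R F (U j w) + J w)"
    using eq
  proof (intro nn_integral_mono_AE, eventually_elim)
    fix w
    let ?z = "U j w + (s - ?a) *\<^sub>R ind (U j w) *\<^sub>R F (U j w) + J w"
    assume w: "Uhat s w = S (s - ?a) ?z"
    have "norm (S (s - ?a) ?z) \<le> norm ?z"
      using norm_blinfun[of "S (s - ?a)" ?z] mult_right_mono[OF S norm_ge_zero, of "s - ?a" ?z] as by simp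
    then show "ennreal ((1 + (norm (Uhat s w))\<^sup>2) powr (q / 2)) \<le> ennreal ((1 + (norm ?z)\<^sup>2) powr (q / 2))"
      unfolding w using q by (intro ennreal_leI powr_mono2 add_left_mono power_mono) auto
  qed
  ultimately have "moment (Uhat s) \<le> ennreal (exp (rate * (q / 2) * s)) * moment u0"
    by (intro step_moment_exp_le[OF as(1,2) mU]) auto
  then show ?thesis using exp_rate_le[OF as(3)] order_trans by blast
qed

end

end

end

theorem proposition6p1:
  fixes K :: "complex set"
    and sc :: "complex \<Rightarrow> 'y::{real_inner, banach, second_countable_topology} \<Rightarrow> 'y"
    and ip :: "'y \<Rightarrow> 'y \<Rightarrow> complex"
    and B :: "'h::{real_inner, banach, second_countable_topology} set"
    and A :: "'y \<Rightarrow> 'y" and D :: "'y set"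
    and S :: "real \<Rightarrow> 'y \<Rightarrow>\<^sub>L 'y"
    and F :: "'y \<Rightarrow> 'y" and G :: "'y \<Rightarrow> 'h \<Rightarrow>\<^sub>L 'y"
    and q C\<^sub>q T :: real
    and M :: "'w measure" and Fil :: "real \<Rightarrow> 'w measure"
    and W :: "(real \<Rightarrow> 'h) \<Rightarrow> 'w \<Rightarrow> real"
  assumes "hilbert_scalars K sc ip"
    and "orthonormal_basis B"
    and "C0_contraction_semigroup K sc S"
    and "generator_graph S = {(x, - A x) | x. x \<in> D}"
    and "F \<in> borel_measurable borel"
    and "G \<in> borel \<rightarrow>\<^sub>M hs_borel B"
    and "2 \<le> q" and "0 \<le> C\<^sub>q"
    and "\<And>x. Re (ip x (F x)) + (q - 1) / 2 * (hs_norm B (G x))\<^sup>2 \<le> C\<^sub>q * (1 + (norm x)\<^sup>2)"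
    and "0 < T"
    and "usual_filtered_prob_space M Fil T"
    and "cylindrical_BM M Fil T W"
  shows "\<exists>C::real. 0 \<le> C \<and>
    (\<forall>\<theta> u0 N U.
       0 < \<theta> \<and> \<theta> \<le> 1 / 4 \<and>
       u0 \<in> borel_measurable (Fil 0) \<and> Lq_norm M q u0 < \<infinity> \<and>
       1 \<le> N \<and> exp_euler_scheme M B W S F G \<theta> T N u0 U \<longrightarrow>
         ennreal C * (1 + Lq_norm M q u0) < \<infinity> \<and>
         (\<forall>Uhat. continuous_ext M Fil B W S F G \<theta> T N U Uhat \<longrightarrow>
            (SUP t\<in>{0..T}. Lq_norm M q (Uhat t)) \<le> ennreal C * (1 + Lq_norm M q u0)) \<and>
         (MAX j\<in>{0..N}. Lq_norm M q (U j)) \<le> ennreal C * (1 + Lq_norm M q u0) \<and>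
         (SUP t\<in>{0..T}. Lq_norm M q (piecewise_constant_ext T N U t))
           \<le> ennreal C * (1 + Lq_norm M q u0))"
proof -
  interpret prob_space M
    using assms(11) unfolding usual_filtered_prob_space_def by blast
  interpret cylindrical_brownian_motion_basis M Fil T W B
    by unfold_locales (fact assms)+
  have S: "norm (S t) \<le> 1" if "0 \<le> t" for t
    using assms(3) that unfolding C0_contraction_semigroup_def by blast
  have coercive: "x \<bullet> F x + (q - 1) / 2 * (hs_norm B (G x))\<^sup>2 \<le> C\<^sub>q * (1 + (norm x)\<^sup>2)" for x
    using assms(9)[of x] unfolding inner_eq_Re_ip[OF assms(1)] .
  \<comment> \<open>The exponent is \<open>rate * (q / 2) * T\<close> with
    \<open>c = C\<^sub>q\<close>. It involves none of \<open>\<theta>\<close>, \<open>N\<close> and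
    \<open>u0\<close>, so the constant can be chosen before them.\<close>
  define E where "E = exp ((2 * C\<^sub>q + 1 + T) * (q / 2) * T)"
  define C where "C = sqrt 2 * E powr (1 / q)"
  have E: "0 \<le> E" and C: "0 \<le> C" unfolding E_def C_def by simp_all
  show ?thesis
  proof (intro exI[of _ C] conjI allI impI C)
    fix \<theta> u0 N U
    assume "0 < \<theta> \<and> \<theta> \<le> 1 / 4 \<and> u0 \<in> borel_measurable (Fil 0) \<and> Lq_norm M q u0 < \<infinity> \<and>
       1 \<le> N \<and> exp_euler_scheme M B W S F G \<theta> T N u0 U"
    then have \<theta>: "0 < \<theta>" "\<theta> \<le> 1 / 4" and u0: "u0 \<in> borel_measurable (Fil 0)" "Lq_norm M q u0 < \<infinity>"
      and N: "1 \<le> N" and scheme: "exp_euler_scheme M B W S F G \<theta> T N u0 U"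
      by blast+
    have k: "0 < T / real N" "T / real N \<le> T"
      using N assms(10) by (simp_all add: divide_le_eq)
    note ctx = S assms(5-8) coercive k \<theta> N refl u0(1) scheme
    have U: "Lq_norm M q (U j) \<le> ennreal C * (1 + Lq_norm M q u0)" if "j \<le> N" for j
      unfolding C_def
      using scheme_measurable[OF ctx that] assms(7) E u0(2) scheme_moment_le[OF ctx that, folded E_def]
      by (rule Lq_norm_le_of_moment)
    show "ennreal C * (1 + Lq_norm M q u0) < \<infinity>"
      using u0(2) by (simp add: ennreal_mult_less_top)
    show "(SUP t\<in>{0..T}. Lq_norm M q (Uhat t)) \<le> ennreal C * (1 + Lq_norm M q u0)"
      if ext: "continuous_ext M Fil B W S F G \<theta> T N U Uhat" for Uhat
    proof (rule SUP_least)
      fix t assume t: "t \<in> {0..T}"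
      have "Uhat t \<in> borel_measurable M"
        using ext t unfolding continuous_ext_def Let_def by blast
      then show "Lq_norm M q (Uhat t) \<le> ennreal C * (1 + Lq_norm M q u0)"
        unfolding C_def
        using assms(7) E u0(2) continuous_ext_moment_le[OF ctx ext t, folded E_def]
        by (rule Lq_norm_le_of_moment)
    qed
    show "(MAX j\<in>{0..N}. Lq_norm M q (U j)) \<le> ennreal C * (1 + Lq_norm M q u0)"
      using U by (intro Max.boundedI) auto
    show "(SUP t\<in>{0..T}. Lq_norm M q (piecewise_constant_ext T N U t)) \<le> ennreal C * (1 + Lq_norm M q u0)"
    proof (rule SUP_least)
      fix t assume t: "t \<in> {0..T}"
      show "Lq_norm M q (piecewise_constant_ext T N U t) \<le> ennreal C * (1 + Lq_norm M q u0)"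
      proof (cases "t < T")
        case True
        then show ?thesis
          using U[of "nat \<lfloor>t / (T / real N)\<rfloor>"] grid_index(1)[OF ctx, of t] t
          by (simp add: piecewise_constant_ext_def)
      next
        case False
        then show ?thesis using U[of N] by (simp add: piecewise_constant_ext_def)
      qed
    qed
  qed
qed

end
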